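(* Let $(D,V)$ be an admissible pair on a separable Hilbert space $H$. Then there exist a regular Hermite–Biehler function $E$ with no real zeros and a constant $\alpha\in\mathbb{R}$ such that $e^{i\alpha z}\mathcal{W}H=\mathcal{H}(E)$ as Hilbert spaces, i.e. the map $f\mapsto e^{i\alpha z}f$ is a unitary map of $\mathcal{W}H$ onto $\mathcal{H}(E)$.
   Context: Let $H$ be a separable complex Hilbert space. A pair $(D,V)$ of operators is called admissible if: (i) $D:\mathscr{D}(D)\subset H\to H$ is a densely defined closed linear operator; (ii) $\dim\ker D=1$; (iii) $D$ has a self-adjoint restriction with compact resolvent; (iv) $V:H\to H$ is a compact operator with $\sigma(V)=\{0\}$; (v) $\operatorname{Ran}V\subset\mathscr{D}(D)$ and $DV=I$. Fix $0\neq\phi_0\in\ker D$ and put $\phi_\lambda=(I-\lambda V)^{-1}\phi_0$ for $\lambda\in\mathbb{C}$ (then $\phi_\lambda$ spans $\ker(D-\lambda I)$). The generalized Fourier transform is $(\mathcal{W}x)(\lambda)=\langle x,\phi_{\bar\lambda}\rangle_H$ for $x\in H$, $\lambda\in\mathbb{C}$; each $\mathcal{W}x$ is entire, $\mathcal{W}$ is injective, and $\mathcal{W}H$ is regarded as a Hilbert space of entire functions with norm $\|\mathcal{W}x\|:=\|x\|_H$, so that $\mathcal{W}:H\to\mathcal{W}H$ is unitary. A Hermite–Biehler (HB) function is an entire function $E$ with $|E(z)|>|E(\bar z)|$ for all $z$ in the upper half-plane $\mathbb{C}_+$. For entire $f$ write $f^\#(z)=\overline{f(\bar z)}$. The de Branges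 space $\mathcal{H}(E)$ is the Hilbert space of entire functions $f$ with $f/E\in H^2(\mathbb{C}_+)$ and $f^\#/E\in H^2(\mathbb{C}_+)$, with norm $\|f\|^2=\int_{\mathbb{R}}|f(t)/E(t)|^2\,dt$. $E$ is called regular if $1/((z+i)E(z))\in H^2(\mathbb{C}_+)$. *)

theory Defs
  imports "HOL-Analysis.Analysis"
begin

text \<open>A complex Hilbert space is modelled as a real Banach space type 'h together with
  a complex scalar multiplication sc and an inner product ip (linear in the first,
  conjugate-linear in the second argument) inducing the norm.\<close>

definition complex_hilbert :: "(complex \<Rightarrow> 'h::banach \<Rightarrow> 'h) \<Rightarrow> ('h \<Rightarrow> 'h \<Rightarrow> complex) \<Rightarrow> bool"
  where "complex_hilbert sc ip \<longleftrightarrow>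
    (\<forall>r x. sc (complex_of_real r) x = (r::real) *\<^sub>R x) \<and>
    (\<forall>a b x. sc (a * b) x = sc a (sc b x)) \<and>
    (\<forall>a x y. sc a (x + y) = sc a x + sc a y) \<and>
    (\<forall>a b x. sc (a + b) x = sc a x + sc b x) \<and>
    (\<forall>x y z. ip (x + y) z = ip x z + ip y z) \<and>
    (\<forall>a x y. ip (sc a x) y = a * ip x y) \<and>
    (\<forall>x y. ip y x = cnj (ip x y)) \<and>
    (\<forall>x. ip x x = complex_of_real ((norm x)^2))"

definition separable_space :: "'h::topological_space itself \<Rightarrow> bool"
  where "separable_space _ \<longleftrightarrow> (\<exists>S::'h set. countable S \<and> closure S = UNIV)"

definition csubspace :: "(complex \<Rightarrow> 'h \<Rightarrow> 'h) \<Rightarrow> 'h::real_vector set \<Rightarrow> bool"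
  where "csubspace sc S \<longleftrightarrow> 0 \<in> S \<and> (\<forall>x\<in>S. \<forall>y\<in>S. x + y \<in> S) \<and> (\<forall>a. \<forall>x\<in>S. sc a x \<in> S)"

definition clinear_on :: "(complex \<Rightarrow> 'h \<Rightarrow> 'h) \<Rightarrow> 'h::real_vector set \<Rightarrow> ('h \<Rightarrow> 'h) \<Rightarrow> bool"
  where "clinear_on sc S f \<longleftrightarrow> (\<forall>x\<in>S. \<forall>y\<in>S. f (x + y) = f x + f y) \<and>
     (\<forall>a. \<forall>x\<in>S. f (sc a x) = sc a (f x))"

definition compact_op :: "(complex \<Rightarrow> 'h \<Rightarrow> 'h) \<Rightarrow> ('h::real_normed_vector \<Rightarrow> 'h) \<Rightarrow> bool"
  where "compact_op sc T \<longleftrightarrow> clinear_on sc UNIV T \<and> compact (closure (T ` ball 0 1))"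

text \<open>Spectrum of a bounded operator on a Banach space (bounded inverse is automatic).\<close>
definition cspectrum :: "(complex \<Rightarrow> 'h \<Rightarrow> 'h) \<Rightarrow> ('h::real_vector \<Rightarrow> 'h) \<Rightarrow> complex set"
  where "cspectrum sc T = {\<mu>. \<not> bij (\<lambda>x. T x - sc \<mu> x)}"

definition selfadjoint_restr ::
  "(complex \<Rightarrow> 'h \<Rightarrow> 'h) \<Rightarrow> ('h \<Rightarrow> 'h \<Rightarrow> complex) \<Rightarrow> 'h::real_normed_vector set \<Rightarrow> ('h \<Rightarrow> 'h) \<Rightarrow> bool"
  where "selfadjoint_restr sc ip S D \<longleftrightarrow> csubspace sc S \<and> clinear_on sc S D \<and> closure S = UNIV \<and>
     (\<forall>x\<in>S. \<forall>y\<in>S. ip (D x) y = ip x (D y)) \<and>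
     S = {y. \<exists>z. \<forall>x\<in>S. ip (D x) y = ip x z}"

definition compact_resolvent ::
  "(complex \<Rightarrow> 'h \<Rightarrow> 'h) \<Rightarrow> 'h::real_normed_vector set \<Rightarrow> ('h \<Rightarrow> 'h) \<Rightarrow> bool"
  where "compact_resolvent sc S D \<longleftrightarrow> (\<exists>\<mu> R. (\<forall>y. R y \<in> S \<and> D (R y) - sc \<mu> (R y) = y) \<and>
     (\<forall>x\<in>S. R (D x - sc \<mu> x) = x) \<and> compact_op sc R)"

definition admissible ::
  "(complex \<Rightarrow> 'h \<Rightarrow> 'h) \<Rightarrow> ('h \<Rightarrow> 'h \<Rightarrow> complex) \<Rightarrow> 'h::real_normed_vector set \<Rightarrow> ('h \<Rightarrow> 'h)
     \<Rightarrow> ('h \<Rightarrow> 'h) \<Rightarrow> bool"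
  where "admissible sc ip domD D V \<longleftrightarrow>
    \<comment> \<open>(i) densely defined closed linear operator\<close>
    csubspace sc domD \<and> clinear_on sc domD D \<and> closure domD = UNIV \<and>
    closed {(x, D x) | x. x \<in> domD} \<and>
    \<comment> \<open>(ii) one-dimensional kernel\<close>
    (\<exists>\<phi>. \<phi> \<noteq> 0 \<and> {x \<in> domD. D x = 0} = range (\<lambda>c. sc c \<phi>)) \<and>
    \<comment> \<open>(iii) self-adjoint restriction with compact resolvent\<close>
    (\<exists>S. S \<subseteq> domD \<and> selfadjoint_restr sc ip S D \<and> compact_resolvent sc S D) \<and>
    \<comment> \<open>(iv) V compact with spectrum {0}\<close>
    compact_op sc V \<and> cspectrum sc V = {0} \<and>
    \<comment> \<open>(v) Ran V in dom D and DV = I\<close>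
    range V \<subseteq> domD \<and> (\<forall>x. D (V x) = x)"

definition phi :: "(complex \<Rightarrow> 'h \<Rightarrow> 'h) \<Rightarrow> ('h::real_vector \<Rightarrow> 'h) \<Rightarrow> 'h \<Rightarrow> complex \<Rightarrow> 'h"
  where "phi sc V \<phi>0 w = inv (\<lambda>x. x - sc w (V x)) \<phi>0"

definition gen_fourier ::
  "(complex \<Rightarrow> 'h \<Rightarrow> 'h) \<Rightarrow> ('h \<Rightarrow> 'h \<Rightarrow> complex) \<Rightarrow> ('h::real_vector \<Rightarrow> 'h) \<Rightarrow> 'h \<Rightarrow> 'h
     \<Rightarrow> complex \<Rightarrow> complex"
  where "gen_fourier sc ip V \<phi>0 x = (\<lambda>w. ip x (phi sc V \<phi>0 (cnj w)))"

definition hermite_biehler :: "(complex \<Rightarrow> complex) \<Rightarrow> bool"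
  where "hermite_biehler E \<longleftrightarrow> E holomorphic_on UNIV \<and>
     (\<forall>z. Im z > 0 \<longrightarrow> cmod (E z) > cmod (E (cnj z)))"

definition H2_upper :: "(complex \<Rightarrow> complex) \<Rightarrow> bool"
  where "H2_upper g \<longleftrightarrow> g holomorphic_on {z. Im z > 0} \<and>
     (\<forall>y>0. integrable lborel (\<lambda>x. (cmod (g (Complex x y)))^2)) \<and>
     (\<exists>C. \<forall>y>0. (LINT x|lborel. (cmod (g (Complex x y)))^2) \<le> C)"

definition sharp :: "(complex \<Rightarrow> complex) \<Rightarrow> complex \<Rightarrow> complex"
  where "sharp f = (\<lambda>z. cnj (f (cnj z)))"

definition de_branges :: "(complex \<Rightarrow> complex) \<Rightarrow> (complex \<Rightarrow> complex) set"
  where "de_branges E = {f. f holomorphic_on UNIV \<and> H2_upper (\<lambda>z. f z / E z) \<and>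
     H2_upper (\<lambda>z. sharp f z / E z)}"

definition de_branges_norm :: "(complex \<Rightarrow> complex) \<Rightarrow> (complex \<Rightarrow> complex) \<Rightarrow> real"
  where "de_branges_norm E f = sqrt (LINT t|lborel. (cmod (f (complex_of_real t) / E (complex_of_real t)))^2)"

definition regular_HB :: "(complex \<Rightarrow> complex) \<Rightarrow> bool"
  where "regular_HB E \<longleftrightarrow> H2_upper (\<lambda>z. 1 / ((z + \<i>) * E z))"

end

theory Submission
  imports Defs "HOL-Complex_Analysis.Complex_Analysis" "HOL-Real_Asymp.Real_Asymp"
begin

text \<open>The boundary form \<open>\<langle>Dx, y\<rangle> - \<langle>x, Dy\<rangle>\<close> has rank two and is diagonalised by the eigenvectors of \<open>D\<close>
  at \<open>\<i>\<close> and \<open>-\<i>\<close>. Evaluated on the eigenvectors \<open>\<phi>\<close> it yields entire functions \<open>E0\<close>, \<open>F0\<close> with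
  \<open>2\<pi>(z - \<bar>w)K(w, z) = \<i>(\<bar>E0(w) E0(z) - \<bar>F0(w) F0(z))\<close> for the reproducing kernel \<open>K\<close> of the space
  of generalized Fourier transforms. Here \<open>F0\<^sup>#/E0\<close> extends to a zero-free entire function \<open>exp g\<close> of modulus one on
  the real line. As \<open>V\<close> is bounded, the norms of the eigenvectors decay at most like \<open>1/(1 + |z|)\<close>, so
  \<open>E0\<close> and \<open>F0\<^sup>#\<close> are bounded from below in the upper half-plane; Harnack's inequality then forces
  \<open>g(z) = \<i>(\<beta>z + \<gamma>)\<close>, and with \<open>E = exp(g/2) E0\<close> the kernel \<open>exp(\<i>\<beta>(z - \<bar>w)/2) K(w, z)\<close> is the de Branges
  kernel of \<open>E\<close>. Totality of the eigenvectors follows from comparing \<open>V(I - \<lambda>V)\<^sup>-\<^sup>1\<close>, entire in \<open>\<lambda>\<close>,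
  with the resolvent of the self-adjoint restriction, of norm at most \<open>1/|Im \<lambda>|\<close>.\<close>

section \<open>Contour shifts for line integrals\<close>

text \<open>Linearity of the exponent g is the crux: the theorem allows only the multiplier
  exp(\<i>\<alpha>z), and a zero-free entire function of modulus one on the axis may have an
  exponent of any growth. The lower bounds suffice because they bound log|E0| from below by
  logarithms; adding a suitable logarithm produces a positive harmonic function. Equality of kernels
  does not by itself identify the spaces, since membership and norm in H(E) are given by integrals
  on lines. Cauchy's formula shows that the kernel reproduces H(E) at points of the upper
  half-plane; the transform is therefore isometric on combinations of kernel vectors, Fatou's lemma
  extends membership to limits, and Riesz representation supplies preimages. Fatou's lemma gives the
  right bound only if each line norm is at most the norm on the real axis, whence the contraction
  estimate. Regularity comes from \<phi>0 = (I - \<lambda>V)\<phi>: pairing this with a fixed vector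
  writes the constant 1 as p - zq with p, q in the transform space.\<close>

lemma continuous_on_line:
  assumes "continuous_on U G" "\<And>x. Complex x y \<in> U"
  shows "continuous_on S (\<lambda>x. G (Complex x y))"
  by (rule continuous_on_compose2[OF assms(1)]) (auto simp: assms(2) intro!: continuous_intros)

lemma integral_primitive_horizontal:
  assumes P: "\<And>z. z \<in> S \<Longrightarrow> (P has_field_derivative G z) (at z within S)"
    and ab: "a \<le> b" and sub: "\<And>x. Complex x y \<in> S"
  shows "((\<lambda>x. G (Complex x y)) has_integral (P (Complex b y) - P (Complex a y))) {a..b}"
proof (rule fundamental_theorem_of_calculus[OF ab])
  fix x assume "x \<in> {a..b}"
  have "((\<lambda>x. Complex x y) has_vector_derivative 1) (at x within {a..b})"
    unfolding Complex_eq by (auto intro!: derivative_eq_intros simp: has_vector_derivative_def scaleR_conv_of_real)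
  from field_vector_diff_chain_within[OF this, of P "G (Complex x y)"]
  show "((\<lambda>x. P (Complex x y)) has_vector_derivative G (Complex x y)) (at x within {a..b})"
    using has_field_derivative_subset[OF P[OF sub], of "(\<lambda>x. Complex x y) ` {a..b}"] sub
    by (auto simp: o_def)
qed

lemma integral_primitive_vertical:
  assumes P: "\<And>z. z \<in> S \<Longrightarrow> (P has_field_derivative G z) (at z within S)"
    and ab: "a \<le> b" and sub: "\<And>y. y \<in> {a..b} \<Longrightarrow> Complex x y \<in> S"
  shows "((\<lambda>y. \<i> * G (Complex x y)) has_integral (P (Complex x b) - P (Complex x a))) {a..b}"
proof (rule fundamental_theorem_of_calculus[OF ab])
  fix y assume y: "y \<in> {a..b}"
  have "((\<lambda>y. Complex x y) has_vector_derivative \<i>) (at y within {a..b})"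
    unfolding Complex_eq by (auto intro!: derivative_eq_intros simp: has_vector_derivative_def scaleR_conv_of_real)
  from field_vector_diff_chain_within[OF this, of P "G (Complex x y)"]
  show "((\<lambda>y. P (Complex x y)) has_vector_derivative \<i> * G (Complex x y)) (at y within {a..b})"
    using has_field_derivative_subset[OF P[OF sub[OF y]], of "(\<lambda>y. Complex x y) ` {a..b}"] sub
    unfolding o_def by blast
qed

lemma integral_le_lborel_integral:
  fixes f :: "real \<Rightarrow> real"
  assumes "integrable lborel f" "\<And>x. f x \<ge> 0"
  shows "integral {a..b} f \<le> (LINT x|lborel. f x)"
proof -
  have s: "set_integrable lborel {a..b} f"
    using assms(1) unfolding set_integrable_def by (intro integrable_mult_indicator) auto
  have "integral {a..b} f = (LINT x:{a..b}|lborel. f x)"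
    using set_borel_integral_eq_integral(2)[OF s] by simp
  also have "\<dots> \<le> (LINT x|lborel. f x)"
    unfolding set_lebesgue_integral_def
    using s assms unfolding set_integrable_def by (intro integral_mono) (auto split: split_indicator)
  finally show ?thesis .
qed

lemma tendsto_integral_symmetric:
  fixes f :: "real \<Rightarrow> complex" and X :: "nat \<Rightarrow> real"
  assumes f: "integrable lborel f" and X: "filterlim X at_top sequentially"
  shows "(\<lambda>n. integral {- X n .. X n} f) \<longlonglongrightarrow> (LINT x|lborel. f x)"
proof -
  have s: "set_integrable lborel {- X n .. X n} f" for n
    using f unfolding set_integrable_def by (intro integrable_mult_indicator) auto
  have "(\<lambda>n. LINT x|lborel. indicator {- X n .. X n} x *\<^sub>R f x) \<longlonglongrightarrow> (LINT x|lborel. f x)"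
  proof (rule integral_dominated_convergence[where w = "\<lambda>x. norm (f x)"])
    show "AE x in lborel. (\<lambda>n. indicator {- X n .. X n} x *\<^sub>R f x) \<longlonglongrightarrow> f x"
    proof (rule AE_I2)
      fix x
      have "eventually (\<lambda>n. X n \<ge> \<bar>x\<bar>) sequentially"
        using X by (simp add: filterlim_at_top)
      then have "eventually (\<lambda>n. indicator {- X n .. X n} x *\<^sub>R f x = f x) sequentially"
        by eventually_elim (auto simp: abs_le_iff)
      then show "(\<lambda>n. indicator {- X n .. X n} x *\<^sub>R f x) \<longlonglongrightarrow> f x"
        by (rule tendsto_eventually)
    qed
  qed (use f in \<open>auto split: split_indicator\<close>)
  then show ?thesis
    using set_borel_integral_eq_integral(2)[OF s] by (simp add: set_lebesgue_integral_def)
qed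

text \<open>No pointwise decay is assumed, so the vertical sides of the rectangle with corners -X
  and X are controlled on average only. Their contribution \<open>v\<close> has integral at most 2YC
  over [N, 2N] by Fubini, hence some X in that interval has \<open>v X\<close> at most 2YC/N.
  Letting N grow along such X closes the contour.\<close>

lemma line_integral_shift:
  fixes G :: "complex \<Rightarrow> complex"
  assumes hol: "G holomorphic_on U" and U: "open U" "{z. 0 \<le> Im z \<and> Im z \<le> Y} \<subseteq> U" and Y: "0 \<le> Y"
    and int: "\<And>y. 0 \<le> y \<Longrightarrow> y \<le> Y \<Longrightarrow> integrable lborel (\<lambda>x. G (Complex x y))"
    and bd: "\<And>y. 0 \<le> y \<Longrightarrow> y \<le> Y \<Longrightarrow> (LINT x|lborel. cmod (G (Complex x y))) \<le> C"
  shows "(LINT x|lborel. G (Complex x Y)) = (LINT x|lborel. G (Complex x 0))"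
proof -
  define S where "S = {z. 0 \<le> Im z \<and> Im z \<le> Y}"
  have "convex S"
    unfolding S_def by (intro convex_halfspace_Im_ge convex_halfspace_Im_le convex_Int[of "{z. 0 \<le> Im z}" "{z. Im z \<le> Y}", unfolded Int_def, simplified])
  have contS: "continuous_on S G"
    using hol U holomorphic_on_imp_continuous_on continuous_on_subset unfolding S_def by blast
  have diff: "G field_differentiable at z" if "z \<in> S" for z
    using that hol U holomorphic_on_imp_differentiable_at unfolding S_def by blast
  obtain P where P: "\<And>z. z \<in> S \<Longrightarrow> (P has_field_derivative G z) (at z within S)"
    using holomorphic_convex_primitive[OF \<open>convex S\<close> finite.emptyI contS]
      diff interior_subset by (metis Diff_empty subset_iff)
  define v where "v X = integral {0..Y} (\<lambda>y. cmod (G (Complex X y)) + cmod (G (Complex (- X) y)))" for X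
  \<comment> \<open>The sign s is later 1 or -1, so that the right and the left side of the
    rectangle share one computation.\<close>
  have cont2: "continuous_on (cbox (a, 0) (b, Y)) (\<lambda>(x, y). cmod (G (Complex (s * x) y)))" for a b s
    unfolding split_def
    by (intro continuous_intros continuous_on_compose2[OF contS]) (auto simp: S_def cbox_Pair_eq)
  have contv: "continuous_on {0..Y} (\<lambda>y. cmod (G (Complex x y)))" for x
    by (intro continuous_intros continuous_on_compose2[OF contS]) (auto simp: S_def)
  have C0: "C \<ge> 0"
    using order_trans[OF Bochner_Integration.integral_nonneg bd[of 0]] Y by simp
  have step: "norm (integral {- X..X} (\<lambda>x. G (Complex x Y)) - integral {- X..X} (\<lambda>x. G (Complex x 0))) \<le> v X"
    if X: "X \<ge> 0" for X
  proof -
    have h: "integral {- X..X} (\<lambda>x. G (Complex x y)) = P (Complex X y) - P (Complex (- X) y)"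
      if "0 \<le> y" "y \<le> Y" for y
      using integral_primitive_horizontal[of S P G "-X" X y, OF P] X that by (auto simp: S_def intro!: integral_unique)
    have k: "((\<lambda>y. \<i> * G (Complex x y)) has_integral (P (Complex x Y) - P (Complex x 0))) {0..Y}" for x
      using integral_primitive_vertical[of S P G 0 Y x, OF P] Y by (auto simp: S_def)
    have "((\<lambda>y. \<i> * G (Complex X y) - \<i> * G (Complex (- X) y)) has_integral
        (P (Complex X Y) - P (Complex X 0)) - (P (Complex (- X) Y) - P (Complex (- X) 0))) {0..Y}"
      by (intro has_integral_diff k)
    then have eq: "integral {- X..X} (\<lambda>x. G (Complex x Y)) - integral {- X..X} (\<lambda>x. G (Complex x 0))
        = integral {0..Y} (\<lambda>y. \<i> * G (Complex X y) - \<i> * G (Complex (- X) y))"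
      and ii: "(\<lambda>y. \<i> * G (Complex X y) - \<i> * G (Complex (- X) y)) integrable_on {0..Y}"
      using h[of Y] h[of 0] Y by (auto simp: integral_unique has_integral_integrable)
    show ?thesis unfolding eq v_def
    proof (rule integral_norm_bound_integral[OF ii])
      show "(\<lambda>y. cmod (G (Complex X y)) + cmod (G (Complex (- X) y))) integrable_on {0..Y}"
        by (intro integrable_continuous_interval continuous_intros contv)
    qed (metis (no_types, lifting) norm_mult norm_ii mult_1 norm_triangle_ineq4)
  qed
  have ex: "\<exists>X. real n + 1 \<le> X \<and> X \<le> 2 * (real n + 1) \<and> v X \<le> 2 * Y * C / (real n + 1)" for n :: nat
  proof (rule ccontr)
    define N where "N = real n + 1"
    have N: "N > 0" by (simp add: N_def)
    assume "\<not> ?thesis"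
    then have gt: "v X > 2 * Y * C / N" if "X \<in> {N..2*N}" for X
      using that unfolding N_def by (metis atLeastAtMost_iff not_le)
    have cv: "continuous_on {N..2*N} v"
      unfolding v_def
    proof (rule integral_continuous_on_param[of "{N..2*N}" 0 Y "\<lambda>X y. cmod (G (Complex X y)) + cmod (G (Complex (- X) y))", simplified])
      show "continuous_on ({N..2*N} \<times> {0..Y}) (\<lambda>(X, y). cmod (G (Complex X y)) + cmod (G (Complex (- X) y)))"
        using continuous_on_add[OF cont2[of N "2*N" 1] cont2[of N "2*N" "-1"]]
        by (simp add: cbox_Pair_eq split_def)
    qed
    have sw: "integral {N..2*N} (\<lambda>X. integral {0..Y} (\<lambda>y. cmod (G (Complex (s * X) y))))
      = integral {0..Y} (\<lambda>y. integral {N..2*N} (\<lambda>X. cmod (G (Complex (s * X) y))))" for s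
      using integral_swap_continuous[OF cont2[of N "2*N" s]] by simp
    have le: "integral {N..2*N} (\<lambda>X. cmod (G (Complex (s * X) y))) \<le> C"
      if "0 \<le> y" "y \<le> Y" "s = 1 \<or> s = -1" for s y
    proof -
      have i: "integrable lborel (\<lambda>x. G (Complex (s * x) y))"
        using lborel_integrable_real_affine[OF int[OF that(1,2)], of s 0] that(3) by auto
      have "(LINT x|lborel. cmod (G (Complex x y))) = \<bar>s\<bar> *\<^sub>R (LINT x|lborel. cmod (G (Complex (0 + s * x) y)))"
        by (rule lborel_integral_real_affine) (use that(3) in auto)
      then have "(LINT x|lborel. cmod (G (Complex (s * x) y))) \<le> C"
        using bd[OF that(1,2)] that(3) by auto
      then show ?thesis
        using integral_le_lborel_integral[of "\<lambda>x. cmod (G (Complex (s * x) y))" N "2*N"] i by auto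
    qed
    have ci: "continuous_on {0..Y} (\<lambda>y. integral {N..2*N} (\<lambda>X. cmod (G (Complex (s * X) y))))" for s
    proof (rule integral_continuous_on_param[of "{0..Y}" N "2*N" "\<lambda>y X. cmod (G (Complex (s * X) y))", simplified])
      show "continuous_on ({0..Y} \<times> {N..2*N}) (\<lambda>(y, X). cmod (G (Complex (s * X) y)))"
        unfolding split_def
        by (intro continuous_intros continuous_on_compose2[OF contS]) (auto simp: S_def)
    qed
    have one: "integral {N..2*N} (\<lambda>X. integral {0..Y} (\<lambda>y. cmod (G (Complex (s * X) y)))) \<le> Y * C"
      if "s = 1 \<or> s = -1" for s
    proof -
      have "integral {0..Y} (\<lambda>y. integral {N..2*N} (\<lambda>X. cmod (G (Complex (s * X) y)))) \<le> integral {0..Y} (\<lambda>y. C)"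
        by (intro integral_le integrable_continuous_interval ci) (use le that in auto)
      then show ?thesis using sw[of s] Y by simp
    qed
    have cvs: "continuous_on {N..2*N} (\<lambda>X. integral {0..Y} (\<lambda>y. cmod (G (Complex (s * X) y))))" for s
    proof (rule integral_continuous_on_param[of "{N..2*N}" 0 Y "\<lambda>X y. cmod (G (Complex (s * X) y))", simplified])
      show "continuous_on ({N..2*N} \<times> {0..Y}) (\<lambda>(X, y). cmod (G (Complex (s * X) y)))"
        using cont2[of N "2*N" s] by (simp add: cbox_Pair_eq)
    qed
    have vsplit: "v X = integral {0..Y} (\<lambda>y. cmod (G (Complex (1 * X) y))) + integral {0..Y} (\<lambda>y. cmod (G (Complex (-1 * X) y)))" for X
      unfolding v_def by (subst integral_add) (auto intro!: integrable_continuous_interval contv)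
    have "integral {N..2*N} v = integral {N..2*N} (\<lambda>X. integral {0..Y} (\<lambda>y. cmod (G (Complex (1 * X) y))))
        + integral {N..2*N} (\<lambda>X. integral {0..Y} (\<lambda>y. cmod (G (Complex (-1 * X) y))))"
      unfolding vsplit by (intro integral_add integrable_continuous_interval cvs)
    also have "\<dots> \<le> 2 * Y * C"
      using one[of 1] one[of "-1"] by simp
    finally have up: "integral {N..2*N} v \<le> 2 * Y * C" .
    have "integral {N..2*N} (\<lambda>X. 2 * Y * C / N) < integral {N..2*N} v"
      by (rule integral_less_real) (use gt N cv in \<open>auto simp: not_le\<close>)
    then show False using up N by simp
  qed
  obtain X where X: "\<And>n. real n + 1 \<le> X n" "\<And>n. v (X n) \<le> 2 * Y * C / (real n + 1)"
    using ex by metis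
  have "real n \<le> X n" for n
    using X(1)[of n] by linarith
  then have Xtop: "filterlim X at_top sequentially"
    by (intro filterlim_at_top_mono[OF filterlim_real_sequentially] always_eventually allI)
  have "(\<lambda>n. integral {- X n..X n} (\<lambda>x. G (Complex x Y)) - integral {- X n..X n} (\<lambda>x. G (Complex x 0))) \<longlonglongrightarrow> 0"
  proof (rule Lim_null_comparison)
    show "\<forall>\<^sub>F n in sequentially. norm (integral {- X n..X n} (\<lambda>x. G (Complex x Y)) - integral {- X n..X n} (\<lambda>x. G (Complex x 0))) \<le> 2 * Y * C / (real n + 1)"
    proof (intro always_eventually allI)
      fix n show "norm (integral {- X n..X n} (\<lambda>x. G (Complex x Y)) - integral {- X n..X n} (\<lambda>x. G (Complex x 0))) \<le> 2 * Y * C / (real n + 1)"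
        using step[of "X n"] X(1,2)[of n] by linarith
    qed
    show "(\<lambda>n. 2 * Y * C / (real n + 1)) \<longlonglongrightarrow> 0"
      by real_asymp
  qed
  moreover have "(\<lambda>n. integral {- X n..X n} (\<lambda>x. G (Complex x Y)) - integral {- X n..X n} (\<lambda>x. G (Complex x 0)))
      \<longlonglongrightarrow> (LINT x|lborel. G (Complex x Y)) - (LINT x|lborel. G (Complex x 0))"
    using Y by (intro tendsto_diff tendsto_integral_symmetric[OF _ Xtop] int) auto
  ultimately show ?thesis using LIMSEQ_unique by fastforce
qed

section \<open>Hardy space of the upper half-plane\<close>

text \<open>With w = u + \<i>v the integrand is 1/|x - w|^2, so this is the squared norm of a Cauchy
  kernel on the real line.\<close>

lemma has_bochner_integral_Cauchy_density:
  assumes "v > 0"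
  shows "has_bochner_integral lborel (\<lambda>x::real. 1 / ((x - u)\<^sup>2 + v\<^sup>2)) (pi / v)"
proof -
  define F where "F x = arctan ((x - u) / v) / v" for x
  define f where "f x = 1 / ((x - u)\<^sup>2 + v\<^sup>2)" for x
  have pos: "(x - u)\<^sup>2 + v\<^sup>2 > 0" for x
    using assms by (simp add: add_nonneg_pos)
  have D: "DERIV F x :> f x" for x
  proof -
    have "inverse (1 + ((x - u) / v)\<^sup>2) * (1 / v) / v = f x"
      using assms pos[of x] by (simp add: f_def divide_simps power2_eq_square add_eq_0_iff)
    then show ?thesis
      unfolding F_def using assms by (auto intro!: derivative_eq_intros)
  qed
  have cont: "isCont f x" for x
    unfolding f_def using pos[of x] by (intro continuous_intros) auto
  have B: "((F \<circ> real_of_ereal) \<longlongrightarrow> pi / 2 / v) (at_left \<infinity>)"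
    unfolding ereal_tendsto_simps F_def using assms by real_asymp (simp add: divide_simps)
  have A: "((F \<circ> real_of_ereal) \<longlongrightarrow> - (pi / 2) / v) (at_right (-\<infinity>))"
    unfolding ereal_tendsto_simps F_def using assms by real_asymp (simp add: divide_simps)
  note ftc = interval_integral_FTC_nonneg[of "-\<infinity>" \<infinity> F f "- (pi/2)/v" "pi/2/v", OF _ D cont _ A B]
  have "set_integrable lborel (einterval (-\<infinity>) \<infinity>) f" "(LBINT x=-\<infinity>..\<infinity>. f x) = pi/2/v - (- (pi/2)/v)"
    using ftc pos by (auto simp: f_def less_imp_le)
  then show ?thesis
    unfolding has_bochner_integral_iff f_def[symmetric]
    by (auto simp: set_integrable_def interval_lebesgue_integral_def set_lebesgue_integral_def einterval_eq_UNIV)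
qed

text \<open>Holomorphy is required on a neighbourhood of the closed half-plane, so boundary values
  are plain restrictions and no nontangential limits occur. Quotients f/E of entire functions
  qualify when E has no zeros in the closed half-plane. The bound C is kept explicit because limits
  need it.\<close>

definition hardy_bound :: "(complex \<Rightarrow> complex) \<Rightarrow> real \<Rightarrow> bool"
  where "hardy_bound g C \<longleftrightarrow>
    (\<exists>U. open U \<and> {z. 0 \<le> Im z} \<subseteq> U \<and> g holomorphic_on U) \<and>
    (\<forall>y\<ge>0. integrable lborel (\<lambda>x. (cmod (g (Complex x y)))\<^sup>2) \<and>
           (LINT x|lborel. (cmod (g (Complex x y)))\<^sup>2) \<le> C)"

text \<open>Serves both to carry bounds from lines of positive height down to the real axis and to
  pass to limits of approximating vectors.\<close>

lemma Fatou_integral: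
  fixes F :: "nat \<Rightarrow> 'a \<Rightarrow> real"
  assumes int: "\<And>n. integrable M (F n)" and nn: "\<And>n x. F n x \<ge> 0"
    and le: "\<And>n. (LINT x|M. F n x) \<le> B n" and B: "B \<longlonglongrightarrow> C" and lim: "\<And>x. (\<lambda>n. F n x) \<longlonglongrightarrow> f x"
  shows "integrable M f" "(LINT x|M. f x) \<le> C"
proof -
  have [measurable]: "F n \<in> borel_measurable M" for n
    using int by auto
  have [measurable]: "f \<in> borel_measurable M"
    by (rule borel_measurable_LIMSEQ_real[OF lim]) auto
  have f0: "f x \<ge> 0" for x
    by (rule LIMSEQ_le_const[OF lim]) (use nn in auto)
  have "B n \<ge> 0" for n
    using order_trans[OF Bochner_Integration.integral_nonneg le] nn by blast
  then have C0: "C \<ge> 0"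
    by (intro LIMSEQ_le_const[OF B]) auto
  have "(\<integral>\<^sup>+x. ennreal (f x) \<partial>M) = (\<integral>\<^sup>+x. liminf (\<lambda>n. ennreal (F n x)) \<partial>M)"
    by (intro nn_integral_cong lim_imp_Liminf[symmetric]) (auto intro!: tendsto_ennrealI lim)
  also have "\<dots> \<le> liminf (\<lambda>n. \<integral>\<^sup>+x. ennreal (F n x) \<partial>M)"
    by (rule nn_integral_liminf) auto
  also have "\<dots> \<le> liminf (\<lambda>n. ennreal (B n))"
  proof (intro Liminf_mono always_eventually allI)
    show "(\<integral>\<^sup>+x. ennreal (F n x) \<partial>M) \<le> ennreal (B n)" for n
      using nn int le[of n] by (subst nn_integral_eq_integral) (auto intro: ennreal_leI)
  qed
  also have "\<dots> = ennreal C"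
    by (intro lim_imp_Liminf tendsto_ennrealI B) simp
  finally have *: "(\<integral>\<^sup>+x. ennreal (f x) \<partial>M) \<le> ennreal C" .
  show i: "integrable M f"
    using * f0 by (intro integrableI_nonneg) (auto simp: less_top[symmetric] top_unique le_less_trans)
  show "(LINT x|M. f x) \<le> C"
    using * f0 C0 i by (simp add: nn_integral_eq_integral)
qed

lemma hardy_bound_cont_line:
  assumes "hardy_bound g C" "y \<ge> 0"
  shows "continuous_on S (\<lambda>x. g (Complex x y))"
proof -
  obtain U where "{z. 0 \<le> Im z} \<subseteq> U" "g holomorphic_on U"
    using assms unfolding hardy_bound_def by blast
  then show ?thesis
    using assms(2) by (intro continuous_on_line[of U] holomorphic_on_imp_continuous_on) auto
qed

lemma hardy_bound_measurable:
  assumes "hardy_bound g C" "y \<ge> 0"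
  shows "(\<lambda>x. g (Complex x y)) \<in> borel_measurable lborel"
  using borel_measurable_continuous_onI[OF hardy_bound_cont_line[OF assms]] by simp

lemma hardy_bound_imp_H2_upper:
  assumes "hardy_bound g C"
  shows "H2_upper g"
proof -
  obtain U where "{z. 0 \<le> Im z} \<subseteq> U" "g holomorphic_on U"
    using assms unfolding hardy_bound_def by blast
  then have "g holomorphic_on {z. 0 < Im z}"
    by (elim holomorphic_on_subset) auto
  then show ?thesis
    unfolding H2_upper_def
  proof (intro conjI exI[where x = C] allI impI)
    fix y :: real assume "y > 0"
    then show "integrable lborel (\<lambda>x. (cmod (g (Complex x y)))\<^sup>2)" "(LINT x|lborel. (cmod (g (Complex x y)))\<^sup>2) \<le> C"
      using assms unfolding hardy_bound_def by auto
  qed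
qed

text \<open>\<open>H2_upper\<close> says nothing about the axis itself. Continuity up to the axis
  and Fatou's lemma along the heights 1/(n + 1) supply the missing line.\<close>

lemma H2_upper_imp_hardy_bound:
  assumes H2: "H2_upper g" and U: "open U" "{z. 0 \<le> Im z} \<subseteq> U" "g holomorphic_on U"
  obtains C where "hardy_bound g C"
proof -
  obtain C where C: "\<And>y. y > 0 \<Longrightarrow> (LINT x|lborel. (cmod (g (Complex x y)))\<^sup>2) \<le> C"
    and int: "\<And>y. y > 0 \<Longrightarrow> integrable lborel (\<lambda>x. (cmod (g (Complex x y)))\<^sup>2)"
    using H2 unfolding H2_upper_def by blast
  have cont: "continuous_on U g"
    using U holomorphic_on_imp_continuous_on by blast
  have lim: "(\<lambda>n. (cmod (g (Complex x (inverse (real (Suc n))))))\<^sup>2) \<longlonglongrightarrow> (cmod (g (Complex x 0)))\<^sup>2" for x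
  proof (intro tendsto_intros)
    have "isCont g (Complex x 0)"
      using cont U by (simp add: continuous_on_eq_continuous_at subset_iff)
    moreover have "(\<lambda>n. Complex x (inverse (real (Suc n)))) \<longlonglongrightarrow> Complex x 0"
      by (intro tendsto_Complex tendsto_const LIMSEQ_inverse_real_of_nat)
    ultimately show "(\<lambda>n. g (Complex x (inverse (real (Suc n))))) \<longlonglongrightarrow> g (Complex x 0)"
      by (rule isCont_tendsto_compose)
  qed
  have "integrable lborel (\<lambda>x. (cmod (g (Complex x 0)))\<^sup>2)" "(LINT x|lborel. (cmod (g (Complex x 0)))\<^sup>2) \<le> C"
    using Fatou_integral[OF int _ C tendsto_const lim] by auto
  then have "hardy_bound g C"
    unfolding hardy_bound_def using U int C by (metis less_eq_real_def)
  then show ?thesis by (rule that)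
qed

lemma hardy_bound_decay:
  assumes U: "open U" "{z. 0 \<le> Im z} \<subseteq> U" "g holomorphic_on U"
    and le: "\<And>z. 0 \<le> Im z \<Longrightarrow> (cmod (g z))\<^sup>2 \<le> K / (1 + (Re z)\<^sup>2)"
  shows "hardy_bound g (K * pi)"
proof -
  have I: "has_bochner_integral lborel (\<lambda>x::real. K * (1 / (1 + x\<^sup>2))) (K * pi)"
    using has_bochner_integral_Cauchy_density[of 1 0]
    by (intro has_bochner_integral_mult_right) (simp add: add.commute)
  have K0: "K \<ge> 0"
    using order_trans[OF zero_le_power2 le[of 0]] by simp
  have le': "(cmod (g (Complex x y)))\<^sup>2 \<le> K / (1 + x\<^sup>2)" if "y \<ge> 0" for x y
    using le[of "Complex x y"] that by simp
  have c: "continuous_on UNIV (\<lambda>x. g (Complex x y))" if "y \<ge> 0" for y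
    using U that by (intro continuous_on_line[of U] holomorphic_on_imp_continuous_on) auto
  have i: "integrable lborel (\<lambda>x. (cmod (g (Complex x y)))\<^sup>2)" if "y \<ge> 0" for y
  proof (rule Bochner_Integration.integrable_bound)
    show "integrable lborel (\<lambda>x::real. K * (1 / (1 + x\<^sup>2)))" using I by (simp add: has_bochner_integral_iff)
    have [measurable]: "(\<lambda>x. g (Complex x y)) \<in> borel_measurable borel"
      using borel_measurable_continuous_onI[OF c[OF that]] .
    show "(\<lambda>x. (cmod (g (Complex x y)))\<^sup>2) \<in> borel_measurable lborel" by simp
    show "AE x in lborel. norm ((cmod (g (Complex x y)))\<^sup>2) \<le> norm (K * (1 / (1 + x\<^sup>2)))"
      using le'[OF that] K0 by (intro AE_I2) auto
  qed
  have "(LINT x|lborel. (cmod (g (Complex x y)))\<^sup>2) \<le> K * pi" if "y \<ge> 0" for y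
  proof -
    have "(LINT x|lborel. (cmod (g (Complex x y)))\<^sup>2) \<le> (LINT x|lborel. K * (1 / (1 + x\<^sup>2)))"
      using i[OF that] I le'[OF that] by (intro integral_mono) (auto simp: has_bochner_integral_iff)
    then show ?thesis using I by (simp add: has_bochner_integral_iff)
  qed
  then show ?thesis unfolding hardy_bound_def using U i by blast
qed

lemma cmod_parallelogram: "(cmod (a + b))\<^sup>2 + (cmod (a - b))\<^sup>2 = 2 * (cmod a)\<^sup>2 + 2 * (cmod b)\<^sup>2"
  by (simp add: cmod_power2) (simp add: power2_eq_square algebra_simps)

lemma norm_diff_sq_le: "(cmod (a - b))\<^sup>2 \<le> 2 * (cmod a)\<^sup>2 + 2 * (cmod b)\<^sup>2"
  using cmod_parallelogram[of a b] by (smt (verit) zero_le_power2)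

lemma hardy_bound_diff:
  assumes g: "hardy_bound g C" and h: "hardy_bound h D"
  shows "hardy_bound (\<lambda>z. g z - h z) (2 * C + 2 * D)"
proof -
  obtain U U' where U: "open U" "{z. 0 \<le> Im z} \<subseteq> U" "g holomorphic_on U" "open U'" "{z. 0 \<le> Im z} \<subseteq> U'" "h holomorphic_on U'"
    using g h unfolding hardy_bound_def by blast
  have hol: "(\<lambda>z. g z - h z) holomorphic_on (U \<inter> U')"
    using U by (intro holomorphic_intros) (auto intro: holomorphic_on_subset)
  {
    fix y :: real assume y: "y \<ge> 0"
    have ig: "integrable lborel (\<lambda>x. 2 * (cmod (g (Complex x y)))\<^sup>2 + 2 * (cmod (h (Complex x y)))\<^sup>2)"
      using g h y unfolding hardy_bound_def by auto
    have [measurable]: "(\<lambda>x. g (Complex x y)) \<in> borel_measurable borel" "(\<lambda>x. h (Complex x y)) \<in> borel_measurable borel"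
      using hardy_bound_measurable[OF g y] hardy_bound_measurable[OF h y] by auto
    have i: "integrable lborel (\<lambda>x. (cmod (g (Complex x y) - h (Complex x y)))\<^sup>2)"
      by (rule Bochner_Integration.integrable_bound[OF ig]) (auto simp: norm_diff_sq_le)
    have "(LINT x|lborel. (cmod (g (Complex x y) - h (Complex x y)))\<^sup>2) \<le> (LINT x|lborel. 2 * (cmod (g (Complex x y)))\<^sup>2 + 2 * (cmod (h (Complex x y)))\<^sup>2)"
      by (rule integral_mono[OF i ig]) (simp add: norm_diff_sq_le)
    also have "\<dots> = 2 * (LINT x|lborel. (cmod (g (Complex x y)))\<^sup>2) + 2 * (LINT x|lborel. (cmod (h (Complex x y)))\<^sup>2)"
      using g h y unfolding hardy_bound_def by simp
    also have "\<dots> \<le> 2 * C + 2 * D"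
      using g h y unfolding hardy_bound_def by (intro add_mono mult_left_mono) auto
    finally have "(LINT x|lborel. (cmod (g (Complex x y) - h (Complex x y)))\<^sup>2) \<le> 2 * C + 2 * D" .
    note i this
  }
  then show ?thesis
    unfolding hardy_bound_def using hol U by (auto intro!: exI[of _ "U \<inter> U'"])
qed

lemma hardy_bound_cmult:
  assumes g: "hardy_bound g C"
  shows "hardy_bound (\<lambda>z. c * g z) ((cmod c)\<^sup>2 * C)"
  using g unfolding hardy_bound_def norm_mult power_mult_distrib
  by (auto intro!: mult_left_mono holomorphic_intros)

text \<open>Converts decay like 1/|z - w|^2, cut off on the unit disc about w, into decay like 1/(1
  + (Re z)^2), whose integral is the same on every horizontal line.\<close>

lemma shift_bound:
  "1 + (Re z)\<^sup>2 \<le> (3 + 2 * (Re w)\<^sup>2) * max 1 ((cmod (z - w))\<^sup>2)"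
proof -
  have "(Re z - Re w)\<^sup>2 \<le> (cmod (z - w))\<^sup>2"
    by (metis abs_Re_le_cmod minus_complex.sel(1) power2_abs power_mono abs_ge_zero)
  moreover have "(Re z)\<^sup>2 \<le> 2 * (Re z - Re w)\<^sup>2 + 2 * (Re w)\<^sup>2"
    using sum_squares_ge_zero[of "Re z - 2 * Re w" 0] by (simp add: power2_eq_square algebra_simps)
  moreover define m where "m = max 1 ((cmod (z - w))\<^sup>2)"
  moreover have "m \<ge> 1" "m \<ge> (cmod (z - w))\<^sup>2" by (auto simp: m_def)
  moreover have "2 * (Re w)\<^sup>2 * 1 \<le> 2 * (Re w)\<^sup>2 * m" using \<open>m \<ge> 1\<close> by (intro mult_left_mono) auto
  ultimately show ?thesis unfolding m_def[symmetric] by (simp add: algebra_simps)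
qed

lemma integrable_Cauchy_kernel: "integrable lborel (\<lambda>x::real. K / (1 + x\<^sup>2))"
  and integral_Cauchy_kernel: "(LINT x|lborel. K / (1 + x\<^sup>2)) = K * pi"
proof -
  have "has_bochner_integral lborel (\<lambda>x::real. K * (1 / (1 + x\<^sup>2))) (K * pi)"
    using has_bochner_integral_Cauchy_density[of 1 0]
    by (intro has_bochner_integral_mult_right) (simp add: add.commute)
  then show "integrable lborel (\<lambda>x::real. K / (1 + x\<^sup>2))" "(LINT x|lborel. K / (1 + x\<^sup>2)) = K * pi"
    by (simp_all add: has_bochner_integral_iff)
qed

lemma hardy_bound_integrable:
  assumes "hardy_bound g C" "y \<ge> 0"
  shows "integrable lborel (\<lambda>x. (cmod (g (Complex x y)))\<^sup>2)" "(LINT x|lborel. (cmod (g (Complex x y)))\<^sup>2) \<le> C"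
  using assms unfolding hardy_bound_def by auto

text \<open>The second height s*y + t admits products of g with a reflected copy of itself: s = -1
  and t = 2Y reflect at the line of height Y, while s = 1 and t = 0 give g alone. The summand with B
  absorbs Cauchy kernels.\<close>

lemma line_integral_shift_hardy:
  assumes g: "hardy_bound g C" and Y: "0 \<le> Y" and A: "A \<ge> 0"
    and U: "open U" "{z. 0 \<le> Im z \<and> Im z \<le> Y} \<subseteq> U" "G holomorphic_on U"
    and le: "\<And>x y. 0 \<le> y \<Longrightarrow> y \<le> Y \<Longrightarrow> cmod (G (Complex x y)) \<le>
        A * ((cmod (g (Complex x y)))\<^sup>2 + (cmod (g (Complex x (s * y + t))))\<^sup>2) + B / (1 + x\<^sup>2)"
    and st: "\<And>y. 0 \<le> y \<Longrightarrow> y \<le> Y \<Longrightarrow> s * y + t \<ge> 0"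
  shows "(LINT x|lborel. G (Complex x Y)) = (LINT x|lborel. G (Complex x 0))"
    and "0 \<le> y \<Longrightarrow> y \<le> Y \<Longrightarrow> integrable lborel (\<lambda>x. G (Complex x y))"
proof -
  let ?b = "\<lambda>y x. A * ((cmod (g (Complex x y)))\<^sup>2 + (cmod (g (Complex x (s * y + t))))\<^sup>2) + B / (1 + x\<^sup>2)"
  have ib: "integrable lborel (?b y)" if "0 \<le> y" "y \<le> Y" for y
    using hardy_bound_integrable[OF g that(1)] hardy_bound_integrable[OF g st[OF that]] integrable_Cauchy_kernel
    by (intro Bochner_Integration.integrable_add integrable_mult_right) auto
  have lb: "(LINT x|lborel. ?b y x) \<le> A * (C + C) + B * pi" if "0 \<le> y" "y \<le> Y" for y
    using hardy_bound_integrable[OF g that(1)] hardy_bound_integrable[OF g st[OF that]] integrable_Cauchy_kernel A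
    by (simp add: integral_Cauchy_kernel) (intro mult_left_mono add_mono; simp)
  have cont: "continuous_on UNIV (\<lambda>x. G (Complex x y))" if "0 \<le> y" "y \<le> Y" for y
    using U that by (intro continuous_on_line[of U] holomorphic_on_imp_continuous_on) auto
  have i: "integrable lborel (\<lambda>x. G (Complex x y))" if "0 \<le> y" "y \<le> Y" for y
  proof (rule Bochner_Integration.integrable_bound[OF ib[OF that]])
    show "(\<lambda>x. G (Complex x y)) \<in> borel_measurable lborel"
      using borel_measurable_continuous_onI[OF cont[OF that]] by simp
    show "AE x in lborel. norm (G (Complex x y)) \<le> norm (?b y x)"
      using le[OF that] by (intro AE_I2) (metis order_trans abs_ge_self real_norm_def)
  qed
  then show "0 \<le> y \<Longrightarrow> y \<le> Y \<Longrightarrow> integrable lborel (\<lambda>x. G (Complex x y))" by blast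
  have "(LINT x|lborel. cmod (G (Complex x y))) \<le> A * (C + C) + B * pi" if "0 \<le> y" "y \<le> Y" for y
    using order_trans[OF integral_mono[OF integrable_norm[OF i[OF that]] ib[OF that] le[OF that]] lb[OF that]] .
  then show "(LINT x|lborel. G (Complex x Y)) = (LINT x|lborel. G (Complex x 0))"
    by (intro line_integral_shift[OF U(3,1,2) Y i])
qed

section \<open>Cauchy integrals over the real line\<close>

lemma sum_prod_le: "a * b \<le> (a\<^sup>2 + b\<^sup>2) / 2" for a b :: real
  using sum_squares_bound[of a b] by simp

text \<open>G is g/(z - w) with a possible singularity at w removed. Its integral does not depend on
  the height of the line, and at large height it is small because the Cauchy kernel is small in the
  mean-square sense there.\<close>

lemma hardy_vanish:
  assumes g: "hardy_bound g C" and U: "open U" "{z. 0 \<le> Im z} \<subseteq> U" "G holomorphic_on U"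
    and eq: "\<And>z. 0 \<le> Im z \<Longrightarrow> g z = (z - w) * G z"
  shows "(LINT x|lborel. G (Complex x 0)) = 0"
proof -
  have cont: "continuous_on {z. 0 \<le> Im z} G"
    using U holomorphic_on_imp_continuous_on continuous_on_subset by blast
  have "compact ({z. 0 \<le> Im z} \<inter> cball w 1)"
    by (intro closed_Int_compact closed_halfspace_Im_ge compact_cball)
  then have "bounded (G ` ({z. 0 \<le> Im z} \<inter> cball w 1))"
    using cont by (intro compact_imp_bounded compact_continuous_image) (auto intro: continuous_on_subset)
  then obtain M where M: "M > 0" "\<And>z. 0 \<le> Im z \<Longrightarrow> cmod (z - w) \<le> 1 \<Longrightarrow> cmod (G z) \<le> M"
    by (auto simp: bounded_pos dist_norm norm_minus_commute)
  \<comment> \<open>One constant for both regions: within distance 1 of w the bound M from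
    compactness is used, outside it the inequality |g|/r \<le> (|g|^2 + 1/r^2)/2 with r = |z -
    w|.\<close>
  define K where "K = (1 + M) * (3 + 2 * (Re w)\<^sup>2)"
  have le: "cmod (G z) \<le> (cmod (g z))\<^sup>2 / 2 + K / (1 + (Re z)\<^sup>2)" if z: "0 \<le> Im z" for z
  proof (cases "cmod (z - w) \<le> 1")
    case True
    have "1 + (Re z)\<^sup>2 \<le> 3 + 2 * (Re w)\<^sup>2"
      using shift_bound[of z w] True by (simp add: max_absorb1 power_le_one)
    then have "(1 + M) * (1 + (Re z)\<^sup>2) \<le> K"
      unfolding K_def using M(1) by (intro mult_left_mono) auto
    then have "1 + M \<le> K / (1 + (Re z)\<^sup>2)"
      by (subst pos_le_divide_eq) (auto simp: add_pos_nonneg)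
    then show ?thesis using M(2)[OF z True] by (smt (verit) zero_le_power2 divide_nonneg_nonneg)
  next
    case False
    let ?r = "cmod (z - w)"
    have "1 + (Re z)\<^sup>2 \<le> (3 + 2 * (Re w)\<^sup>2) * ?r\<^sup>2"
      using shift_bound[of z w] False by (simp add: max_def)
    then have "(1 / ?r)\<^sup>2 * (1 + (Re z)\<^sup>2) \<le> (3 + 2 * (Re w)\<^sup>2)"
      using False by (simp add: power_divide divide_simps)
    also have "\<dots> \<le> K"
      unfolding K_def using M(1) by (simp add: algebra_simps)
    finally have "(1 / ?r)\<^sup>2 \<le> K / (1 + (Re z)\<^sup>2)"
      by (subst pos_le_divide_eq) (auto simp: add_pos_nonneg)
    moreover have "cmod (G z) = cmod (g z) * (1 / ?r)"
      using eq[OF z] False by (auto simp: norm_mult)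
    moreover have "G' \<le> a / 2 + k" if "t \<le> k" "G' = p" "p \<le> (a + t) / 2" "0 \<le> t" for G' a k t p :: real
      using that by simp
    ultimately show ?thesis
      using sum_prod_le[of "cmod (g z)" "1 / ?r"] zero_le_power2[of "1 / ?r"] by blast
  qed
  \<comment> \<open>For s = 1 and t = 0 both squares coincide, hence 1/4 in place of 1/2.\<close>
  have le2: "cmod (G (Complex x y)) \<le> 1/4 * ((cmod (g (Complex x y)))\<^sup>2 + (cmod (g (Complex x (1 * y + 0))))\<^sup>2) + K / (1 + x\<^sup>2)"
    if "0 \<le> y" for x y
    using le[of "Complex x y"] that by simp
  have inv: "(LINT x|lborel. G (Complex x Y)) = (LINT x|lborel. G (Complex x 0))"
    and iG: "integrable lborel (\<lambda>x. G (Complex x Y))" if "Y \<ge> 0" for Y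
  proof -
    note * = line_integral_shift_hardy[OF g that, of "1/4" U G 1 0 K, OF _ U(1) _ U(3) le2]
    show "(LINT x|lborel. G (Complex x Y)) = (LINT x|lborel. G (Complex x 0))"
      by (rule *(1)) (use U(2) in auto)
    show "integrable lborel (\<lambda>x. G (Complex x Y))"
      by (rule *(2)) (use U(2) that in auto)
  qed
  \<comment> \<open>At height m^2 above w the Cauchy kernel has squared norm pi/m^2. Splitting the
    product with weight \<open>sqrt m\<close> balances the two terms, both of which become
    O(1/m).\<close>
  have small: "cmod (LINT x|lborel. G (Complex x 0)) \<le> (C + pi) / (2 * m)" if m: "m > 0" "m\<^sup>2 + Im w \<ge> 0" for m
  proof -
    define Y where "Y = m\<^sup>2 + Im w"
    have Y: "Y \<ge> 0" "Y - Im w = m\<^sup>2" using m by (auto simp: Y_def)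
    have p: "cmod (G (Complex x Y)) \<le> 1/(2*m) * (cmod (g (Complex x Y)))\<^sup>2 + (m/2) * (1 / ((x - Re w)\<^sup>2 + (m\<^sup>2)\<^sup>2))" for x
    proof -
      let ?r = "cmod (Complex x Y - w)"
      have r2: "?r\<^sup>2 = (x - Re w)\<^sup>2 + (m\<^sup>2)\<^sup>2"
        by (simp add: cmod_power2 Y)
      have "(m\<^sup>2)\<^sup>2 > 0" using m by simp
      then have "?r\<^sup>2 > 0" unfolding r2 by (simp add: add_nonneg_pos)
      then have r: "?r > 0" by simp
      have s: "sqrt m > 0" "(sqrt m)\<^sup>2 = m" using m by auto
      have "cmod (G (Complex x Y)) = (cmod (g (Complex x Y)) / sqrt m) * (sqrt m / ?r)"
        using eq[of "Complex x Y"] Y r s by (auto simp: norm_mult)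
      also have "\<dots> \<le> ((cmod (g (Complex x Y)) / sqrt m)\<^sup>2 + (sqrt m / ?r)\<^sup>2) / 2"
        by (rule sum_prod_le)
      also have "\<dots> = 1/(2*m) * (cmod (g (Complex x Y)))\<^sup>2 + (m/2) * (1 / ?r\<^sup>2)"
        by (simp add: power_divide s add_divide_distrib)
      finally show ?thesis unfolding r2 .
    qed
    have hb: "has_bochner_integral lborel (\<lambda>x. 1 / ((x - Re w)\<^sup>2 + (m\<^sup>2)\<^sup>2)) (pi / m\<^sup>2)"
      by (rule has_bochner_integral_Cauchy_density) (use m in auto)
    have "cmod (LINT x|lborel. G (Complex x 0)) = cmod (LINT x|lborel. G (Complex x Y))"
      using inv[OF Y(1)] by simp
    also have "\<dots> \<le> (LINT x|lborel. cmod (G (Complex x Y)))"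
      by (rule integral_norm_bound)
    also have "\<dots> \<le> (LINT x|lborel. 1/(2*m) * (cmod (g (Complex x Y)))\<^sup>2 + (m/2) * (1 / ((x - Re w)\<^sup>2 + (m\<^sup>2)\<^sup>2)))"
      using iG[OF Y(1)] hardy_bound_integrable[OF g Y(1)] hb p
      by (intro integral_mono Bochner_Integration.integrable_add integrable_mult_right) (auto simp: has_bochner_integral_iff)
    also have "\<dots> = 1/(2*m) * (LINT x|lborel. (cmod (g (Complex x Y)))\<^sup>2) + (m/2) * (pi / m\<^sup>2)"
      using hardy_bound_integrable[OF g Y(1)] hb
      by (intro has_bochner_integral_integral_eq has_bochner_integral_add has_bochner_integral_mult_right
            has_bochner_integral_integrable)
    also have "\<dots> \<le> 1/(2*m) * C + (m/2) * (pi / m\<^sup>2)"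
      using hardy_bound_integrable[OF g Y(1)] m by (intro add_right_mono mult_left_mono) auto
    also have "\<dots> = (C + pi) / (2 * m)"
      using m by (simp add: field_simps power2_eq_square)
    finally show ?thesis .
  qed
  have "cmod (LINT x|lborel. G (Complex x 0)) \<le> 0"
  proof (rule tendsto_lowerbound)
    show "((\<lambda>m. (C + pi) / (2 * m)) \<longlongrightarrow> 0) at_top"
      by real_asymp
    have "eventually (\<lambda>m. m\<^sup>2 + Im w \<ge> 0) at_top"
      by real_asymp
    then show "\<forall>\<^sub>F m in at_top. cmod (LINT x|lborel. G (Complex x 0)) \<le> (C + pi) / (2 * m)"
      using eventually_gt_at_top[of 0] by eventually_elim (rule small)
  qed simp
  then show ?thesis by simp
qed

lemma hardy_bound_over_linear_integrable:
  assumes g: "hardy_bound g C" and "Im w \<noteq> 0"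
  shows "integrable lborel (\<lambda>x. g (Complex x 0) / (Complex x 0 - w))"
proof (rule Bochner_Integration.integrable_bound)
  have hb: "has_bochner_integral lborel (\<lambda>x. 1 / ((x - Re w)\<^sup>2 + \<bar>Im w\<bar>\<^sup>2)) (pi / \<bar>Im w\<bar>)"
    by (rule has_bochner_integral_Cauchy_density) (use assms in auto)
  show "integrable lborel (\<lambda>x. ((cmod (g (Complex x 0)))\<^sup>2 + 1 / ((x - Re w)\<^sup>2 + (Im w)\<^sup>2)) / 2)"
    using hardy_bound_integrable[OF g, of 0] hb by (auto simp: has_bochner_integral_iff)
  have [measurable]: "(\<lambda>x. g (Complex x 0)) \<in> borel_measurable borel"
    using hardy_bound_measurable[OF g, of 0] by simp
  have [measurable]: "(\<lambda>x. Complex x 0) \<in> borel_measurable borel"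
    by (intro borel_measurable_continuous_onI continuous_intros)
  show "(\<lambda>x. g (Complex x 0) / (Complex x 0 - w)) \<in> borel_measurable lborel"
    by measurable
  show "AE x in lborel. norm (g (Complex x 0) / (Complex x 0 - w))
      \<le> norm (((cmod (g (Complex x 0)))\<^sup>2 + 1 / ((x - Re w)\<^sup>2 + (Im w)\<^sup>2)) / 2)"
  proof (rule AE_I2)
    fix x
    have "norm (g (Complex x 0) / (Complex x 0 - w)) = cmod (g (Complex x 0)) * (1 / cmod (Complex x 0 - w))"
      by (simp add: norm_divide)
    also have "\<dots> \<le> ((cmod (g (Complex x 0)))\<^sup>2 + (1 / cmod (Complex x 0 - w))\<^sup>2) / 2"
      by (rule sum_prod_le)
    also have "(1 / cmod (Complex x 0 - w))\<^sup>2 = 1 / ((x - Re w)\<^sup>2 + (Im w)\<^sup>2)"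
      by (simp add: power_divide cmod_power2)
    finally show "norm (g (Complex x 0) / (Complex x 0 - w))
      \<le> norm (((cmod (g (Complex x 0)))\<^sup>2 + 1 / ((x - Re w)\<^sup>2 + (Im w)\<^sup>2)) / 2)"
      by (auto intro: order_trans[OF _ abs_ge_self])
  qed
qed

lemma hardy_Cauchy_lower:
  assumes g: "hardy_bound g C" and w: "Im w < 0"
  shows "(LINT x|lborel. g (Complex x 0) / (Complex x 0 - w)) = 0"
proof -
  obtain U where U: "open U" "{z. 0 \<le> Im z} \<subseteq> U" "g holomorphic_on U"
    using g unfolding hardy_bound_def by blast
  have "(\<lambda>z. g z / (z - w)) holomorphic_on (U - {w})"
    using U by (intro holomorphic_intros) (auto intro: holomorphic_on_subset)
  then show ?thesis
    by (intro hardy_vanish[OF g, of "U - {w}" "\<lambda>z. g z / (z - w)" w]) (use U w in auto)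
qed

text \<open>Subtracting c/(z - \<open>cnj w\<close>) makes the function vanish at w without leaving
  the Hardy class, as the new pole lies below the axis; \<open>hardy_vanish\<close> then applies
  after division by z - w. What remains is c times the integral of 1/|x - w|^2, and c pi/Im w is the
  stated value.\<close>

lemma hardy_Cauchy_upper:
  assumes g: "hardy_bound g C" and w: "Im w > 0"
  shows "(LINT x|lborel. g (Complex x 0) / (Complex x 0 - w)) = 2 * pi * \<i> * g w"
proof -
  obtain U where U: "open U" "{z. 0 \<le> Im z} \<subseteq> U" "g holomorphic_on U"
    using g unfolding hardy_bound_def by blast
  define c where "c = g w * (w - cnj w)"
  define U' where "U' = U - {cnj w}"
  have U': "open U'" "{z. 0 \<le> Im z} \<subseteq> U'" "g holomorphic_on U'"
    unfolding U'_def using U w by (auto intro: holomorphic_on_subset)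
  have far: "cmod (z - cnj w) \<ge> Im w" if "Im z \<ge> 0" for z
    using abs_Im_le_cmod[of "z - cnj w"] that w by simp
  have ne: "z - cnj w \<noteq> 0" if "Im z \<ge> 0" for z using far[OF that] w by auto
  have h: "hardy_bound (\<lambda>z. 1 / (z - cnj w)) ((3 + 2 * (Re w)\<^sup>2) * (1 + 1 / (Im w)\<^sup>2) * pi)"
  proof (rule hardy_bound_decay[OF U'(1,2)])
    show "(\<lambda>z. 1 / (z - cnj w)) holomorphic_on U'"
      by (intro holomorphic_intros) (auto simp: U'_def)
    fix z assume z: "0 \<le> Im z"
    let ?r2 = "(cmod (z - cnj w))\<^sup>2"
    have a: "?r2 \<ge> (Im w)\<^sup>2" using far[OF z] w by (intro power_mono) auto
    have p: "(Im w)\<^sup>2 > 0" using w by simp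
    have "1 \<le> ?r2 / (Im w)\<^sup>2" using a p by simp
    moreover have "(1 + 1 / (Im w)\<^sup>2) * ?r2 = ?r2 + ?r2 / (Im w)\<^sup>2" by (simp add: algebra_simps)
    ultimately have "max 1 ?r2 \<le> (1 + 1 / (Im w)\<^sup>2) * ?r2"
      using zero_le_power2[of "cmod (z - cnj w)"] by linarith
    then have "(3 + 2 * (Re w)\<^sup>2) * max 1 ?r2 \<le> (3 + 2 * (Re w)\<^sup>2) * ((1 + 1 / (Im w)\<^sup>2) * ?r2)"
      by (intro mult_left_mono) auto
    then have "1 + (Re z)\<^sup>2 \<le> (3 + 2 * (Re w)\<^sup>2) * (1 + 1 / (Im w)\<^sup>2) * ?r2"
      using shift_bound[of z "cnj w"] by simp
    moreover have "?r2 > 0" "1 + (Re z)\<^sup>2 > 0" using a p by (auto simp: add_pos_nonneg)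
    ultimately show "(cmod (1 / (z - cnj w)))\<^sup>2 \<le> (3 + 2 * (Re w)\<^sup>2) * (1 + 1 / (Im w)\<^sup>2) / (1 + (Re z)\<^sup>2)"
      by (simp add: norm_divide power_divide pos_le_divide_eq pos_divide_le_eq)
  qed
  define f where "f = (\<lambda>z. g z - c * (1 / (z - cnj w)))"
  obtain C' where f: "hardy_bound f C'"
    unfolding f_def using hardy_bound_diff[OF g hardy_bound_cmult[OF h]] by blast
  have fw: "f w = 0" unfolding f_def c_def using ne[of w] w by simp
  have holf: "f holomorphic_on U'"
    unfolding f_def by (intro holomorphic_intros U') (auto simp: U'_def)
  define G where "G = (\<lambda>z. if z = w then deriv f w else (f z - f w) / (z - w))"
  have "(LINT x|lborel. G (Complex x 0)) = 0"
    by (rule hardy_vanish[OF f U'(1,2), of G w])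
       (use pole_lemma_open[OF holf U'(1), of w] fw in \<open>auto simp: G_def\<close>)
  moreover have "G (Complex x 0) = g (Complex x 0) / (Complex x 0 - w) - c * complex_of_real (1 / ((x - Re w)\<^sup>2 + (Im w)\<^sup>2))" for x
  proof -
    have n: "Complex x 0 \<noteq> w" "Complex x 0 - cnj w \<noteq> 0" using w by (auto simp: complex_eq_iff)
    have "(Complex x 0 - w) * (Complex x 0 - cnj w) = complex_of_real ((x - Re w)\<^sup>2 + (Im w)\<^sup>2)"
      by (simp add: complex_eq_iff power2_eq_square algebra_simps)
    then have "1 / (Complex x 0 - cnj w) / (Complex x 0 - w) = complex_of_real (1 / ((x - Re w)\<^sup>2 + (Im w)\<^sup>2))"
      by (simp add: mult.commute)
    then show ?thesis
      using n fw by (simp add: G_def f_def diff_divide_distrib)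
  qed
  moreover have "has_bochner_integral lborel (\<lambda>x. c * complex_of_real (1 / ((x - Re w)\<^sup>2 + (Im w)\<^sup>2))) (c * complex_of_real (pi / Im w))"
    by (intro has_bochner_integral_mult_right has_bochner_integral_of_real has_bochner_integral_Cauchy_density w)
  moreover have "c * complex_of_real (pi / Im w) = 2 * pi * \<i> * g w"
    using w unfolding c_def complex_diff_cnj by simp
  ultimately show ?thesis
    using hardy_bound_over_linear_integrable[OF g, of w] w by (auto simp: has_bochner_integral_iff)
qed

text \<open>With \<open>n(y)\<close> the squared norm on the line of height \<open>y\<close>, shifting the contour in
  \<open>\<integral>g(z) g\<^sup>#(z - 2\<i>y)dz\<close> gives \<open>n(y) \<le> (n(0) + n(2y))/2\<close>; iterating this and using that \<open>n\<close> is bounded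
  yields \<open>n(y) \<le> n(0)\<close>.\<close>
lemma hardy_bound_contract:
  assumes g: "hardy_bound g C"
  shows "hardy_bound g (LINT x|lborel. (cmod (g (Complex x 0)))\<^sup>2)"
proof -
  define n where "n y = (LINT x|lborel. (cmod (g (Complex x y)))\<^sup>2)" for y
  obtain U where U: "open U" "{z. 0 \<le> Im z} \<subseteq> U" "g holomorphic_on U"
    using g unfolding hardy_bound_def by blast
  have half: "n y \<le> (n 0 + n (2 * y)) / 2" if y: "y \<ge> 0" for y
  proof -
    define U' where "U' = U \<inter> {z. cnj z + 2 * y * \<i> \<in> U}"
    have "continuous_on UNIV (\<lambda>z. cnj z + 2 * y * \<i>)"
      by (intro continuous_intros)
    from open_vimage[OF U(1) this] have op: "open {z. cnj z + 2 * y * \<i> \<in> U}"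
      by (simp add: vimage_def)
    have "cnj \<circ> (\<lambda>z. g (z + 2 * y * \<i>)) \<circ> cnj holomorphic_on {z. cnj z + 2 * y * \<i> \<in> U}"
    proof (rule holomorphic_on_compose_cnj_cnj[OF _ op])
      have "g \<circ> (\<lambda>z. z + 2 * y * \<i>) holomorphic_on cnj ` {z. cnj z + 2 * y * \<i> \<in> U}"
        by (intro holomorphic_on_compose_gen[OF _ U(3)] holomorphic_intros) auto
      then show "(\<lambda>z. g (z + 2 * y * \<i>)) holomorphic_on cnj ` {z. cnj z + 2 * y * \<i> \<in> U}"
        by (simp add: o_def)
    qed
    then have hol: "(\<lambda>z. g z * cnj (g (cnj z + 2 * y * \<i>))) holomorphic_on U'"
      unfolding o_def U'_def using U(3) by (intro holomorphic_intros) (auto intro: holomorphic_on_subset)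
    have pt: "cnj (Complex x t) + 2 * y * \<i> = Complex x (2 * y - t)" for x t
      by (simp add: complex_eq_iff)
    note sh = line_integral_shift_hardy[OF g y, of "1/2" U' "\<lambda>z. g z * cnj (g (cnj z + 2 * y * \<i>))" "-1" "2*y" 0]
    have "(LINT x|lborel. g (Complex x y) * cnj (g (cnj (Complex x y) + 2 * y * \<i>)))
        = (LINT x|lborel. g (Complex x 0) * cnj (g (cnj (Complex x 0) + 2 * y * \<i>)))"
    proof (rule sh(1))
      show "open U'" unfolding U'_def using U(1) op by auto
      show "{z. 0 \<le> Im z \<and> Im z \<le> y} \<subseteq> U'" unfolding U'_def using U(2) by auto
      show "cmod (g (Complex x t) * cnj (g (cnj (Complex x t) + 2 * y * \<i>)))
        \<le> 1/2 * ((cmod (g (Complex x t)))\<^sup>2 + (cmod (g (Complex x (-1 * t + 2 * y))))\<^sup>2) + 0 / (1 + x\<^sup>2)" for x t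
        unfolding pt using sum_prod_le[of "cmod (g (Complex x t))" "cmod (g (Complex x (2 * y - t)))"]
        by (simp add: norm_mult)
    qed (use hol y in auto)
    moreover have "(LINT x|lborel. g (Complex x y) * cnj (g (cnj (Complex x y) + 2 * y * \<i>))) = complex_of_real (n y)"
      unfolding pt n_def by (simp flip: complex_norm_square of_real_power integral_complex_of_real)
    ultimately have "complex_of_real (n y) = (LINT x|lborel. g (Complex x 0) * cnj (g (Complex x (2 * y))))"
      unfolding pt by simp
    then have "\<bar>n y\<bar> = cmod (LINT x|lborel. g (Complex x 0) * cnj (g (Complex x (2 * y))))"
      by (metis norm_of_real)
    also have "\<dots> \<le> (LINT x|lborel. cmod (g (Complex x 0) * cnj (g (Complex x (2 * y)))))"
      by (rule integral_norm_bound)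
    also have "\<dots> \<le> (LINT x|lborel. ((cmod (g (Complex x 0)))\<^sup>2 + (cmod (g (Complex x (2 * y))))\<^sup>2) / 2)"
    proof (rule integral_mono_AE')
      show "integrable lborel (\<lambda>x. ((cmod (g (Complex x 0)))\<^sup>2 + (cmod (g (Complex x (2 * y))))\<^sup>2) / 2)"
        using hardy_bound_integrable[OF g, of 0] hardy_bound_integrable[OF g, of "2*y"] y by auto
      show "AE x in lborel. cmod (g (Complex x 0) * cnj (g (Complex x (2 * y)))) \<le> ((cmod (g (Complex x 0)))\<^sup>2 + (cmod (g (Complex x (2 * y))))\<^sup>2) / 2"
        by (intro AE_I2) (use sum_prod_le in \<open>simp add: norm_mult\<close>)
    qed auto
    also have "\<dots> = (n 0 + n (2 * y)) / 2"
      unfolding n_def using hardy_bound_integrable[OF g, of 0] hardy_bound_integrable[OF g, of "2*y"] y by simp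
    finally show ?thesis by simp
  qed
  have it: "n y \<le> n 0 + C / 2 ^ k" if "y \<ge> 0" for y k
    using that
  proof (induction k arbitrary: y)
    case 0
    then show ?case
      using hardy_bound_integrable(2)[OF g, of y] by (simp add: n_def add_increasing)
  next
    case (Suc k)
    have "n (2 * y) \<le> n 0 + C / 2 ^ k" using Suc by simp
    then have "n y \<le> (n 0 + (n 0 + C / 2 ^ k)) / 2"
      using half[OF Suc.prems] by simp
    also have "\<dots> = n 0 + C / 2 ^ Suc k"
      by (simp add: add_divide_distrib)
    finally show ?case .
  qed
  have "n y \<le> n 0" if "y \<ge> 0" for y
  proof (rule tendsto_lowerbound)
    show "(\<lambda>k. n 0 + C / 2 ^ k) \<longlonglongrightarrow> n 0" by real_asymp
  qed (use it[OF that] in auto)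
  then show ?thesis
    using g unfolding hardy_bound_def n_def by blast
qed

section \<open>Zero-free functions with linear exponent\<close>

text \<open>On the circle of radius \<open>R\<close> one has \<open>|z\<^sup>2 - R\<^sup>2| = 2R|Im z|\<close>, so a factor \<open>(z\<^sup>2 - R\<^sup>2)\<^sup>k\<close> compensates the
  blow-up at the real axis in the maximum principle.\<close>
lemma entire_growth_off_real_axis:
  assumes hol: "f holomorphic_on UNIV"
    and le: "\<And>z. cmod z \<ge> 1 \<Longrightarrow> cmod (f z) * \<bar>Im z\<bar> ^ k \<le> C * cmod z ^ n"
    and z: "cmod z \<ge> 1"
  shows "cmod (f z) * (3 * (cmod z)\<^sup>2) ^ k \<le> (4 * cmod z) ^ k * (C * (2 * cmod z) ^ n)"
proof -
  define R where "R = 2 * cmod z"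
  have R: "R \<ge> 2" using z by (simp add: R_def)
  let ?h = "\<lambda>\<zeta>. f \<zeta> * (\<zeta>\<^sup>2 - (complex_of_real R)\<^sup>2) ^ k"
  have "norm (?h z) \<le> (2 * R) ^ k * (C * R ^ n)"
  proof (rule maximum_modulus_frontier[of ?h "ball 0 R"])
    show "?h holomorphic_on interior (ball 0 R)"
      using hol by (intro holomorphic_intros) (auto intro: holomorphic_on_subset)
    show "continuous_on (closure (ball 0 R)) ?h"
      using hol by (intro continuous_intros) (auto intro: holomorphic_on_imp_continuous_on holomorphic_on_subset)
    have "cmod z < 2 * cmod z" using z by linarith
    then show "z \<in> ball 0 R" unfolding R_def mem_ball_0 .
    fix \<zeta> :: complex assume "\<zeta> \<in> frontier (ball 0 R)"
    then have \<zeta>: "cmod \<zeta> = R" using R by (simp add: dist_norm)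
    have "\<zeta>\<^sup>2 - (complex_of_real R)\<^sup>2 = \<zeta> * (\<zeta> - cnj \<zeta>)"
      using complex_norm_square[of \<zeta>] \<zeta> by (simp add: power2_eq_square algebra_simps)
    also have "cmod \<dots> = 2 * R * \<bar>Im \<zeta>\<bar>"
      using \<zeta> by (simp add: norm_mult complex_diff_cnj)
    finally have "norm (?h \<zeta>) = (2 * R) ^ k * (cmod (f \<zeta>) * \<bar>Im \<zeta>\<bar> ^ k)"
      by (simp add: norm_mult norm_power power_mult_distrib)
    also have "\<dots> \<le> (2 * R) ^ k * (C * R ^ n)"
      using le[of \<zeta>] \<zeta> R by (intro mult_left_mono) auto
    finally show "norm (?h \<zeta>) \<le> (2 * R) ^ k * (C * R ^ n)" .
  qed simp
  moreover have "3 * (cmod z)\<^sup>2 \<le> cmod (z\<^sup>2 - (complex_of_real R)\<^sup>2)"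
  proof -
    have "cmod ((complex_of_real R)\<^sup>2) - cmod (z\<^sup>2) \<le> cmod (z\<^sup>2 - (complex_of_real R)\<^sup>2)"
      using norm_triangle_ineq3[of "z\<^sup>2" "(complex_of_real R)\<^sup>2"] by linarith
    then show ?thesis by (simp add: norm_power R_def power_mult_distrib norm_mult)
  qed
  then have "cmod (f z) * (3 * (cmod z)\<^sup>2) ^ k \<le> norm (?h z)"
    unfolding norm_mult norm_power by (intro mult_left_mono power_mono) auto
  ultimately show ?thesis unfolding R_def by simp
qed

text \<open>The preceding growth estimate with k = 1 and n = 0 removes the blow-up at the real axis
  and leaves a bound of order 1/|z|, so Liouville's theorem applies.\<close>

lemma entire_bounded_by_inverse_Im_zero:
  assumes hol: "f holomorphic_on UNIV" and le: "\<And>z. Im z \<noteq> 0 \<Longrightarrow> cmod (f z) * \<bar>Im z\<bar> \<le> C"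
  shows "f z = 0"
proof -
  have C: "C \<ge> 0" using order_trans[OF _ le[of \<i>]] by simp
  have b: "cmod (f z) \<le> (4 * C / 3) / cmod z" if z: "cmod z \<ge> 1" for z
  proof -
    have "cmod (f z) * (3 * (cmod z)\<^sup>2) ^ 1 \<le> (4 * cmod z) ^ 1 * (C * (2 * cmod z) ^ 0)"
    proof (rule entire_growth_off_real_axis[OF hol _ z])
      show "cmod (f w) * \<bar>Im w\<bar> ^ 1 \<le> C * cmod w ^ 0" for w
        using le[of w] C by (cases "Im w = 0") auto
    qed
    then have "cmod z * (3 * (cmod (f z) * cmod z)) \<le> cmod z * (4 * C)"
      by (simp add: power2_eq_square algebra_simps)
    then have "3 * (cmod (f z) * cmod z) \<le> 4 * C" using z
      by (metis mult_le_cancel_left_pos less_le_trans zero_less_one)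
    then show ?thesis using z by (subst pos_le_divide_eq) auto
  qed
  have "(f \<longlongrightarrow> 0) at_infinity"
  proof (rule Lim_null_comparison)
    show "\<forall>\<^sub>F z in at_infinity. norm (f z) \<le> (4 * C / 3) / norm z"
      unfolding eventually_at_infinity using b by blast
    show "((\<lambda>z::complex. (4 * C / 3) / norm z) \<longlongrightarrow> 0) at_infinity"
      by (intro tendsto_divide_0[OF tendsto_const] filterlim_at_top_imp_at_infinity filterlim_norm_at_top)
  qed
  then show ?thesis by (rule Liouville_weak[OF hol])
qed

lemma entire_eq_on_reals:
  assumes "f holomorphic_on UNIV" "g holomorphic_on UNIV" "\<And>t. f (complex_of_real t) = g (complex_of_real t)"
  shows "f z = g z"
proof -
  have "(0::complex) islimpt range complex_of_real"
    unfolding islimpt_approachable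
  proof (intro allI impI)
    fix e :: real assume "e > 0"
    then show "\<exists>x'\<in>range complex_of_real. x' \<noteq> 0 \<and> dist x' 0 < e"
      by (intro bexI[of _ "complex_of_real (e / 2)"] rangeI) (auto simp: dist_norm)
  qed
  then have "f z - g z = 0"
    using analytic_continuation[of "\<lambda>z. f z - g z" UNIV "range complex_of_real" 0 z] assms
    by (auto intro!: holomorphic_intros)
  then show ?thesis by simp
qed

lemma entire_eq_on_upper_half_plane:
  assumes "f holomorphic_on UNIV" "g holomorphic_on UNIV" "\<And>z. Im z > 0 \<Longrightarrow> f z = g z"
  shows "f z = g z"
proof (rule analytic_continuation_open[of "{z. Im z > 0}" UNIV f g])
  show "{z. Im z > 0} \<noteq> {}" by (auto intro: exI[of _ \<i>])
qed (use assms in \<open>auto simp: open_halfspace_Im_gt\<close>)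

text \<open>A Harnack bound for the modulus and not just the real part. Conjugating p by the Cayley
  map \<open>c\<close>, which sends 0 to \<i>, and by the corresponding map of the right half-plane
  gives F with F(0) = 0 to which Schwarz applies. The result is |p(z)|(1 - |w|) \<le> |p(\<i>)|(1 +
  |w|); multiplying by 1 + |w| brings in 1 - |w|^2 = 4 Im z/|z + \<i>|^2.\<close>

lemma half_plane_Caratheodory:
  assumes hol: "p holomorphic_on {z. Im z > 0}" and pos: "\<And>z. Im z > 0 \<Longrightarrow> Re (p z) > 0"
    and z: "Im z > 0"
  shows "cmod (p z) \<le> cmod (p \<i>) * (cmod (z + \<i>))\<^sup>2 / Im z"
proof -
  define c where "c w = \<i> * (1 + w) / (1 - w)" for w
  have ne: "1 - w \<noteq> 0" if "cmod w < 1" for w using that by auto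
  have Imc: "Im (c w) > 0" if w: "cmod w < 1" for w
  proof -
    have "Im (c w) = (1 - (cmod w)\<^sup>2) / (cmod (1 - w))\<^sup>2"
      unfolding c_def cmod_power2 by (simp add: Im_divide power2_eq_square algebra_simps)
    moreover have "(cmod w)\<^sup>2 < 1" using w by (simp add: power_less_one_iff abs_square_less_1)
    moreover have "(cmod (1 - w))\<^sup>2 > 0" using ne[OF w] by simp
    ultimately show ?thesis by simp
  qed
  define F where "F w = (p (c w) - p \<i>) / (p (c w) + cnj (p \<i>))" for w
  have den: "p \<zeta> + cnj (p \<i>) \<noteq> 0" if "Im \<zeta> > 0" for \<zeta>
    using pos[OF that] pos[of \<i>] by (auto simp: complex_eq_iff)
  have lt: "cmod (p \<zeta> - p \<i>) < cmod (p \<zeta> + cnj (p \<i>))" if "Im \<zeta> > 0" for \<zeta>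
  proof -
    have "(cmod (p \<zeta> + cnj (p \<i>)))\<^sup>2 - (cmod (p \<zeta> - p \<i>))\<^sup>2 = 4 * (Re (p \<zeta>) * Re (p \<i>))"
      by (simp add: cmod_power2) (simp add: power2_eq_square algebra_simps)
    moreover have "Re (p \<zeta>) * Re (p \<i>) > 0" using pos[OF that] pos[of \<i>] by simp
    ultimately have "(cmod (p \<zeta> - p \<i>))\<^sup>2 < (cmod (p \<zeta> + cnj (p \<i>)))\<^sup>2" by linarith
    then show ?thesis by (rule power_less_imp_less_base) simp
  qed
  define w where "w = (z - \<i>) / (z + \<i>)"
  have zi: "z + \<i> \<noteq> 0" using z by (auto simp: complex_eq_iff)
  have w2: "1 - (cmod w)\<^sup>2 = 4 * Im z / (cmod (z + \<i>))\<^sup>2"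
  proof -
    have "(cmod (z + \<i>))\<^sup>2 - (cmod (z - \<i>))\<^sup>2 = 4 * Im z"
      by (simp add: cmod_power2) (simp add: power2_eq_square algebra_simps)
    moreover have "(cmod (z + \<i>))\<^sup>2 \<noteq> 0" using zi by simp
    ultimately show ?thesis by (simp add: w_def norm_divide power_divide diff_divide_distrib[symmetric] divide_simps)
  qed
  have "(cmod (z + \<i>))\<^sup>2 > 0" using zi by simp
  then have "1 - (cmod w)\<^sup>2 > 0" unfolding w2 using z by simp
  then have w1: "cmod w < 1" using abs_square_less_1[of "cmod w"] by simp
  have cw: "c w = z"
  proof -
    have "1 - w = 2 * \<i> / (z + \<i>)" "1 + w = 2 * z / (z + \<i>)"
      using zi by (auto simp: w_def field_simps)
    then show ?thesis using zi by (simp add: c_def)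
  qed
  have "cmod (F w) \<le> cmod w"
  proof (rule Schwarz_Lemma(1)[OF _ _ _ w1])
    have "p \<circ> c holomorphic_on ball 0 1"
      by (rule holomorphic_on_compose_gen[OF _ hol])
         (use ne Imc in \<open>auto simp: c_def[abs_def] intro!: holomorphic_intros\<close>)
    then show "F holomorphic_on ball 0 1"
      unfolding F_def using den Imc by (intro holomorphic_intros) (auto simp: o_def)
    show "F 0 = 0" by (simp add: F_def c_def)
    show "cmod (F w) < 1" if "cmod w < 1" for w
      using lt[OF Imc[OF that]] den[OF Imc[OF that]] by (simp add: F_def norm_divide)
  qed
  then have "cmod (p z - p \<i>) \<le> cmod w * cmod (p z + cnj (p \<i>))"
    using den[OF z] by (simp add: F_def cw norm_divide divide_simps split: if_splits)
  also have "\<dots> \<le> cmod w * (cmod (p z) + cmod (p \<i>))"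
    by (intro mult_left_mono order_trans[OF norm_triangle_ineq]) auto
  finally have "cmod (p z) - cmod (p \<i>) \<le> cmod w * (cmod (p z) + cmod (p \<i>))"
    using norm_triangle_ineq2[of "p z" "p \<i>"] by linarith
  then have "cmod (p z) * (1 - cmod w) \<le> cmod (p \<i>) * (1 + cmod w)"
    by (simp add: algebra_simps)
  then have "cmod (p z) * (1 - cmod w) * (1 + cmod w) \<le> cmod (p \<i>) * (1 + cmod w) * (1 + cmod w)"
    by (rule mult_right_mono) simp
  also have "\<dots> \<le> cmod (p \<i>) * 2 * 2"
    using w1 by (intro mult_mono) auto
  finally have "cmod (p z) * (1 - (cmod w)\<^sup>2) \<le> cmod (p \<i>) * 4"
    by (simp add: power2_eq_square algebra_simps)
  then show ?thesis
    unfolding w2 using z zi by (simp add: field_simps)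
qed

text \<open>The hypothesis bounds Re h from below by logarithms. Shifted up by \<delta> and
  corrected by a logarithm L and a constant K, h acquires positive real part and the Harnack bound
  applies at z - \<delta>\<i>. The factor (Im z)^2 pays once for the denominator of that bound and
  once for K, which is of order 1/\<delta>.\<close>

lemma log_growth_half_plane:
  assumes hol: "h holomorphic_on {z. Im z > 0}" and c: "c > 0"
    and le: "\<And>z. Im z > 0 \<Longrightarrow> c * sqrt (Im z) \<le> exp (Re (h z)) * (1 + cmod z)"
  shows "\<exists>C. \<forall>z. Im z > 0 \<longrightarrow> cmod (h z) * (Im z)\<^sup>2 \<le> C * (1 + cmod z) ^ 3"
proof -
  \<comment> \<open>The argument has real part 2 + 2 Im z > 0, so the principal branch is
    holomorphic. The factor 2 makes Re L at least ln(1 + |z|).\<close>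
  define L where "L z = Ln (- 2 * \<i> * (z + \<i>))" for z
  have ReL: "Re (L z) = ln (2 * cmod (z + \<i>))" and nL: "cmod (L z) \<le> 2 * (1 + cmod z) + pi" if z: "Im z > 0" for z
  proof -
    have ne: "z + \<i> \<noteq> 0" using z by (auto simp: complex_eq_iff)
    then show R: "Re (L z) = ln (2 * cmod (z + \<i>))"
      unfolding L_def by (subst Re_Ln) (auto simp: norm_mult)
    have g1: "cmod (z + \<i>) \<ge> 1" using abs_Im_le_cmod[of "z + \<i>"] z by simp
    have "\<bar>ln q\<bar> \<le> q" if "q \<ge> 1" for q :: real
      using ln_less_self[of q] ln_ge_zero[of q] that by linarith
    then have "\<bar>ln (2 * cmod (z + \<i>))\<bar> \<le> 2 * cmod (z + \<i>)"
      using g1 by simp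
    also have "\<dots> \<le> 2 * (1 + cmod z)"
      using norm_triangle_ineq[of z \<i>] by simp
    finally have "\<bar>Re (L z)\<bar> \<le> 2 * (1 + cmod z)" using R by simp
    moreover have "\<bar>Im (L z)\<bar> \<le> pi"
      unfolding L_def using ne mpi_less_Im_Ln[of "- 2 * \<i> * (z + \<i>)"] Im_Ln_le_pi[of "- 2 * \<i> * (z + \<i>)"]
      by (intro abs_leI) auto
    ultimately show "cmod (L z) \<le> 2 * (1 + cmod z) + pi"
      using cmod_le[of "L z"] by linarith
  qed
  have holL: "L holomorphic_on {z. Im z > 0}"
    unfolding L_def by (intro holomorphic_intros) (auto simp: complex_nonpos_Reals_iff)
  have contseg: "compact ((\<lambda>s. Complex 0 s) ` {1..2})"
    by (intro compact_continuous_image continuous_intros) auto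
  have "bounded (h ` ((\<lambda>s. Complex 0 s) ` {1..2}))"
    by (intro compact_imp_bounded compact_continuous_image contseg continuous_on_subset[OF holomorphic_on_imp_continuous_on[OF hol]]) auto
  then obtain M where M: "M > 0" "\<And>s. 1 \<le> s \<Longrightarrow> s \<le> 2 \<Longrightarrow> cmod (h (Complex 0 s)) \<le> M"
    unfolding bounded_pos by auto
  \<comment> \<open>On the segment from \<i> to 2\<i> the function h is bounded by M, and 6 + pi
    bounds L there because |z| \<le> 2.\<close>
  define M' where "M' = M + 6 + pi + \<bar>ln c\<bar>"
  define C where "C = 2 * (M' + 2) + (2 + pi + \<bar>ln c\<bar> + 2)"
  have "cmod (h z) * (Im z)\<^sup>2 \<le> C * (1 + cmod z) ^ 3" if z: "Im z > 0" for z
  proof -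
    define y where "y = Im z"
    define \<delta> where "\<delta> = min 1 y / 2"
    have d: "0 < \<delta>" "\<delta> \<le> 1/2" "\<delta> \<le> y / 2" "y > 0" using z by (auto simp: \<delta>_def y_def)
    have di: "1 / \<delta> \<le> 2 * (1 + y) / y"
      using d(4) by (auto simp: \<delta>_def min_def field_simps)
    \<comment> \<open>Absorbs ln c and (ln \<delta>)/2, using that -ln \<delta> is less than
      1/\<delta>.\<close>
    define K where "K = \<bar>ln c\<bar> + 1 / \<delta>"
    define p where "p \<zeta> = h (\<zeta> + \<delta> * \<i>) + L (\<zeta> + \<delta> * \<i>) + K" for \<zeta>
    have hp: "p holomorphic_on {z. Im z > 0}"
    proof -
      have "h \<circ> (\<lambda>\<zeta>. \<zeta> + \<delta> * \<i>) holomorphic_on {z. Im z > 0}" "L \<circ> (\<lambda>\<zeta>. \<zeta> + \<delta> * \<i>) holomorphic_on {z. Im z > 0}"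
        using d by (auto intro!: holomorphic_on_compose_gen[OF _ hol] holomorphic_on_compose_gen[OF _ holL] holomorphic_intros)
      then show ?thesis unfolding p_def o_def by (intro holomorphic_intros)
    qed
    have pp: "Re (p \<zeta>) > 0" if \<zeta>: "Im \<zeta> > 0" for \<zeta>
    proof -
      define w where "w = \<zeta> + \<delta> * \<i>"
      have w: "Im w > \<delta>" "Im w > 0" using \<zeta> d by (auto simp: w_def)
      have "c * sqrt \<delta> \<le> c * sqrt (Im w)" using w c by simp
      also have "\<dots> \<le> exp (Re (h w)) * (1 + cmod w)" by (rule le[OF w(2)])
      finally have "ln (c * sqrt \<delta>) \<le> ln (exp (Re (h w)) * (1 + cmod w))"
        using c d by (subst ln_le_cancel_iff) (auto simp: add_pos_nonneg)
      then have a: "ln c + ln \<delta> / 2 \<le> Re (h w) + ln (1 + cmod w)"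
        using c d add_pos_nonneg[OF zero_less_one norm_ge_zero[of w]] by (simp add: ln_mult ln_sqrt)
      have "(1 + cmod w)\<^sup>2 \<le> (2 * cmod (w + \<i>))\<^sup>2"
      proof -
        have "(cmod (w + \<i>))\<^sup>2 = (cmod w)\<^sup>2 + 2 * Im w + 1"
          by (simp add: cmod_power2) (simp add: power2_eq_square algebra_simps)
        moreover have "(1 + cmod w)\<^sup>2 \<le> 2 * (1 + (cmod w)\<^sup>2)"
          using sum_squares_bound[of 1 "cmod w"] by (simp add: power2_eq_square algebra_simps)
        moreover have "(2 * cmod (w + \<i>))\<^sup>2 = 4 * (cmod (w + \<i>))\<^sup>2"
          by (simp add: power_mult_distrib)
        moreover have "P \<le> Q" if "R = s + 2 * t + 1" "P \<le> 2 * (1 + s)" "Q = 4 * R" "0 < t" "0 \<le> s" for P Q R s t :: real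
          using that by simp
        ultimately show ?thesis using w(2) zero_le_power2[of "cmod w"] by blast
      qed
      then have "1 + cmod w \<le> 2 * cmod (w + \<i>)"
        by (rule power2_le_imp_le) simp
      then have b: "ln (1 + cmod w) \<le> Re (L w)"
        unfolding ReL[OF w(2)] by (intro ln_mono) (auto simp: add_pos_nonneg intro: less_le_trans)
      have "- ln \<delta> \<le> 1 / \<delta> - 1"
        using ln_le_minus_one[of "1 / \<delta>"] d by (simp add: ln_div)
      moreover have "1 / \<delta> > 0" using d by simp
      ultimately have "ln \<delta> / 2 > - (1 / \<delta>)" by linarith
      then show ?thesis
        using a b by (simp add: p_def K_def w_def[symmetric])
    qed
    define \<zeta> where "\<zeta> = z - \<delta> * \<i>"
    have \<zeta>: "Im \<zeta> \<ge> y / 2" "Im \<zeta> > 0" using d by (auto simp: \<zeta>_def y_def[symmetric])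
    have pz: "cmod (p \<zeta>) \<le> cmod (p \<i>) * (cmod (\<zeta> + \<i>))\<^sup>2 / Im \<zeta>"
      by (rule half_plane_Caratheodory[OF hp pp \<zeta>(2)])
    have pi': "cmod (p \<i>) \<le> M' + 1 / \<delta>"
    proof -
      have eq: "\<i> + \<delta> * \<i> = Complex 0 (1 + \<delta>)" by (simp add: complex_eq_iff)
      have "cmod (h (Complex 0 (1 + \<delta>))) \<le> M" using d by (intro M) auto
      moreover have "cmod (L (Complex 0 (1 + \<delta>))) \<le> 2 * (1 + cmod (Complex 0 (1 + \<delta>))) + pi"
        using d by (intro nL) auto
      moreover have "cmod (Complex 0 (1 + \<delta>)) \<le> 2" using d by (simp add: cmod_def)
      moreover have "cmod (p \<i>) \<le> cmod (h (Complex 0 (1 + \<delta>))) + cmod (L (Complex 0 (1 + \<delta>))) + cmod (complex_of_real K)"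
        unfolding p_def eq by (intro order_trans[OF norm_triangle_ineq] add_right_mono) auto
      moreover have "cmod (complex_of_real K) = \<bar>ln c\<bar> + 1 / \<delta>"
        unfolding K_def norm_of_real using d by simp
      ultimately show ?thesis unfolding M'_def by argo
    qed
    have c1: "cmod (\<zeta> + \<i>) \<le> 1 + cmod z"
    proof -
      have "\<zeta> + \<i> = z + complex_of_real (1 - \<delta>) * \<i>" by (simp add: \<zeta>_def algebra_simps)
      also have "cmod \<dots> \<le> cmod z + cmod (complex_of_real (1 - \<delta>) * \<i>)" by (rule norm_triangle_ineq)
      also have "cmod (complex_of_real (1 - \<delta>) * \<i>) \<le> 1"
        unfolding norm_mult norm_of_real using d by simp
      finally show ?thesis by simp
    qed
    define r where "r = 1 + cmod z"
    have r: "r \<ge> 1" "y \<le> r" "1 + y \<le> r" "r > 0"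
      using abs_Im_le_cmod[of z] d by (auto simp: r_def y_def)
    have M'0: "M' \<ge> 0" using M(1) by (simp add: M'_def)
    have "cmod (p \<zeta>) \<le> (M' + 1 / \<delta>) * r\<^sup>2 / (y / 2)"
      using pi' c1 \<zeta> d M'0
      by (intro order_trans[OF pz] frac_le mult_mono power_mono) (auto simp: r_def)
    also have "\<dots> \<le> (M' + 2 * (1 + y) / y) * r\<^sup>2 / (y / 2)"
      using di d by (intro divide_right_mono mult_right_mono add_left_mono) auto
    finally have "cmod (p \<zeta>) * y\<^sup>2 \<le> (M' + 2 * (1 + y) / y) * r\<^sup>2 / (y / 2) * y\<^sup>2"
      by (rule mult_right_mono) simp
    also have "\<dots> = 2 * (M' * y + 2 * (1 + y)) * r\<^sup>2"
      using d by (simp add: field_simps power2_eq_square)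
    also have "\<dots> \<le> 2 * (M' * r + 2 * r) * r\<^sup>2"
      using r M'0 by (intro mult_mono add_mono mult_left_mono) auto
    finally have A: "cmod (p \<zeta>) * y\<^sup>2 \<le> 2 * (M' + 2) * r ^ 3"
      by (simp add: power2_eq_square power3_eq_cube algebra_simps)
    have B: "(2 * r + pi + \<bar>ln c\<bar> + 2 * (1 + y) / y) * y\<^sup>2 \<le> (2 + pi + \<bar>ln c\<bar> + 2) * r ^ 3"
    proof -
      have "(2 * r + pi + \<bar>ln c\<bar> + 2 * (1 + y) / y) * y\<^sup>2 = (2 * r + pi + \<bar>ln c\<bar>) * y\<^sup>2 + 2 * ((1 + y) * y)"
        using d by (simp add: field_simps power2_eq_square)
      also have "\<dots> \<le> (2 * r + pi * r + \<bar>ln c\<bar> * r) * r\<^sup>2 + 2 * (r * r)"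
        using r d by (intro add_mono mult_mono power_mono mult_left_mono) (auto simp: mult_le_cancel_left1 mult_nonneg_nonneg)
      also have "2 * (r * r) \<le> 2 * (r * r * r)"
        using r by simp
      finally show ?thesis by (simp add: power2_eq_square power3_eq_cube algebra_simps)
    qed
    have "h z = p \<zeta> - L z - K" by (simp add: p_def \<zeta>_def)
    then have "cmod (h z) \<le> cmod (p \<zeta>) + cmod (L z) + cmod (complex_of_real K)"
      by (metis (no_types, lifting) add_right_mono norm_triangle_ineq4 order_trans)
    also have "cmod (complex_of_real K) = \<bar>ln c\<bar> + 1 / \<delta>"
      unfolding K_def norm_of_real using d by simp
    finally have "cmod (h z) \<le> cmod (p \<zeta>) + (2 * r + pi + \<bar>ln c\<bar> + 2 * (1 + y) / y)"
      using nL[OF z] di by (simp add: r_def)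
    then have "cmod (h z) * y\<^sup>2 \<le> (cmod (p \<zeta>) + (2 * r + pi + \<bar>ln c\<bar> + 2 * (1 + y) / y)) * y\<^sup>2"
      by (rule mult_right_mono) simp
    then have "cmod (h z) * y\<^sup>2 \<le> C * r ^ 3"
      using A B unfolding C_def distrib_right by linarith
    then show ?thesis unfolding y_def r_def .
  qed
  then show ?thesis by blast
qed

text \<open>If A = exp h then B = exp(h + g), and the lower bounds on A and B control the growth of
  both logarithms, hence of their difference g. Since g is imaginary on the real line, reflection
  carries the bound to the lower half-plane. There remains blow-up of order 2 at the axis against
  cubic growth, and 3 - 2 = 1 is the resulting degree.\<close>

lemma zero_free_quotient_linear_exponent:
  assumes g: "g holomorphic_on UNIV" and re: "\<And>t. Re (g (complex_of_real t)) = 0"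
    and A: "A holomorphic_on {z. Im z > 0}" and c: "c > 0"
    and leA: "\<And>z. Im z > 0 \<Longrightarrow> c * sqrt (Im z) \<le> cmod (A z) * (1 + cmod z)"
    and leB: "\<And>z. Im z > 0 \<Longrightarrow> c * sqrt (Im z) \<le> cmod (B z) * (1 + cmod z)"
    and eq: "\<And>z. Im z > 0 \<Longrightarrow> exp (g z) = B z / A z"
  obtains \<beta> \<gamma> :: real where "\<And>z. g z = \<i> * (complex_of_real \<beta> * z + complex_of_real \<gamma>)"
proof -
  have A0: "A z \<noteq> 0" if "Im z > 0" for z
    using leA[OF that] c that by (auto simp: mult_le_0_iff)
  have "contractible {z. Im z > 0}"
    by (intro convex_imp_contractible convex_halfspace_Im_gt)
  then obtain h where h: "h holomorphic_on {z. Im z > 0}" "\<And>z. Im z > 0 \<Longrightarrow> A z = exp (h z)"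
    using contractible_imp_holomorphic_log[OF A] A0 by (metis (no_types, lifting) mem_Collect_eq)
  have "\<exists>C. \<forall>z. Im z > 0 \<longrightarrow> cmod (h z) * (Im z)\<^sup>2 \<le> C * (1 + cmod z) ^ 3"
    using leA h by (intro log_growth_half_plane[OF h(1) c]) (metis norm_exp_eq_Re)
  then obtain C1 where C1: "\<And>z. Im z > 0 \<Longrightarrow> cmod (h z) * (Im z)\<^sup>2 \<le> C1 * (1 + cmod z) ^ 3" by blast
  have "exp (h z + g z) = B z" if "Im z > 0" for z
    using eq[OF that] A0[OF that] h(2)[OF that] by (simp add: exp_add)
  then have e: "exp (Re (h z + g z)) = cmod (B z)" if "Im z > 0" for z
    using that by (metis norm_exp_eq_Re)
  have "(\<lambda>z. h z + g z) holomorphic_on {z. Im z > 0}"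
    using h(1) g by (intro holomorphic_intros) (auto intro: holomorphic_on_subset)
  then have "\<exists>C. \<forall>z. Im z > 0 \<longrightarrow> cmod (h z + g z) * (Im z)\<^sup>2 \<le> C * (1 + cmod z) ^ 3"
    by (rule log_growth_half_plane[OF _ c]) (simp only: e leB)
  then obtain C2 where C2: "\<And>z. Im z > 0 \<Longrightarrow> cmod (h z + g z) * (Im z)\<^sup>2 \<le> C2 * (1 + cmod z) ^ 3" by blast
  have up: "cmod (g z) * (Im z)\<^sup>2 \<le> (C1 + C2) * (1 + cmod z) ^ 3" if "Im z > 0" for z
  proof -
    have "cmod (g z) \<le> cmod (h z) + cmod (h z + g z)"
      using norm_triangle_ineq4[of "h z + g z" "h z"] by simp
    then have "cmod (g z) * (Im z)\<^sup>2 \<le> (cmod (h z) + cmod (h z + g z)) * (Im z)\<^sup>2"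
      by (rule mult_right_mono) simp
    then show ?thesis using C1[OF that] C2[OF that] by (simp add: algebra_simps)
  qed
  have hs: "(\<lambda>z. - cnj (g (cnj z))) holomorphic_on UNIV"
    using holomorphic_on_compose_cnj_cnj[of g UNIV] g
    by (auto simp: o_def intro!: holomorphic_intros intro: holomorphic_on_subset)
  have sym: "g z = - cnj (g (cnj z))" for z
    by (rule entire_eq_on_reals[OF g hs]) (use re in \<open>auto simp: complex_eq_iff\<close>)
  have all: "cmod (g z) * (Im z)\<^sup>2 \<le> (C1 + C2) * (1 + cmod z) ^ 3" if "Im z \<noteq> 0" for z
  proof (cases "Im z > 0")
    case False
    have "cmod (g z) = cmod (g (cnj z))" using sym[of z] by (metis complex_mod_cnj norm_minus_cancel)
    then show ?thesis using up[of "cnj z"] that False by simp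
  qed (rule up)
  have C0: "C1 + C2 \<ge> 0"
  proof -
    have "0 \<le> (C1 + C2) * (1 + cmod \<i>) ^ 3" using order_trans[OF _ all[of \<i>]] by simp
    then show ?thesis by simp
  qed
  \<comment> \<open>With k = 2, n = 3 and 1 + |w| \<le> 2|w| the growth estimate has 16 * 8 * 8 =
    1024 on the right against 9 on the left.\<close>
  have lin: "cmod (g z) \<le> (1024 / 9 * (C1 + C2)) * cmod z ^ 1" if z: "1 \<le> cmod z" for z
  proof -
    have "cmod (g z) * (3 * (cmod z)\<^sup>2) ^ 2 \<le> (4 * cmod z) ^ 2 * ((8 * (C1 + C2)) * (2 * cmod z) ^ 3)"
    proof (rule entire_growth_off_real_axis[OF g _ z])
      fix w assume w: "1 \<le> cmod w"
      have "(1 + cmod w) ^ 3 \<le> (2 * cmod w) ^ 3" using w by (intro power_mono) auto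
      then have "(C1 + C2) * (1 + cmod w) ^ 3 \<le> (C1 + C2) * (2 * cmod w) ^ 3"
        using C0 by (rule mult_left_mono)
      moreover have "8 * (C1 + C2) * cmod w ^ 3 = (C1 + C2) * (2 * cmod w) ^ 3"
        by (simp add: power_mult_distrib)
      moreover have "cmod (g w) * \<bar>Im w\<bar> ^ 2 \<le> (C1 + C2) * (1 + cmod w) ^ 3"
        using all[of w] C0 by (cases "Im w = 0") auto
      ultimately show "cmod (g w) * \<bar>Im w\<bar> ^ 2 \<le> 8 * (C1 + C2) * cmod w ^ 3"
        by linarith
    qed
    then have "cmod z ^ 4 * (9 * cmod (g z)) \<le> cmod z ^ 4 * (1024 * (C1 + C2) * cmod z)"
      by (simp add: power_mult_distrib power2_eq_square power3_eq_cube power4_eq_xxxx algebra_simps)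
    moreover have "cmod z ^ 4 > 0" using z by (intro zero_less_power) linarith
    ultimately show ?thesis by (simp add: mult_le_cancel_left_pos)
  qed
  define a b where "a = g 0" and "b = deriv g 0"
  have gz: "g z = a + b * z" for z
    using Liouville_polynomial[OF g lin, where \<xi> = z] by (simp add: a_def b_def)
  have "Re a = 0" using re[of 0] by (simp add: a_def)
  moreover have "Re b = 0" using re[of 1] gz[of 1] \<open>Re a = 0\<close> by simp
  ultimately have "g z = \<i> * (complex_of_real (Im b) * z + complex_of_real (Im a))" for z
    unfolding gz by (auto simp: complex_eq_iff algebra_simps)
  then show ?thesis by (rule that)
qed

section \<open>Complex Hilbert spaces\<close>

locale cplx_hilbert =
  fixes sc :: "complex \<Rightarrow> 'h::banach \<Rightarrow> 'h" and ip :: "'h \<Rightarrow> 'h \<Rightarrow> complex"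
  assumes ch: "complex_hilbert sc ip"
begin

lemma sc_of_real: "sc (complex_of_real r) x = r *\<^sub>R x"
  and sc_mult: "sc (a * b) x = sc a (sc b x)"
  and sc_add_right: "sc a (x + y) = sc a x + sc a y"
  and sc_add_left: "sc (a + b) x = sc a x + sc b x"
  and ip_add_left: "ip (x + y) z = ip x z + ip y z"
  and ip_sc_left: "ip (sc a x) y = a * ip x y"
  and ip_commute: "ip y x = cnj (ip x y)"
  and ip_self: "ip x x = complex_of_real ((norm x)\<^sup>2)"
  using ch unfolding complex_hilbert_def by blast+

lemma sc_one [simp]: "sc 1 x = x" and sc_zero_left [simp]: "sc 0 x = 0"
  using sc_of_real[of 1 x] sc_of_real[of 0 x] by auto

lemma sc_zero_right [simp]: "sc a 0 = 0"
  using sc_add_right[of a 0 0] by simp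

lemma sc_minus_one: "sc (-1) x = - x"
  using sc_of_real[of "-1" x] by simp

lemma sc_minus_right: "sc a (- x) = - sc a x"
  using sc_add_right[of a x "- x"] by (simp add: add_eq_0_iff)

lemma sc_diff_right: "sc a (x - y) = sc a x - sc a y"
  using sc_add_right[of a x "- y"] by (simp add: sc_minus_right)

lemma sc_minus_left: "sc (- a) x = - sc a x"
  using sc_add_left[of a "- a" x] by (simp add: add_eq_0_iff)

lemma sc_diff_left: "sc (a - b) x = sc a x - sc b x"
  using sc_add_left[of a "- b" x] by (simp add: sc_minus_left)

lemma sc_inverse: "a \<noteq> 0 \<Longrightarrow> sc a (sc (1 / a) x) = x" "a \<noteq> 0 \<Longrightarrow> sc (1 / a) (sc a x) = x"
  by (simp_all flip: sc_mult)

lemma ip_add_right: "ip x (y + z) = ip x y + ip x z"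
  by (metis complex_cnj_add ip_add_left ip_commute)

lemma ip_sc_right: "ip x (sc a y) = cnj a * ip x y"
  by (metis complex_cnj_mult ip_sc_left ip_commute)

lemma ip_zero_left [simp]: "ip 0 y = 0" and ip_zero_right [simp]: "ip x 0 = 0"
  using ip_add_left[of 0 0 y] ip_add_right[of x 0 0] by auto

lemma ip_minus_left: "ip (- x) y = - ip x y" and ip_minus_right: "ip x (- y) = - ip x y"
  using ip_add_left[of x "- x" y] ip_add_right[of x y "- y"] by (auto simp: add_eq_0_iff)

lemma ip_diff_left: "ip (x - y) z = ip x z - ip y z"
  using ip_add_left[of x "- y" z] by (simp add: ip_minus_left)

lemma ip_diff_right: "ip x (y - z) = ip x y - ip x z"
  using ip_add_right[of x y "- z"] by (simp add: ip_minus_right)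

lemma norm_sq: "(norm x)\<^sup>2 = Re (ip x x)"
  by (simp add: ip_self)

lemma ip_self_eq_0 [simp]: "ip x x = 0 \<longleftrightarrow> x = 0"
  by (simp add: ip_self)

lemma norm_sc: "norm (sc a x) = cmod a * norm x"
proof -
  have "complex_of_real ((norm (sc a x))\<^sup>2) = a * cnj a * ip x x"
    unfolding ip_self[symmetric] ip_sc_left ip_sc_right by simp
  also have "\<dots> = complex_of_real ((cmod a * norm x)\<^sup>2)"
    unfolding complex_norm_square[symmetric] ip_self by (simp add: power_mult_distrib)
  finally have "(norm (sc a x))\<^sup>2 = (cmod a * norm x)\<^sup>2"
    using of_real_eq_iff by blast
  then show ?thesis by simp
qed

lemma norm_add_sq: "(norm (x + y))\<^sup>2 = (norm x)\<^sup>2 + 2 * Re (ip x y) + (norm y)\<^sup>2"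
proof -
  have "Re (ip y x) = Re (ip x y)" by (subst ip_commute) simp
  then show ?thesis by (simp add: norm_sq ip_add_left ip_add_right)
qed

lemma norm_diff_sq: "(norm (x - y))\<^sup>2 = (norm x)\<^sup>2 - 2 * Re (ip x y) + (norm y)\<^sup>2"
  using norm_add_sq[of x "- y"] by (simp add: ip_minus_right)

lemma parallelogram: "(norm (x + y :: 'h))\<^sup>2 + (norm (x - y))\<^sup>2 = 2 * (norm x)\<^sup>2 + 2 * (norm y)\<^sup>2"
  using norm_add_sq[of x y] norm_diff_sq[of x y] by linarith

lemma Cauchy_Schwarz: "cmod (ip x y) \<le> norm x * norm y"
proof (cases "y = 0")
  case False
  define a where "a = ip x y / ip y y"
  have "ip (x - sc a y) (x - sc a y) = ip x x - a * ip y x - cnj a * ip x y + a * cnj a * ip y y"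
    by (simp add: ip_diff_left ip_diff_right ip_sc_left ip_sc_right algebra_simps)
  also have "a * cnj a * ip y y = cnj a * ip x y"
    using False by (simp add: a_def)
  also have "a * ip y x = complex_of_real ((cmod (ip x y))\<^sup>2 / (norm y)\<^sup>2)"
    unfolding a_def ip_commute[of y x] ip_self using complex_norm_square[of "ip x y"] by simp
  finally have "ip (x - sc a y) (x - sc a y) = complex_of_real ((norm x)\<^sup>2 - (cmod (ip x y))\<^sup>2 / (norm y)\<^sup>2)"
    by (simp add: ip_self)
  then have "(norm (x - sc a y))\<^sup>2 = (norm x)\<^sup>2 - (cmod (ip x y))\<^sup>2 / (norm y)\<^sup>2"
    unfolding ip_self of_real_eq_iff .
  then have "(cmod (ip x y))\<^sup>2 / (norm y)\<^sup>2 \<le> (norm x)\<^sup>2"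
    using zero_le_power2[of "norm (x - sc a y)"] by linarith
  then have "(cmod (ip x y))\<^sup>2 \<le> (norm x * norm y)\<^sup>2"
    using False by (simp add: pos_divide_le_eq power_mult_distrib)
  then show ?thesis by (rule power2_le_imp_le) simp
qed simp

lemma bounded_linear_ip_left: "bounded_linear (\<lambda>x. ip x y)"
proof (rule bounded_linear_intro[where K = "norm y"])
  show "ip (r *\<^sub>R x) y = r *\<^sub>R ip x y" for r x
    by (simp flip: sc_of_real add: ip_sc_left scaleR_conv_of_real)
qed (use Cauchy_Schwarz in \<open>auto simp: ip_add_left\<close>)

lemma bounded_linear_ip_right: "bounded_linear (\<lambda>y. ip x y)"
proof (rule bounded_linear_intro[where K = "norm x"])
  show "ip x (r *\<^sub>R y) = r *\<^sub>R ip x y" for r y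
    by (simp flip: sc_of_real add: ip_sc_right scaleR_conv_of_real)
  show "norm (ip x y) \<le> norm y * norm x" for y
    using Cauchy_Schwarz[of x y] by (simp add: mult.commute)
qed (simp add: ip_add_right)

lemmas tendsto_ip_left = bounded_linear.tendsto[OF bounded_linear_ip_left]
lemmas tendsto_ip_right = bounded_linear.tendsto[OF bounded_linear_ip_right]

lemma bounded_linear_sc: "bounded_linear (sc a)"
proof (rule bounded_linear_intro[where K = "cmod a"])
  show "sc a (r *\<^sub>R x) = r *\<^sub>R sc a x" for r x
    by (simp flip: sc_of_real sc_mult add: mult.commute)
qed (simp_all add: sc_add_right norm_sc mult.commute)

section \<open>Closed subspaces, orthogonal projection and Riesz representation\<close>

lemma csubspace_diff: "csubspace sc M \<Longrightarrow> x \<in> M \<Longrightarrow> y \<in> M \<Longrightarrow> x - y \<in> M"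
  unfolding csubspace_def by (metis diff_conv_add_uminus sc_minus_one)

lemma csubspace_scaleR: "csubspace sc M \<Longrightarrow> x \<in> M \<Longrightarrow> r *\<^sub>R x \<in> M"
  unfolding csubspace_def by (metis sc_of_real)

lemma csubspace_closure:
  assumes "csubspace sc M"
  shows "csubspace sc (closure M)"
  unfolding csubspace_def
proof (intro conjI ballI allI)
  show "0 \<in> closure M" using assms closure_subset unfolding csubspace_def by blast
  fix x assume x: "x \<in> closure M"
  then obtain X where X: "\<And>n. X n \<in> M" "X \<longlonglongrightarrow> x" unfolding closure_sequential by blast
  show "x + y \<in> closure M" if y: "y \<in> closure M" for y
  proof -
    obtain Y where Y: "\<And>n. Y n \<in> M" "Y \<longlonglongrightarrow> y" using y unfolding closure_sequential by blast
    have "(\<lambda>n. X n + Y n) \<longlonglongrightarrow> x + y" by (intro tendsto_add X Y)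
    moreover have "X n + Y n \<in> M" for n using assms X Y unfolding csubspace_def by blast
    ultimately show ?thesis unfolding closure_sequential by (intro exI[of _ "\<lambda>n. X n + Y n"]) auto
  qed
  show "sc a x \<in> closure M" for a
  proof -
    have "(\<lambda>n. sc a (X n)) \<longlonglongrightarrow> sc a x" by (intro bounded_linear.tendsto[OF bounded_linear_sc] X)
    moreover have "sc a (X n) \<in> M" for n using assms X unfolding csubspace_def by blast
    ultimately show ?thesis unfolding closure_sequential by (intro exI[of _ "\<lambda>n. sc a (X n)"]) auto
  qed
qed

lemma minimizer_orthogonal:
  assumes M: "csubspace sc M" and m: "m \<in> M" and min: "\<And>v. v \<in> M \<Longrightarrow> norm (x - m) \<le> norm (x - v)" and v: "v \<in> M"
  shows "ip (x - m) v = 0"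
proof (cases "v = 0")
  case False
  define u where "u = x - m"
  define a where "a = ip u v / complex_of_real ((norm v)\<^sup>2)"
  have "m + sc a v \<in> M" using M m v unfolding csubspace_def by blast
  from min[OF this] have "norm u \<le> norm (u - sc a v)"
    by (simp add: u_def algebra_simps)
  then have "(norm u)\<^sup>2 \<le> (norm (u - sc a v))\<^sup>2" by (intro power_mono) auto
  also have "\<dots> = (norm u)\<^sup>2 - 2 * Re (cnj a * ip u v) + (cmod a * norm v)\<^sup>2"
    by (simp add: norm_diff_sq ip_sc_right norm_sc)
  also have "cnj a * ip u v = complex_of_real ((cmod (ip u v))\<^sup>2 / (norm v)\<^sup>2)"
    unfolding a_def using complex_norm_square[of "ip u v"] by (simp add: mult.commute)
  also have "(cmod a * norm v)\<^sup>2 = (cmod (ip u v))\<^sup>2 / (norm v)\<^sup>2"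
  proof -
    have "cmod a = cmod (ip u v) / (norm v)\<^sup>2"
      by (simp add: a_def norm_divide norm_power)
    then show ?thesis using False by (simp add: power_mult_distrib power_divide power2_eq_square power4_eq_xxxx)
  qed
  finally have "(cmod (ip u v))\<^sup>2 / (norm v)\<^sup>2 \<le> 0" by simp
  then show ?thesis using False by (simp add: u_def[symmetric] divide_le_0_iff)
qed simp

lemma projection_exists:
  assumes M: "csubspace sc M" and cl: "closed M"
  obtains m where "m \<in> M" "\<And>v. v \<in> M \<Longrightarrow> ip (x - m) v = 0"
proof -
  define d where "d = infdist x M"
  have ne: "M \<noteq> {}" using M unfolding csubspace_def by blast
  have d: "d \<le> norm (x - v)" if "v \<in> M" for v
    using infdist_le[OF that, of x] by (simp add: d_def dist_norm)
  have d0: "d \<ge> 0" by (simp add: d_def infdist_nonneg)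
  have "\<exists>v\<in>M. norm (x - v) < d + 1 / real (Suc n)" for n
  proof (rule ccontr)
    assume "\<not> ?thesis"
    then have "d + 1 / real (Suc n) \<le> infdist x M"
      unfolding infdist_def using ne by (auto intro!: cINF_greatest simp: dist_norm not_less)
    then show False by (simp add: d_def)
  qed
  then obtain X where X: "\<And>n. X n \<in> M" "\<And>n. norm (x - X n) < d + 1 / real (Suc n)" by metis
  have lim: "(\<lambda>n. norm (x - X n)) \<longlonglongrightarrow> d"
  proof (rule tendsto_sandwich[of "\<lambda>_. d" _ _ "\<lambda>n. d + 1 / real (Suc n)"])
    show "(\<lambda>n. d + 1 / real (Suc n)) \<longlonglongrightarrow> d"
      using tendsto_add[OF tendsto_const LIMSEQ_inverse_real_of_nat, of d] by (simp add: inverse_eq_divide)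
  qed (use X d in \<open>auto intro!: always_eventually less_imp_le\<close>)
  \<comment> \<open>Parallelogram law: the midpoint of two elements of M is again at distance at
    least d from x, so a minimizing sequence is Cauchy.\<close>
  have bound: "(norm (X i - X j))\<^sup>2 \<le> 2 * (norm (x - X i))\<^sup>2 + 2 * (norm (x - X j))\<^sup>2 - 4 * d\<^sup>2" for i j
  proof -
    have "(1/2) *\<^sub>R (X i + X j) \<in> M"
      using M X(1) csubspace_scaleR unfolding csubspace_def by blast
    from d[OF this] have "d\<^sup>2 \<le> (norm (x - (1/2) *\<^sub>R (X i + X j)))\<^sup>2"
      using d0 by (intro power_mono) auto
    moreover have "(x - X i) + (x - X j) = 2 *\<^sub>R (x - (1/2) *\<^sub>R (X i + X j))"
      by (simp add: algebra_simps scaleR_2)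
    then have "(norm ((x - X i) + (x - X j)))\<^sup>2 = 4 * (norm (x - (1/2) *\<^sub>R (X i + X j)))\<^sup>2"
      by (simp add: power_mult_distrib)
    moreover have "norm ((x - X i) - (x - X j)) = norm (X i - X j)" by (simp add: norm_minus_commute)
    ultimately show ?thesis using parallelogram[of "x - X i" "x - X j"] by simp
  qed
  have "Cauchy X"
  proof (rule metric_CauchyI)
    fix e :: real assume e: "e > 0"
    have "(\<lambda>n. (norm (x - X n))\<^sup>2) \<longlonglongrightarrow> d\<^sup>2" by (intro tendsto_intros lim)
    then have "eventually (\<lambda>n. (norm (x - X n))\<^sup>2 < d\<^sup>2 + e\<^sup>2 / 4) sequentially"
      using e by (intro order_tendstoD) auto
    then obtain N where N: "\<And>n. n \<ge> N \<Longrightarrow> (norm (x - X n))\<^sup>2 < d\<^sup>2 + e\<^sup>2 / 4"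
      unfolding eventually_sequentially by blast
    show "\<exists>N. \<forall>m\<ge>N. \<forall>n\<ge>N. dist (X m) (X n) < e"
    proof (intro exI[of _ N] allI impI)
      fix m n assume "m \<ge> N" "n \<ge> N"
      then have "(norm (X m - X n))\<^sup>2 < e\<^sup>2" using bound[of m n] N[of m] N[of n] by linarith
      then show "dist (X m) (X n) < e" unfolding dist_norm using e by (meson power_less_imp_less_base less_imp_le)
    qed
  qed
  then obtain m where m: "X \<longlonglongrightarrow> m" using Cauchy_convergent convergent_def by blast
  have "m \<in> M" using cl X(1) m closed_sequentially by blast
  have "(\<lambda>n. norm (x - X n)) \<longlonglongrightarrow> norm (x - m)" by (intro tendsto_intros m)
  then have "norm (x - m) = d" using lim LIMSEQ_unique by blast
  then have "ip (x - m) v = 0" if "v \<in> M" for v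
    using minimizer_orthogonal[OF M \<open>m \<in> M\<close> _ that] d by simp
  then show ?thesis using \<open>m \<in> M\<close> that by blast
qed

lemma dense_if_orthogonal_trivial:
  assumes M: "csubspace sc M" and triv: "\<And>y. (\<And>v. v \<in> M \<Longrightarrow> ip y v = 0) \<Longrightarrow> y = 0"
  shows "closure M = UNIV"
proof -
  have "x \<in> closure M" for x
  proof -
    obtain m where m: "m \<in> closure M" "\<And>v. v \<in> closure M \<Longrightarrow> ip (x - m) v = 0"
      using projection_exists[OF csubspace_closure[OF M] closed_closure] by blast
    have "x - m = 0" using m(2) closure_subset by (intro triv) blast
    then show ?thesis using m(1) by simp
  qed
  then show ?thesis by blast
qed

lemma orthogonal_dense_zero:
  assumes "closure M = UNIV" and "\<And>v. v \<in> M \<Longrightarrow> ip v y = 0"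
  shows "y = 0"
proof -
  obtain X where X: "\<And>n. X n \<in> M" "X \<longlonglongrightarrow> y"
    using assms(1) closure_sequential[of y M] by blast
  have "(\<lambda>n. ip (X n) y) \<longlonglongrightarrow> ip y y" by (intro tendsto_ip_left X)
  then have "(\<lambda>n. 0) \<longlonglongrightarrow> ip y y" using assms(2) X(1) by simp
  then show ?thesis using LIMSEQ_unique[OF tendsto_const, of 0 "ip y y"] by simp
qed

lemma Riesz_representation:
  assumes add: "\<And>x y. f (x + y) = f x + f y" and sc: "\<And>a x. f (sc a x) = a * f x"
    and bd: "\<And>x. cmod (f x) \<le> C * norm x"
  obtains u where "\<And>x. f x = ip x u"
proof (cases "\<forall>x. f x = 0")
  case True
  then show ?thesis using that[of 0] by simp
next
  case False
  then obtain x0 where x0: "f x0 \<noteq> 0" by blast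
  have bl: "bounded_linear f"
  proof (rule bounded_linear_intro[where K = C])
    show "f (r *\<^sub>R x) = r *\<^sub>R f x" for r x
      by (simp flip: sc_of_real add: sc scaleR_conv_of_real)
  qed (use add bd in \<open>auto simp: mult.commute\<close>)
  define M where "M = {x. f x = 0}"
  have f0: "f 0 = 0" using add[of 0 0] by simp
  have M: "csubspace sc M" unfolding csubspace_def M_def by (auto simp: add sc f0)
  have "closed M"
    unfolding M_def using closed_Collect_eq[OF linear_continuous_on[OF bl] continuous_on_const] by simp
  then obtain m where m: "m \<in> M" "\<And>v. v \<in> M \<Longrightarrow> ip (x0 - m) v = 0"
    using projection_exists[OF M] by blast
  define n where "n = x0 - m"
  have fn: "f n = f x0" using add[of n m] m(1) by (simp add: n_def M_def)
  then have n0: "n \<noteq> 0" using x0 f0 by auto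
  define u where "u = sc (cnj (f n) / complex_of_real ((norm n)\<^sup>2)) n"
  have "f x = ip x u" for x
  proof -
    have "f (x + sc (- (f x / f n)) n) = 0" using fn x0 by (simp add: add sc)
    then have "ip n (x + sc (- (f x / f n)) n) = 0" using m(2) by (simp add: n_def M_def)
    then have "ip (x + sc (- (f x / f n)) n) n = 0" by (subst ip_commute) simp
    then have "ip x n = f x / f n * complex_of_real ((norm n)\<^sup>2)"
      by (simp add: ip_add_left ip_sc_left ip_self)
    then show ?thesis
      using n0 fn x0 by (simp add: u_def ip_sc_right)
  qed
  then show ?thesis by (rule that)
qed

end

section \<open>Hilbert spaces with de Branges kernel\<close>

text \<open>The hypothesis does not bound g at p, which may lie in the half-plane. Compactness
  bounds g on the unit disc about p, and \<open>shift_bound\<close> handles the rest.\<close>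

lemma hardy_bound_decay_at:
  assumes U: "open U" "{z. 0 \<le> Im z} \<subseteq> U" "g holomorphic_on U"
    and le: "\<And>z. 0 \<le> Im z \<Longrightarrow> cmod (z - p) * cmod (g z) \<le> M"
  obtains C where "hardy_bound g C"
proof -
  have "compact ({z. 0 \<le> Im z} \<inter> cball p 1)"
    by (intro closed_Int_compact closed_halfspace_Im_ge compact_cball)
  moreover have "continuous_on ({z. 0 \<le> Im z} \<inter> cball p 1) g"
    using U by (intro holomorphic_on_imp_continuous_on) (auto intro: holomorphic_on_subset)
  ultimately have "bounded (g ` ({z. 0 \<le> Im z} \<inter> cball p 1))"
    by (intro compact_imp_bounded compact_continuous_image)
  then obtain N where N: "N > 0" "\<And>z. 0 \<le> Im z \<Longrightarrow> cmod (z - p) \<le> 1 \<Longrightarrow> cmod (g z) \<le> N"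
    by (auto simp: bounded_pos dist_norm norm_minus_commute)
  define K where "K = (M\<^sup>2 + N\<^sup>2) * (3 + 2 * (Re p)\<^sup>2)"
  have "hardy_bound g (K * pi)"
  proof (rule hardy_bound_decay[OF U])
    fix z assume z: "0 \<le> Im z"
    have "(cmod (g z))\<^sup>2 * max 1 ((cmod (z - p))\<^sup>2) \<le> M\<^sup>2 + N\<^sup>2"
    proof (cases "cmod (z - p) \<le> 1")
      case True
      then have "max 1 ((cmod (z - p))\<^sup>2) = 1" by (simp add: max_absorb1 power_le_one)
      then show ?thesis using power_mono[OF N(2)[OF z True], of 2] by (simp add: add_increasing)
    next
      case False
      then have "max 1 ((cmod (z - p))\<^sup>2) = (cmod (z - p))\<^sup>2" by (simp add: max_absorb2)
      then show ?thesis using power_mono[OF le[OF z], of 2] by (simp add: power_mult_distrib mult.commute add_increasing2)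
    qed
    then have "(cmod (g z))\<^sup>2 * max 1 ((cmod (z - p))\<^sup>2) * (3 + 2 * (Re p)\<^sup>2) \<le> K"
      unfolding K_def by (rule mult_right_mono) simp
    moreover have "(cmod (g z))\<^sup>2 * (1 + (Re z)\<^sup>2) \<le> (cmod (g z))\<^sup>2 * ((3 + 2 * (Re p)\<^sup>2) * max 1 ((cmod (z - p))\<^sup>2))"
      by (intro mult_left_mono shift_bound) simp
    ultimately have "(cmod (g z))\<^sup>2 * (1 + (Re z)\<^sup>2) \<le> K"
      by (simp add: mult_ac)
    then show "(cmod (g z))\<^sup>2 \<le> K / (1 + (Re z)\<^sup>2)"
      by (subst pos_le_divide_eq) (auto simp: add_pos_nonneg)
  qed
  then show ?thesis by (rule that)
qed

lemma hardy_bound_add: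
  assumes "hardy_bound g C" "hardy_bound h D"
  shows "hardy_bound (\<lambda>z. g z + h z) (2 * C + 2 * D)"
  using hardy_bound_diff[OF assms(1) hardy_bound_cmult[OF assms(2), of "-1"]] by simp

lemma sharp_holomorphic:
  assumes "f holomorphic_on UNIV"
  shows "sharp f holomorphic_on UNIV"
  using holomorphic_on_compose_cnj_cnj[of f UNIV] assms
  by (auto simp: o_def sharp_def[abs_def] intro: holomorphic_on_subset)

lemma sharp_real: "sharp f (Complex t 0) = cnj (f (Complex t 0))"
proof -
  have "cnj (Complex t 0) = Complex t 0" by (simp add: complex_eq_iff)
  then show ?thesis by (simp add: sharp_def)
qed

lemma integrable_mult_cnj:
  assumes [measurable]: "f \<in> borel_measurable lborel" "g \<in> borel_measurable lborel"
    and f: "integrable lborel (\<lambda>x. (cmod (f x))\<^sup>2)" and g: "integrable lborel (\<lambda>x. (cmod (g x))\<^sup>2)"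
  shows "integrable lborel (\<lambda>x. f x * cnj (g x))"
    and "cmod (LINT x|lborel. f x * cnj (g x)) \<le> ((LINT x|lborel. (cmod (f x))\<^sup>2) + (LINT x|lborel. (cmod (g x))\<^sup>2)) / 2"
proof -
  have [measurable]: "cnj \<in> borel_measurable borel"
    by (intro borel_measurable_continuous_onI continuous_intros)
  have i: "integrable lborel (\<lambda>x. ((cmod (f x))\<^sup>2 + (cmod (g x))\<^sup>2) / 2)"
    using f g by simp
  have le: "cmod (f x * cnj (g x)) \<le> ((cmod (f x))\<^sup>2 + (cmod (g x))\<^sup>2) / 2" for x
    using sum_prod_le[of "cmod (f x)" "cmod (g x)"] by (simp add: norm_mult)
  show j: "integrable lborel (\<lambda>x. f x * cnj (g x))"
  proof (rule Bochner_Integration.integrable_bound[OF i])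
    show "AE x in lborel. norm (f x * cnj (g x)) \<le> norm (((cmod (f x))\<^sup>2 + (cmod (g x))\<^sup>2) / 2)"
      by (intro AE_I2 order_trans[OF le]) simp
  qed measurable
  have "cmod (LINT x|lborel. f x * cnj (g x)) \<le> (LINT x|lborel. cmod (f x * cnj (g x)))"
    by (rule integral_norm_bound)
  also have "\<dots> \<le> (LINT x|lborel. ((cmod (f x))\<^sup>2 + (cmod (g x))\<^sup>2) / 2)"
    by (intro integral_mono integrable_norm i j le)
  also have "\<dots> = ((LINT x|lborel. (cmod (f x))\<^sup>2) + (LINT x|lborel. (cmod (g x))\<^sup>2)) / 2"
    using f g by simp
  finally show "cmod (LINT x|lborel. f x * cnj (g x)) \<le> ((LINT x|lborel. (cmod (f x))\<^sup>2) + (LINT x|lborel. (cmod (g x))\<^sup>2)) / 2" .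
qed

locale hermite_biehler_no_real_zeros =
  fixes E :: "complex \<Rightarrow> complex"
  assumes HB: "hermite_biehler E" and real_nonzero: "\<And>t. E (complex_of_real t) \<noteq> 0"
begin

lemma E_entire: "E holomorphic_on UNIV"
  using HB unfolding hermite_biehler_def by blast

lemma E_nonzero:
  assumes "Im z \<ge> 0"
  shows "E z \<noteq> 0"
proof (cases "Im z = 0")
  case True
  then have "complex_of_real (Re z) = z" by (simp add: complex_eq_iff)
  then show ?thesis using real_nonzero[of "Re z"] by simp
next
  case False
  then have "cmod (E z) > cmod (E (cnj z))" using assms HB unfolding hermite_biehler_def by simp
  then show ?thesis by auto
qed

lemma sharp_E_le: "Im z \<ge> 0 \<Longrightarrow> cmod (sharp E z) \<le> cmod (E z)"
proof (cases "Im z = 0")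
  case True
  then have "cnj z = z" by (simp add: complex_eq_iff)
  then show ?thesis by (simp add: sharp_def)
qed (use HB in \<open>auto simp: hermite_biehler_def sharp_def less_imp_le\<close>)

lemma E_domain: "open {z. E z \<noteq> 0}" "{z. 0 \<le> Im z} \<subseteq> {z. E z \<noteq> 0}"
  using open_Collect_neq[OF holomorphic_on_imp_continuous_on[OF E_entire] continuous_on_const] E_nonzero by auto

lemma quotient_holomorphic: "f holomorphic_on UNIV \<Longrightarrow> (\<lambda>z. f z / E z) holomorphic_on {z. E z \<noteq> 0}"
  using E_entire by (intro holomorphic_intros) (auto intro: holomorphic_on_subset)

lemma de_branges_hardy:
  assumes "f \<in> de_branges E"
  obtains C D where "hardy_bound (\<lambda>z. f z / E z) C" "hardy_bound (\<lambda>z. sharp f z / E z) D"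
proof -
  have "f holomorphic_on UNIV" "H2_upper (\<lambda>z. f z / E z)" "H2_upper (\<lambda>z. sharp f z / E z)"
    using assms unfolding de_branges_def by auto
  then show ?thesis
    using that H2_upper_imp_hardy_bound[OF _ E_domain quotient_holomorphic] sharp_holomorphic by metis
qed

lemma hardy_imp_de_branges:
  assumes "f holomorphic_on UNIV" "hardy_bound (\<lambda>z. f z / E z) C" "hardy_bound (\<lambda>z. sharp f z / E z) D"
  shows "f \<in> de_branges E"
  using assms hardy_bound_imp_H2_upper unfolding de_branges_def by auto

end

text \<open>Abstract situation of a space of functions z \<mapsto> <x, \<psi>(z)> whose kernel
  <\<psi>(w), \<psi>(z)> is that of H(E). Multiplying out the denominator keeps the identity
  meaningful at z = \<open>cnj w\<close>; \<open>total\<close> is injectivity of the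
  transform.\<close>

locale de_branges_kernel = cplx_hilbert sc ip + hermite_biehler_no_real_zeros E
  for sc :: "complex \<Rightarrow> 'h::banach \<Rightarrow> 'h" and ip E +
  fixes \<psi> :: "complex \<Rightarrow> 'h"
  assumes total: "\<And>x. (\<And>z. ip x (\<psi> z) = 0) \<Longrightarrow> x = 0"
    and entire: "\<And>x. (\<lambda>z. ip x (\<psi> z)) holomorphic_on UNIV"
    and kernel: "\<And>w z. 2 * pi * (z - cnj w) * ip (\<psi> w) (\<psi> z)
        = \<i> * (cnj (E w) * E z - cnj (sharp E w) * sharp E z)"
begin

definition W where "W x z = ip x (\<psi> z)"

lemma W_entire: "W x holomorphic_on UNIV"
  using entire unfolding W_def[abs_def] .

lemma W_add: "W (x + y) z = W x z + W y z" and W_sc: "W (sc a x) z = a * W x z"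
  and W_diff: "W (x - y) z = W x z - W y z" and W_zero: "W 0 z = 0"
  unfolding W_def by (simp_all add: ip_add_left ip_sc_left ip_diff_left)

text \<open>A provisional notion: in the end every vector is good, by \<open>all_hardy\<close>.
  Until then it records membership in H(E) with unspecified bounds, a property stable under linear
  combinations.\<close>

definition good where "good x \<longleftrightarrow> (\<exists>C. hardy_bound (\<lambda>z. W x z / E z) C) \<and> (\<exists>C. hardy_bound (\<lambda>z. sharp (W x) z / E z) C)"

lemma good_de_branges: "good x \<longleftrightarrow> W x \<in> de_branges E"
  unfolding good_def using W_entire hardy_imp_de_branges de_branges_hardy by metis

lemma csubspace_good: "csubspace sc {x. good x}"
  unfolding csubspace_def
proof (intro conjI ballI allI)
  have "hardy_bound (\<lambda>z. 0) 0"
    unfolding hardy_bound_def by (auto intro!: exI[of _ UNIV])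
  then show "0 \<in> {x. good x}"
    unfolding good_def sharp_def by (simp add: W_zero) blast
  fix x assume "x \<in> {x. good x}"
  then obtain C D where x: "hardy_bound (\<lambda>z. W x z / E z) C" "hardy_bound (\<lambda>z. sharp (W x) z / E z) D"
    unfolding good_def by auto
  show "x + y \<in> {x. good x}" if y: "y \<in> {x. good x}" for y
  proof -
    obtain C' D' where y: "hardy_bound (\<lambda>z. W y z / E z) C'" "hardy_bound (\<lambda>z. sharp (W y) z / E z) D'"
      using y unfolding good_def by auto
    have "(\<lambda>z. W (x + y) z / E z) = (\<lambda>z. W x z / E z + W y z / E z)"
      "(\<lambda>z. sharp (W (x + y)) z / E z) = (\<lambda>z. sharp (W x) z / E z + sharp (W y) z / E z)"
      by (simp_all add: fun_eq_iff W_add sharp_def add_divide_distrib)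
    then show ?thesis
      using hardy_bound_add[OF x(1) y(1)] hardy_bound_add[OF x(2) y(2)]
      unfolding good_def mem_Collect_eq by metis
  qed
  show "sc a x \<in> {x. good x}" for a
  proof -
    have "(\<lambda>z. W (sc a x) z / E z) = (\<lambda>z. a * (W x z / E z))"
      "(\<lambda>z. sharp (W (sc a x)) z / E z) = (\<lambda>z. cnj a * (sharp (W x) z / E z))"
      by (simp_all add: fun_eq_iff W_sc sharp_def)
    then show ?thesis
      using hardy_bound_cmult[OF x(1), of a] hardy_bound_cmult[OF x(2), of "cnj a"]
      unfolding good_def mem_Collect_eq by metis
  qed
qed

text \<open>The kernel identity and |\<open>sharp E\<close>| \<le> |E| on the closed half-plane
  bound the transform of \<psi>(w) by M|E(z)|/|z - \<open>cnj w\<close>|. For its reflection the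
  singular point becomes w itself, inside the half-plane, which is why decay at an arbitrary point
  is needed.\<close>

lemma good_psi:
  assumes w: "Im w > 0"
  shows "good (\<psi> w)"
proof -
  define M where "M = cmod (E w) + cmod (sharp E w)"
  have key: "cmod a * cmod b \<le> M * cmod (E z)"
    if eq: "2 * pi * cmod a * cmod b \<le> cmod (E w) * cmod (E z) + cmod (sharp E w) * cmod (E z)" for a b z
  proof -
    have "1 * (cmod a * cmod b) \<le> (2 * pi) * (cmod a * cmod b)"
      using pi_ge_two by (intro mult_right_mono) auto
    then show ?thesis using eq by (simp add: M_def algebra_simps)
  qed
  have 1: "cmod (z - cnj w) * cmod (W (\<psi> w) z / E z) \<le> M" if z: "0 \<le> Im z" for z
  proof -
    have "2 * pi * cmod (z - cnj w) * cmod (W (\<psi> w) z) = cmod (cnj (E w) * E z - cnj (sharp E w) * sharp E z)"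
      using arg_cong[OF kernel[of z w], of cmod] by (simp add: norm_mult W_def)
    also have "\<dots> \<le> cmod (E w) * cmod (E z) + cmod (sharp E w) * cmod (sharp E z)"
      by (rule order_trans[OF norm_triangle_ineq4]) (simp add: norm_mult)
    also have "\<dots> \<le> cmod (E w) * cmod (E z) + cmod (sharp E w) * cmod (E z)"
      by (intro add_left_mono mult_left_mono sharp_E_le z) simp
    finally show ?thesis
      using key E_nonzero[OF z] by (simp add: norm_divide pos_divide_le_eq)
  qed
  have 2: "cmod (z - w) * cmod (sharp (W (\<psi> w)) z / E z) \<le> M" if z: "0 \<le> Im z" for z
  proof -
    have "cmod (cnj z - cnj w) = cmod (z - w)"
      by (metis complex_cnj_diff complex_mod_cnj)
    then have "2 * pi * cmod (z - w) * cmod (sharp (W (\<psi> w)) z) = cmod (cnj (E w) * E (cnj z) - cnj (sharp E w) * sharp E (cnj z))"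
      using arg_cong[OF kernel[of "cnj z" w], of cmod] by (simp add: norm_mult W_def sharp_def)
    also have "\<dots> \<le> cmod (E w) * cmod (sharp E z) + cmod (sharp E w) * cmod (E z)"
      by (rule order_trans[OF norm_triangle_ineq4]) (simp add: norm_mult sharp_def)
    also have "\<dots> \<le> cmod (E w) * cmod (E z) + cmod (sharp E w) * cmod (E z)"
      by (intro add_right_mono mult_left_mono sharp_E_le z) simp
    finally show ?thesis
      using key E_nonzero[OF z] by (simp add: norm_divide pos_divide_le_eq)
  qed
  show ?thesis
    unfolding good_def
    using hardy_bound_decay_at[OF E_domain quotient_holomorphic[OF W_entire] 1]
      hardy_bound_decay_at[OF E_domain quotient_holomorphic[OF sharp_holomorphic[OF W_entire]] 2] by metis
qed

text \<open>On the real line \<open>sharp E\<close> is the conjugate of E, so the integrand splits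
  into the Cauchy integrand of f/E at v and the conjugate of that of \<open>sharp f\<close>/E at
  \<open>cnj v\<close>. The first yields 2 pi \<i> f(v)/E(v), the second vanishes because
  \<open>cnj v\<close> lies below the axis.\<close>

lemma reproducing:
  assumes f: "f \<in> de_branges E" and v: "Im v > 0"
  shows "(LINT t|lborel. f (Complex t 0) / E (Complex t 0) * cnj (W (\<psi> v) (Complex t 0) / E (Complex t 0))) = f v"
proof -
  obtain C D where C: "hardy_bound (\<lambda>z. f z / E z) C" and D: "hardy_bound (\<lambda>z. sharp f z / E z) D"
    using de_branges_hardy[OF f] by blast
  define g where "g t = f (Complex t 0) / E (Complex t 0) / (Complex t 0 - v)" for t
  define h where "h t = sharp f (Complex t 0) / E (Complex t 0) / (Complex t 0 - cnj v)" for t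
  have ig: "integrable lborel g" and ih: "integrable lborel h"
    using hardy_bound_over_linear_integrable[OF C, of v] hardy_bound_over_linear_integrable[OF D, of "cnj v"] v
    by (auto simp: g_def[abs_def] h_def[abs_def])
  have vg: "(LINT t|lborel. g t) = 2 * pi * \<i> * (f v / E v)" and vh: "(LINT t|lborel. h t) = 0"
    using hardy_Cauchy_upper[OF C v] hardy_Cauchy_lower[OF D, of "cnj v"] v by (auto simp: g_def h_def)
  have pt: "f (Complex t 0) / E (Complex t 0) * cnj (W (\<psi> v) (Complex t 0) / E (Complex t 0))
      = (1 / (2 * pi * \<i>)) * (E v * g t - sharp E v * cnj (h t))" for t
  proof -
    define s where "s = Complex t 0"
    have cs: "cnj s = s" by (simp add: s_def complex_eq_iff)
    have E0: "E s \<noteq> 0" using E_nonzero[of s] by (simp add: s_def)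
    have d0: "s - v \<noteq> 0" using v by (auto simp: s_def complex_eq_iff)
    have sh: "sharp E s = cnj (E s)" "sharp f s = cnj (f s)" unfolding s_def by (simp_all add: sharp_real)
    have "cnj (2 * pi * (s - cnj v) * W (\<psi> v) s) = cnj (\<i> * (cnj (E v) * E s - cnj (sharp E v) * cnj (E s)))"
      using kernel[of s v] unfolding sh W_def by simp
    then have "2 * pi * (s - v) * cnj (W (\<psi> v) s) = - \<i> * (E v * cnj (E s) - sharp E v * E s)"
      by (simp add: cs)
    then have "cnj (W (\<psi> v) s) = - \<i> * (E v * cnj (E s) - sharp E v * E s) / (2 * pi * (s - v))"
      using d0 by (intro eq_divide_imp) (simp_all add: mult.commute)
    moreover have "1 / (2 * complex_of_real pi * \<i>) = - \<i> / (2 * pi)"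
      by (simp add: field_simps)
    ultimately have k: "cnj (W (\<psi> v) s / E s) = (1 / (2 * pi * \<i>)) * ((E v * cnj (E s) - sharp E v * E s) / (cnj (E s) * (s - v)))"
      by simp
    have "cnj (sharp f s / E s / (s - cnj v)) = f s / cnj (E s) / (s - v)"
      by (simp add: sh cs)
    moreover have "a * (F / e / d) - S * (F / c / d) = F / e * ((a * c - S * e) / (c * d))"
      if "e \<noteq> 0" "c \<noteq> 0" "d \<noteq> 0" for a F e d S c :: complex
      using that by (simp add: field_simps)
    ultimately have "E v * (f s / E s / (s - v)) - sharp E v * cnj (sharp f s / E s / (s - cnj v))
        = f s / E s * ((E v * cnj (E s) - sharp E v * E s) / (cnj (E s) * (s - v)))"
      using E0 d0 by simp
    then show ?thesis
      unfolding g_def h_def s_def[symmetric] k by (simp only: mult.left_commute)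
  qed
  have "(LINT t|lborel. E v * g t - sharp E v * cnj (h t)) = E v * (LINT t|lborel. g t) - sharp E v * cnj (LINT t|lborel. h t)"
    using ig ih by (subst Bochner_Integration.integral_diff) auto
  also have "\<dots> = 2 * pi * \<i> * f v"
    unfolding vg vh using E_nonzero[of v] v by simp
  finally show ?thesis
    unfolding pt by simp
qed

lemma line_facts:
  assumes "f \<in> de_branges E"
  shows "(\<lambda>t. f (Complex t 0) / E (Complex t 0)) \<in> borel_measurable lborel"
    and "integrable lborel (\<lambda>t. (cmod (f (Complex t 0) / E (Complex t 0)))\<^sup>2)"
proof -
  obtain C D where "hardy_bound (\<lambda>z. f z / E z) C"
    using de_branges_hardy[OF assms] by blast
  then show "(\<lambda>t. f (Complex t 0) / E (Complex t 0)) \<in> borel_measurable lborel"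
    and "integrable lborel (\<lambda>t. (cmod (f (Complex t 0) / E (Complex t 0)))\<^sup>2)"
    by (auto dest: hardy_bound_measurable[of _ _ 0] hardy_bound_integrable(1)[of _ _ 0])
qed

section \<open>The inner product of H(E) on combinations of kernel vectors\<close>

definition form where
  "form f g = (LINT t|lborel. f (Complex t 0) / E (Complex t 0) * cnj (g (Complex t 0) / E (Complex t 0)))"

lemma form_integrable:
  assumes "f \<in> de_branges E" "g \<in> de_branges E"
  shows "integrable lborel (\<lambda>t. f (Complex t 0) / E (Complex t 0) * cnj (g (Complex t 0) / E (Complex t 0)))"
  by (intro integrable_mult_cnj line_facts assms)

lemma form_cnj: "form f g = cnj (form g f)"
  unfolding form_def Bochner_Integration.integral_cnj[symmetric]
  by (intro Bochner_Integration.integral_cong) (simp_all add: mult.commute)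

lemma form_W_add_left:
  assumes "good x" "good y" "g \<in> de_branges E"
  shows "form (W (x + y)) g = form (W x) g + form (W y) g"
  unfolding form_def W_add add_divide_distrib distrib_right
  using assms by (intro Bochner_Integration.integral_add form_integrable) (auto simp: good_de_branges)

lemma form_W_sc_left: "form (W (sc a x)) g = a * form (W x) g"
  unfolding form_def W_sc by (simp flip: integral_mult_right_zero add: mult.assoc)

text \<open>Only points above the axis are used: there the reproducing formula is available, and the
  identity theorem makes them sufficient for density. The description as an intersection of
  subspaces is its own induction principle.\<close>

definition upper_span where
  "upper_span = \<Inter>{T. csubspace sc T \<and> \<psi> ` {z. Im z > 0} \<subseteq> T}"

lemma upper_span_csubspace: "csubspace sc upper_span"
  unfolding upper_span_def csubspace_def by blast

lemma psi_in_upper_span: "Im z > 0 \<Longrightarrow> \<psi> z \<in> upper_span"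
  unfolding upper_span_def by blast

lemma upper_span_least: "csubspace sc T \<Longrightarrow> (\<And>z. Im z > 0 \<Longrightarrow> \<psi> z \<in> T) \<Longrightarrow> upper_span \<subseteq> T"
  unfolding upper_span_def by blast

lemma upper_span_good: "x \<in> upper_span \<Longrightarrow> good x"
  using upper_span_least[OF csubspace_good] good_psi by blast

text \<open>Both sides are linear in u, and at u = \<psi>(v) both equal the conjugate of W x v by
  the reproducing formula.\<close>

lemma upper_span_form:
  assumes x: "good x" and u: "u \<in> upper_span"
  shows "form (W u) (W x) = ip u x"
proof -
  have "csubspace sc {u. good u \<and> form (W u) (W x) = ip u x}"
    unfolding csubspace_def
  proof (intro conjI ballI allI)
    show "0 \<in> {u. good u \<and> form (W u) (W x) = ip u x}"
      using csubspace_good unfolding csubspace_def by (simp add: form_def W_zero)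
    show "u + v \<in> {u. good u \<and> form (W u) (W x) = ip u x}"
      if "u \<in> {u. good u \<and> form (W u) (W x) = ip u x}" "v \<in> {u. good u \<and> form (W u) (W x) = ip u x}" for u v
      using that x csubspace_good unfolding csubspace_def
      by (simp add: form_W_add_left ip_add_left good_de_branges)
    show "sc a u \<in> {u. good u \<and> form (W u) (W x) = ip u x}"
      if "u \<in> {u. good u \<and> form (W u) (W x) = ip u x}" for u a
      using that csubspace_good unfolding csubspace_def by (simp add: form_W_sc_left ip_sc_left)
  qed
  moreover have "\<psi> v \<in> {u. good u \<and> form (W u) (W x) = ip u x}" if v: "Im v > 0" for v
  proof -
    have "form (W x) (W (\<psi> v)) = W x v"
      unfolding form_def using reproducing[of "W x", OF _ v] x by (simp add: good_de_branges)
    then have "form (W (\<psi> v)) (W x) = ip (\<psi> v) x"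
      by (metis W_def form_cnj ip_commute)
    then show ?thesis using good_psi[OF v] by simp
  qed
  ultimately show ?thesis using upper_span_least u by blast
qed

lemma form_self: "form f f = complex_of_real (LINT t|lborel. (cmod (f (Complex t 0) / E (Complex t 0)))\<^sup>2)"
  unfolding form_def by (simp only: complex_norm_square[symmetric] integral_complex_of_real)

lemma upper_span_dense: "closure upper_span = UNIV"
proof (rule dense_if_orthogonal_trivial[OF upper_span_csubspace])
  fix y assume "\<And>v. v \<in> upper_span \<Longrightarrow> ip y v = 0"
  then have "ip y (\<psi> z) = 0" if "Im z > 0" for z
    using psi_in_upper_span[OF that] by blast
  then have "ip y (\<psi> z) = 0" for z
    using entire_eq_on_upper_half_plane[OF entire[of y] holomorphic_on_const] by blast
  then show "y = 0" by (rule total)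
qed

text \<open>\<open>good\<close> gives only some constant, which could be unbounded along a sequence.
  The contraction estimate replaces it by the integral on the real line, which is the squared norm
  of x.\<close>

lemma upper_span_hardy:
  assumes x: "x \<in> upper_span"
  shows "hardy_bound (\<lambda>z. W x z / E z) ((norm x)\<^sup>2)" "hardy_bound (\<lambda>z. sharp (W x) z / E z) ((norm x)\<^sup>2)"
proof -
  have I: "(LINT t|lborel. (cmod (W x (Complex t 0) / E (Complex t 0)))\<^sup>2) = (norm x)\<^sup>2"
    using upper_span_form[OF upper_span_good[OF x] x] unfolding form_self ip_self of_real_eq_iff .
  obtain C D where CD: "hardy_bound (\<lambda>z. W x z / E z) C" "hardy_bound (\<lambda>z. sharp (W x) z / E z) D"
    using upper_span_good[OF x] unfolding good_def by blast
  have J: "(LINT t|lborel. (cmod (sharp (W x) (Complex t 0) / E (Complex t 0)))\<^sup>2) = (norm x)\<^sup>2"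
    using I by (simp add: sharp_real norm_divide)
  show "hardy_bound (\<lambda>z. W x z / E z) ((norm x)\<^sup>2)" "hardy_bound (\<lambda>z. sharp (W x) z / E z) ((norm x)\<^sup>2)"
    using hardy_bound_contract[OF CD(1)] hardy_bound_contract[OF CD(2)] unfolding I J by auto
qed

text \<open>Transforms converge pointwise along an approximating sequence from the span, and their
  bounds converge to \<open>(norm x)\<^sup>2\<close>, so Fatou's lemma applies on every
  line.\<close>

lemma all_hardy:
  shows "hardy_bound (\<lambda>z. W x z / E z) ((norm x)\<^sup>2)" "hardy_bound (\<lambda>z. sharp (W x) z / E z) ((norm x)\<^sup>2)"
proof -
  obtain X where X: "\<And>n. X n \<in> upper_span" "X \<longlonglongrightarrow> x"
    using upper_span_dense closure_sequential[of x upper_span] by blast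
  have B: "(\<lambda>n. (norm (X n))\<^sup>2) \<longlonglongrightarrow> (norm x)\<^sup>2"
    by (intro tendsto_intros X)
  have l1: "(\<lambda>n. (cmod (W (X n) z / E z))\<^sup>2) \<longlonglongrightarrow> (cmod (W x z / E z))\<^sup>2" for z
    unfolding divide_inverse W_def by (intro tendsto_intros tendsto_ip_left X)
  have l2: "(\<lambda>n. (cmod (sharp (W (X n)) z / E z))\<^sup>2) \<longlonglongrightarrow> (cmod (sharp (W x) z / E z))\<^sup>2" for z
    unfolding divide_inverse W_def sharp_def by (intro tendsto_intros tendsto_ip_left X)
  note F = Fatou_integral[where M = lborel, OF _ _ _ B]
  show "hardy_bound (\<lambda>z. W x z / E z) ((norm x)\<^sup>2)"
    unfolding hardy_bound_def
  proof (intro conjI allI impI)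
    show "\<exists>U. open U \<and> {z. 0 \<le> Im z} \<subseteq> U \<and> (\<lambda>z. W x z / E z) holomorphic_on U"
      using E_domain quotient_holomorphic[OF W_entire] by blast
    fix y :: real assume y: "0 \<le> y"
    show "integrable lborel (\<lambda>t. (cmod (W x (Complex t y) / E (Complex t y)))\<^sup>2)"
      "(LINT t|lborel. (cmod (W x (Complex t y) / E (Complex t y)))\<^sup>2) \<le> (norm x)\<^sup>2"
      using F[of "\<lambda>n t. (cmod (W (X n) (Complex t y) / E (Complex t y)))\<^sup>2", OF _ _ _ l1]
        hardy_bound_integrable[OF upper_span_hardy(1)[OF X(1)] y] by auto
  qed
  show "hardy_bound (\<lambda>z. sharp (W x) z / E z) ((norm x)\<^sup>2)"
    unfolding hardy_bound_def
  proof (intro conjI allI impI)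
    show "\<exists>U. open U \<and> {z. 0 \<le> Im z} \<subseteq> U \<and> (\<lambda>z. sharp (W x) z / E z) holomorphic_on U"
      using E_domain quotient_holomorphic[OF sharp_holomorphic[OF W_entire]] by blast
    fix y :: real assume y: "0 \<le> y"
    show "integrable lborel (\<lambda>t. (cmod (sharp (W x) (Complex t y) / E (Complex t y)))\<^sup>2)"
      "(LINT t|lborel. (cmod (sharp (W x) (Complex t y) / E (Complex t y)))\<^sup>2) \<le> (norm x)\<^sup>2"
      using F[of "\<lambda>n t. (cmod (sharp (W (X n)) (Complex t y) / E (Complex t y)))\<^sup>2", OF _ _ _ l2]
        hardy_bound_integrable[OF upper_span_hardy(2)[OF X(1)] y] by auto
  qed
qed

lemma W_in_de_branges: "W x \<in> de_branges E"
  using hardy_imp_de_branges[OF W_entire all_hardy] .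

text \<open>Fatou's lemma yields only q(x) \<le> |x|^2. Since q obeys the parallelogram law, so does
  the nonnegative defect |x|^2 - q(x). It vanishes on the dense span, hence its value at X + d is at
  most twice its value at d, that is at most 2|d|^2, when X lies in the span.\<close>

lemma isometry: "(LINT t|lborel. (cmod (W x (Complex t 0) / E (Complex t 0)))\<^sup>2) = (norm x)\<^sup>2"
proof -
  define q where "q x = (LINT t|lborel. (cmod (W x (Complex t 0) / E (Complex t 0)))\<^sup>2)" for x
  have qle: "q x \<le> (norm x)\<^sup>2" for x
    using hardy_bound_integrable(2)[OF all_hardy(1)[of x], of 0] by (simp add: q_def)
  have qp: "q (x + y) + q (x - y) = 2 * q x + 2 * q y" for x y
  proof -
    have "q (x + y) + q (x - y) = (LINT t|lborel. (cmod (W (x + y) (Complex t 0) / E (Complex t 0)))\<^sup>2 + (cmod (W (x - y) (Complex t 0) / E (Complex t 0)))\<^sup>2)"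
      unfolding q_def by (rule Bochner_Integration.integral_add[symmetric]) (intro line_facts W_in_de_branges)+
    also have "\<dots> = (LINT t|lborel. 2 * (cmod (W x (Complex t 0) / E (Complex t 0)))\<^sup>2 + 2 * (cmod (W y (Complex t 0) / E (Complex t 0)))\<^sup>2)"
      unfolding W_add W_diff add_divide_distrib diff_divide_distrib cmod_parallelogram ..
    also have "\<dots> = 2 * q x + 2 * q y"
      unfolding q_def using line_facts(2)[OF W_in_de_branges] by simp
    finally show ?thesis .
  qed
  obtain X where X: "\<And>n. X n \<in> upper_span" "X \<longlonglongrightarrow> x"
    using upper_span_dense closure_sequential[of x upper_span] by blast
  have qX: "q (X n) = (norm (X n))\<^sup>2" for n
    using upper_span_form[OF upper_span_good[OF X(1)[of n]] X(1)[of n]] unfolding q_def form_self ip_self of_real_eq_iff .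
  have le: "(norm x)\<^sup>2 - q x \<le> 2 * (norm (x - X n))\<^sup>2" for n
  proof -
    define d where "d = x - X n"
    have "(norm (X n + d))\<^sup>2 - q (X n + d) \<le> ((norm (X n + d))\<^sup>2 - q (X n + d)) + ((norm (X n - d))\<^sup>2 - q (X n - d))"
      using qle[of "X n - d"] by simp
    also have "\<dots> = 2 * (norm d)\<^sup>2 - 2 * q d"
      using parallelogram[of "X n" d] qp[of "X n" d] qX[of n] by simp
    also have "\<dots> \<le> 2 * (norm d)\<^sup>2"
      unfolding q_def by simp
    finally show ?thesis by (simp add: d_def)
  qed
  have "(\<lambda>n. 2 * (norm (x - X n))\<^sup>2) \<longlonglongrightarrow> 2 * (norm (x - x))\<^sup>2"
    by (intro tendsto_intros X)
  then have "(norm x)\<^sup>2 - q x \<le> 0"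
    using LIMSEQ_le_const[of "\<lambda>n. 2 * (norm (x - X n))\<^sup>2" 0 "(norm x)\<^sup>2 - q x"] le by auto
  then show ?thesis using qle[of x] by (simp add: q_def)
qed

text \<open>Pairing with f in the inner product of H(E) is a bounded functional on H. Its Riesz
  vector u satisfies W u = f above the axis, as testing against \<psi>(z) evaluates both functions
  at z.\<close>

lemma surjective:
  assumes f: "f \<in> de_branges E"
  shows "\<exists>x. W x = f"
proof -
  define B where "B = (LINT t|lborel. (cmod (f (Complex t 0) / E (Complex t 0)))\<^sup>2)"
  have b0: "cmod (form (W x) f) \<le> ((norm x)\<^sup>2 + B) / 2" for x
    unfolding form_def B_def isometry[symmetric] by (intro integrable_mult_cnj(2) line_facts W_in_de_branges f)
  \<comment> \<open>The previous estimate is not homogeneous in x; scaling to a unit vector makes it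
    linear in the norm.\<close>
  have b: "cmod (form (W x) f) \<le> (1 + B) / 2 * norm x" for x
  proof (cases "x = 0")
    case False
    define u where "u = sc (complex_of_real (1 / norm x)) x"
    have "norm u = 1" unfolding u_def norm_sc norm_of_real using False by simp
    then have "cmod (form (W u) f) \<le> (1 + B) / 2" using b0[of u] by simp
    moreover have "cmod (form (W u) f) = cmod (form (W x) f) / norm x"
      unfolding u_def form_W_sc_left norm_mult norm_of_real using False by simp
    ultimately show ?thesis
      using False pos_divide_le_eq[of "norm x" "cmod (form (W x) f)" "(1 + B) / 2"]
      by (metis zero_less_norm_iff)
  qed (simp add: form_def W_zero)
  obtain u where u: "\<And>x. form (W x) f = ip x u"
    using Riesz_representation[of "\<lambda>x. form (W x) f", OF _ form_W_sc_left b]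
      form_W_add_left[OF _ _ f] good_de_branges W_in_de_branges by metis
  have "W u z = f z" if "Im z > 0" for z
  proof -
    have "form (W (\<psi> z)) f = cnj (f z)"
      using reproducing[OF f that] form_cnj[of "W (\<psi> z)" f] by (simp add: form_def)
    then have "cnj (W u z) = cnj (f z)" using u[of "\<psi> z"] ip_commute[of u "\<psi> z"] by (simp add: W_def)
    then show ?thesis by (metis complex_cnj_cnj)
  qed
  moreover have "f holomorphic_on UNIV" using f unfolding de_branges_def by blast
  ultimately have "W u z = f z" for z
    using entire_eq_on_upper_half_plane[OF W_entire] by blast
  then show ?thesis by blast
qed

theorem range_eq_de_branges: "range (\<lambda>x z. ip x (\<psi> z)) = de_branges E"
proof -
  have "range W = de_branges E"
  proof (intro subset_antisym image_subsetI W_in_de_branges subsetI)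
    show "f \<in> range W" if "f \<in> de_branges E" for f
      using surjective[OF that] by auto
  qed
  then show ?thesis by (simp add: W_def[abs_def])
qed

theorem de_branges_norm_eq: "de_branges_norm E (\<lambda>z. ip x (\<psi> z)) = norm x"
  using isometry[of x] unfolding de_branges_norm_def complex_of_real_def W_def by simp

end

section \<open>Admissible pairs\<close>

locale admissible_pair = cplx_hilbert sc ip
  for sc :: "complex \<Rightarrow> 'h::banach \<Rightarrow> 'h" and ip +
  fixes domD :: "'h set" and D V :: "'h \<Rightarrow> 'h" and \<phi>0 :: 'h
  assumes adm: "admissible sc ip domD D V"
    and \<phi>0: "\<phi>0 \<in> domD" "\<phi>0 \<noteq> 0" "D \<phi>0 = 0"
begin

section \<open>Elementary consequences of admissibility\<close>

lemma dom_csubspace: "csubspace sc domD" and D_clinear: "clinear_on sc domD D"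
  and V_compact_op: "compact_op sc V" and V_spectrum: "cspectrum sc V = {0}"
  and V_range: "range V \<subseteq> domD" and D_V: "D (V x) = x"
  using adm unfolding admissible_def by simp_all

lemma dom_add: "x \<in> domD \<Longrightarrow> y \<in> domD \<Longrightarrow> x + y \<in> domD"
  and dom_sc: "x \<in> domD \<Longrightarrow> sc a x \<in> domD"
  using dom_csubspace unfolding csubspace_def by simp_all

lemma D_add: "x \<in> domD \<Longrightarrow> y \<in> domD \<Longrightarrow> D (x + y) = D x + D y"
  and D_sc: "x \<in> domD \<Longrightarrow> D (sc a x) = sc a (D x)"
  using D_clinear unfolding clinear_on_def by simp_all

lemma V_add: "V (x + y) = V x + V y" and V_sc: "V (sc a x) = sc a (V x)"
  using V_compact_op unfolding compact_op_def clinear_on_def by simp_all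

lemma V_dom: "V x \<in> domD"
  using V_range by blast

lemma V_compact: "compact (closure (V ` ball 0 1))"
  using V_compact_op unfolding compact_op_def by simp

lemma dom_diff: "x \<in> domD \<Longrightarrow> y \<in> domD \<Longrightarrow> x - y \<in> domD"
  using dom_add[of x "- y"] dom_sc[of y "-1"] by (simp add: sc_minus_one)

lemma D_diff: "x \<in> domD \<Longrightarrow> y \<in> domD \<Longrightarrow> D (x - y) = D x - D y"
  using D_add[of x "- y"] dom_sc[of y "-1"] D_sc[of y "-1"] by (simp add: sc_minus_one)

lemma V_diff: "V (x - y) = V x - V y"
  using V_add[of x "- y"] V_sc[of "-1" y] by (simp add: sc_minus_one)

lemma kernel_D:
  assumes "x \<in> domD" "D x = 0"
  obtains c where "x = sc c \<phi>0"
proof -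
  obtain \<phi> where \<phi>: "{x \<in> domD. D x = 0} = range (\<lambda>c. sc c \<phi>)"
    using adm unfolding admissible_def by (elim conjE exE) simp
  obtain a b where a: "\<phi>0 = sc a \<phi>" and b: "x = sc b \<phi>"
    using assms \<phi>0 \<phi> by blast
  have "a \<noteq> 0" using a \<phi>0(2) by auto
  then have "x = sc (b / a) \<phi>0" unfolding a b by (simp flip: sc_mult)
  then show ?thesis by (rule that)
qed

lemma V_bounded: obtains M where "M > 0" "\<And>x. norm (V x) \<le> M * norm x"
proof -
  have "bounded (V ` ball 0 1)"
    using V_compact compact_imp_bounded bounded_subset closure_subset by blast
  then obtain M where M: "M > 0" "\<And>x. norm x < 1 \<Longrightarrow> norm (V x) \<le> M"
    unfolding bounded_pos by (auto simp: dist_norm)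
  have "norm (V x) \<le> 2 * M * norm x" for x
  proof (cases "x = 0")
    case False
    define r where "r = 1 / (2 * norm x)"
    have r: "r > 0" "r * norm x = 1 / 2" using False by (auto simp: r_def)
    have "norm (sc (complex_of_real r) x) < 1" unfolding norm_sc norm_of_real using r by simp
    then have "norm (V (sc (complex_of_real r) x)) \<le> M" by (rule M(2))
    then have "r * norm (V x) \<le> M" unfolding V_sc norm_sc norm_of_real using r by simp
    then show ?thesis using False by (simp add: r_def field_simps)
  next
    case True
    then have "V x = 0" using V_sc[of 0 x] by simp
    then show ?thesis using True by simp
  qed
  then show ?thesis using that[of "2 * M"] M(1) by simp
qed

lemma bounded_linear_V: "bounded_linear V"
proof -
  obtain M where M: "\<And>x. norm (V x) \<le> M * norm x" using V_bounded by blast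
  show ?thesis
  proof (rule bounded_linear_intro[where K = M])
    show "V (r *\<^sub>R x) = r *\<^sub>R V x" for r x
      by (simp flip: sc_of_real add: V_sc)
  qed (use M V_add in \<open>auto simp: mult.commute\<close>)
qed

lemma V_adjoint:
  obtains u where "\<And>x. ip (V x) y = ip x u"
proof -
  obtain M where M: "\<And>x. norm (V x) \<le> M * norm x" using V_bounded by blast
  have "cmod (ip (V x) y) \<le> (M * norm y) * norm x" for x
    using order_trans[OF Cauchy_Schwarz mult_right_mono[OF M norm_ge_zero], of x y] by (simp add: mult_ac)
  then show ?thesis
    using Riesz_representation[of "\<lambda>x. ip (V x) y"] that by (metis V_add V_sc ip_add_left ip_sc_left)
qed

section \<open>The entire family of inverses of I - wV\<close>

definition T where "T w x = x - sc w (V x)"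
definition res where "res w z = inv (T w) z"

lemma T_add: "T w (x + y) = T w x + T w y" and T_diff: "T w (x - y) = T w x - T w y"
  and T_sc: "T w (sc a x) = sc a (T w x)"
  unfolding T_def by (simp_all add: V_add V_diff V_sc sc_add_right sc_diff_right mult.commute flip: sc_mult)

lemma T_bij: "bij (T w)"
proof (cases "w = 0")
  case True
  then have "T w = id" by (auto simp: T_def)
  then show ?thesis by simp
next
  case False
  have "1 / w \<notin> cspectrum sc V" using False V_spectrum by auto
  then have b: "bij (\<lambda>x. V x - sc (1 / w) x)" unfolding cspectrum_def by simp
  have s: "bij (sc (- w))"
    by (rule bij_betw_byWitness[where f' = "sc (1 / (- w))"]) (use False sc_inverse[of "- w"] in auto)
  have "T w = sc (- w) \<circ> (\<lambda>x. V x - sc (1 / w) x)"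
    using False by (auto simp: T_def sc_diff_right sc_minus_left fun_eq_iff sc_inverse)
  then show ?thesis using bij_comp[OF b s] by simp
qed

lemma T_res: "T w (res w z) = z"
  unfolding res_def using T_bij[of w] by (simp add: bij_is_surj surj_f_inv_f)

lemma res_unique: "T w x = z \<Longrightarrow> res w z = x"
  unfolding res_def using T_bij[of w] by (auto simp: bij_is_inj)

lemma res_eq: "res w z = z + sc w (V (res w z))"
  using T_res[of w z] unfolding T_def by (simp add: algebra_simps)

lemma res_sc: "res w (sc a z) = sc a (res w z)"
  by (rule res_unique) (simp add: T_sc T_res)

text \<open>The spectral condition gives bijectivity only; the norm bound comes from compactness of
  V. If normalized Y(n) had images tending to 0, then along a subsequence V Y(n) would converge to
  some v and Y(n) to wv, a nonzero vector in the kernel of I - wV.\<close>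

lemma T_bounded_below: "\<exists>c>0. \<forall>x. c * norm x \<le> norm (T w x)"
proof (rule ccontr)
  assume neg: "\<not> ?thesis"
  \<comment> \<open>Norm 1/2 keeps the vectors inside the open unit ball, whose image under V is
    relatively compact.\<close>
  have "\<exists>y. norm y = 1 / 2 \<and> norm (T w y) \<le> 1 / real (Suc n)" for n
  proof -
    obtain x where x: "norm (T w x) < 1 / real (Suc n) * norm x"
      using neg by (metis not_le of_nat_0_less_iff zero_less_Suc zero_less_divide_1_iff)
    then have "norm x \<noteq> 0" using norm_ge_zero[of "T w x"] by auto
    then have x0: "norm x > 0" by simp
    define r where "r = 1 / (2 * norm x)"
    have r: "r > 0" "r * norm x = 1 / 2" using x0 by (auto simp: r_def)
    define y where "y = sc (complex_of_real r) x"
    have n1: "norm y = 1 / 2" unfolding y_def norm_sc norm_of_real using r by simp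
    have "norm (T w y) = r * norm (T w x)" unfolding y_def T_sc norm_sc norm_of_real using r by simp
    also have "\<dots> \<le> r * (1 / real (Suc n) * norm x)" using x r by (intro mult_left_mono) auto
    also have "\<dots> = 1 / real (Suc n) * (r * norm x)" by simp
    also have "\<dots> \<le> 1 / real (Suc n)" unfolding r(2) by (intro mult_left_le) auto
    finally show ?thesis using n1 by blast
  qed
  then obtain Y where Y: "\<And>n. norm (Y n) = 1 / 2" "\<And>n. norm (T w (Y n)) \<le> 1 / real (Suc n)" by metis
  have "V (Y n) \<in> closure (V ` ball 0 1)" for n
    using Y(1)[of n] closure_subset by (intro subsetD[OF closure_subset] imageI) simp
  then obtain v r where r: "strict_mono (r :: nat \<Rightarrow> nat)" "((\<lambda>n. V (Y n)) \<circ> r) \<longlonglongrightarrow> v"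
    using V_compact unfolding compact_eq_seq_compact_metric seq_compact_def by metis
  have "(\<lambda>n. T w (Y n)) \<longlonglongrightarrow> 0"
    by (rule Lim_null_comparison[OF always_eventually])
       (use Y(2) LIMSEQ_inverse_real_of_nat in \<open>auto simp: inverse_eq_divide\<close>)
  then have t0: "(\<lambda>n. T w (Y (r n))) \<longlonglongrightarrow> 0"
    using LIMSEQ_subseq_LIMSEQ[OF _ r(1)] by (auto simp: o_def)
  have "(\<lambda>n. T w (Y (r n)) + sc w (V (Y (r n)))) \<longlonglongrightarrow> 0 + sc w v"
    using r(2) by (intro tendsto_add t0 bounded_linear.tendsto[OF bounded_linear_sc]) (simp add: o_def)
  then have lim: "(\<lambda>n. Y (r n)) \<longlonglongrightarrow> sc w v" by (simp add: T_def)
  then have "(\<lambda>n. V (Y (r n))) \<longlonglongrightarrow> V (sc w v)"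
    by (rule bounded_linear.tendsto[OF bounded_linear_V])
  then have "V (sc w v) = v" using r(2) LIMSEQ_unique by (auto simp: o_def)
  then have "T w (sc w v) = T w 0" using V_sc[of 0 0] by (simp add: T_def)
  then have "sc w v = 0" using T_bij[of w] by (metis bij_is_inj injD)
  moreover have "(\<lambda>n. norm (Y (r n))) \<longlonglongrightarrow> norm (sc w v)" by (intro tendsto_norm lim)
  then have "(\<lambda>n. 1 / 2) \<longlonglongrightarrow> norm (sc w v)" using Y(1) by simp
  then have "norm (sc w v) = 1 / 2" using LIMSEQ_unique tendsto_const by blast
  ultimately show False by simp
qed

lemma bounded_linear_res: "bounded_linear (res w)"
proof -
  obtain c where c: "c > 0" "\<And>x. c * norm x \<le> norm (T w x)" using T_bounded_below by blast
  show ?thesis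
  proof (rule bounded_linear_intro[where K = "1 / c"])
    show "res w (x + y) = res w x + res w y" for x y
      by (rule res_unique) (simp add: T_add T_res)
    show "res w (r *\<^sub>R x) = r *\<^sub>R res w x" for r x
      by (simp flip: sc_of_real add: res_sc)
    show "norm (res w x) \<le> norm x * (1 / c)" for x
      using c(2)[of "res w x"] c(1) by (simp add: T_res pos_le_divide_eq mult.commute)
  qed
qed

lemma res_difference: "res w z - res w0 z = sc (w - w0) (res w0 (V (res w z)))"
proof -
  have "T w0 (res w z - res w0 z) = sc (w - w0) (V (res w z))"
    unfolding T_diff T_res using T_res[of w z] by (simp add: T_def sc_diff_left algebra_simps)
  then show ?thesis using res_unique res_sc by metis
qed

text \<open>The difference identity contains \<open>res w z\<close> on its right side too; for |w -
  w0|K \<le> 1/2 that term is absorbed, giving a bound uniform in w near w0.\<close>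

lemma res_continuous: "((\<lambda>w. res w z) \<longlongrightarrow> res w0 z) (at w0)"
proof -
  obtain K where K: "K > 0" "\<And>x. norm (res w0 (V x)) \<le> norm x * K"
    using bounded_linear.pos_bounded[OF bounded_linear_compose[OF bounded_linear_res bounded_linear_V]] by blast
  have d: "norm (res w z - res w0 z) \<le> cmod (w - w0) * K * norm (res w z)" for w
    using mult_left_mono[OF K(2)[of "res w z"], of "cmod (w - w0)"] by (simp add: res_difference norm_sc mult_ac)
  have b: "norm (res w z) \<le> 2 * norm (res w0 z)" if "cmod (w - w0) * K \<le> 1 / 2" for w
  proof -
    have "norm (res w z) \<le> norm (res w0 z) + norm (res w z - res w0 z)"
      using norm_triangle_ineq[of "res w0 z" "res w z - res w0 z"] by simp
    moreover have "norm (res w z - res w0 z) \<le> 1 / 2 * norm (res w z)"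
      using order_trans[OF d mult_right_mono[OF that norm_ge_zero]] .
    ultimately show ?thesis by simp
  qed
  have "((\<lambda>w. res w z - res w0 z) \<longlongrightarrow> 0) (at w0)"
  proof (rule Lim_null_comparison)
    have "((\<lambda>w. cmod (w - w0) * K) \<longlongrightarrow> cmod (w0 - w0) * K) (at w0)" by (intro tendsto_intros)
    then have "\<forall>\<^sub>F w in at w0. cmod (w - w0) * K < 1 / 2" by (intro order_tendstoD) auto
    then show "\<forall>\<^sub>F w in at w0. norm (res w z - res w0 z) \<le> cmod (w - w0) * K * (2 * norm (res w0 z))"
    proof eventually_elim
      case (elim w)
      then show ?case
        using K(1) by (intro order_trans[OF d] mult_left_mono b) auto
    qed
    have "((\<lambda>w. cmod (w - w0) * K * (2 * norm (res w0 z))) \<longlongrightarrow> cmod (w0 - w0) * K * (2 * norm (res w0 z))) (at w0)"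
      by (intro tendsto_intros)
    then show "((\<lambda>w. cmod (w - w0) * K * (2 * norm (res w0 z))) \<longlongrightarrow> 0) (at w0)" by simp
  qed
  then show ?thesis by (simp add: LIM_zero_iff)
qed

lemma res_holomorphic: "(\<lambda>w. ip (res w z) y) holomorphic_on UNIV"
proof -
  have "((\<lambda>w. ip (res w z) y) has_field_derivative ip (res w0 (V (res w0 z))) y) (at w0)" for w0
    unfolding has_field_derivative_iff
  proof (rule Lim_transform_eventually)
    show "((\<lambda>w. ip (res w0 (V (res w z))) y) \<longlongrightarrow> ip (res w0 (V (res w0 z))) y) (at w0)"
      by (intro tendsto_ip_left bounded_linear.tendsto[OF bounded_linear_res]
            bounded_linear.tendsto[OF bounded_linear_V] res_continuous)
    show "\<forall>\<^sub>F w in at w0. ip (res w0 (V (res w z))) y = (ip (res w z) y - ip (res w0 z) y) / (w - w0)"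
      using eventually_neq_at_within[of w0]
      by eventually_elim (simp flip: ip_diff_left add: res_difference ip_sc_left)
  qed
  then show ?thesis
    unfolding holomorphic_on_def field_differentiable_def by blast
qed

section \<open>Eigenvectors of D\<close>

definition \<Phi> where "\<Phi> w = res w \<phi>0"

lemma phi_eq: "phi sc V \<phi>0 w = \<Phi> w"
  unfolding phi_def \<Phi>_def res_def T_def[abs_def] ..

lemma \<Phi>_eq: "\<Phi> w = \<phi>0 + sc w (V (\<Phi> w))"
  unfolding \<Phi>_def by (rule res_eq)

lemma \<Phi>_dom: "\<Phi> w \<in> domD"
  using \<Phi>_eq[of w] dom_add[OF \<phi>0(1) dom_sc[OF V_dom]] by metis

lemma D_\<Phi>: "D (\<Phi> w) = sc w (\<Phi> w)"
proof -
  have "D (\<Phi> w) = D (\<phi>0 + sc w (V (\<Phi> w)))" using \<Phi>_eq[of w] by simp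
  also have "\<dots> = sc w (\<Phi> w)"
    by (simp add: D_add \<phi>0 dom_sc V_dom D_sc D_V)
  finally show ?thesis .
qed

text \<open>D annihilates x - wVx because DV = I, so this vector is a multiple of \<phi>0 and
  inverting I - wV gives the claim.\<close>

lemma eigenvector:
  assumes x: "x \<in> domD" "D x = sc w x"
  obtains c where "x = sc c (\<Phi> w)"
proof -
  have "T w x \<in> domD" "D (T w x) = 0"
    using x by (auto simp: T_def D_diff dom_diff dom_sc V_dom D_sc D_V)
  then obtain c where "T w x = sc c \<phi>0" using kernel_D by blast
  then have "x = sc c (\<Phi> w)" unfolding \<Phi>_def using res_unique res_sc by metis
  then show ?thesis by (rule that)
qed

lemma \<Phi>_lower_bound: obtains c where "c > 0" "\<And>w. c \<le> norm (\<Phi> w) * (1 + cmod w)"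
proof -
  obtain M where M: "M > 0" "\<And>x. norm (V x) \<le> M * norm x" using V_bounded by blast
  have "norm \<phi>0 / (1 + M) \<le> norm (\<Phi> w) * (1 + cmod w)" for w
  proof -
    have "\<phi>0 = \<Phi> w - sc w (V (\<Phi> w))" using \<Phi>_eq[of w] by (simp add: algebra_simps)
    then have "norm \<phi>0 \<le> norm (\<Phi> w) + norm (sc w (V (\<Phi> w)))" by (metis norm_triangle_ineq4)
    also have "\<dots> \<le> norm (\<Phi> w) + cmod w * (M * norm (\<Phi> w))"
      unfolding norm_sc by (intro add_left_mono mult_left_mono M) simp
    also have "\<dots> \<le> norm (\<Phi> w) * (1 + cmod w) * (1 + M)"
      using M(1) by (simp add: algebra_simps)
    finally show ?thesis using M(1) by (simp add: pos_divide_le_eq)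
  qed
  moreover have "norm \<phi>0 / (1 + M) > 0" using M(1) \<phi>0 by simp
  ultimately show ?thesis using that by blast
qed

lemma \<Phi>_nonzero: "\<Phi> w \<noteq> 0"
  using \<Phi>_lower_bound by (metis linorder_not_le mult_zero_left norm_zero)

section \<open>The self-adjoint restriction of D\<close>

definition S where "S = (SOME S. S \<subseteq> domD \<and> selfadjoint_restr sc ip S D)"

lemma S: "S \<subseteq> domD" "selfadjoint_restr sc ip S D"
proof -
  have "\<exists>S. S \<subseteq> domD \<and> selfadjoint_restr sc ip S D"
    using adm unfolding admissible_def by (elim conjE exE) auto
  then have "S \<subseteq> domD \<and> selfadjoint_restr sc ip S D"
    unfolding S_def by (rule someI_ex)
  then show "S \<subseteq> domD" "selfadjoint_restr sc ip S D" by auto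
qed

lemma S_dom: "x \<in> S \<Longrightarrow> x \<in> domD" using S(1) by blast

lemma S_csubspace: "csubspace sc S" and S_dense: "closure S = UNIV"
  and S_symmetric: "x \<in> S \<Longrightarrow> y \<in> S \<Longrightarrow> ip (D x) y = ip x (D y)"
  using S(2) unfolding selfadjoint_restr_def by blast+

lemma S_adjoint:
  assumes "\<And>x. x \<in> S \<Longrightarrow> ip (D x) y = ip x z"
  shows "y \<in> S" "D y = z"
proof -
  have "S = {y. \<exists>z. \<forall>x\<in>S. ip (D x) y = ip x z}"
    using S(2) unfolding selfadjoint_restr_def by blast
  then show y: "y \<in> S" using assms by blast
  have "D y - z = 0"
  proof (rule orthogonal_dense_zero[OF S_dense])
    show "ip v (D y - z) = 0" if "v \<in> S" for v
      using S_symmetric[OF that y] assms[OF that] by (simp add: ip_diff_right)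
  qed
  then show "D y = z" by simp
qed

lemma S_lower_bound:
  assumes x: "x \<in> S"
  shows "\<bar>Im w\<bar> * norm x \<le> norm (D x - sc w x)"
proof (cases "x = 0")
  case False
  have "Im (ip (D x) x) = 0"
    using S_symmetric[OF x x] ip_commute[of "D x" x] by (simp add: complex_eq_iff)
  then have "\<bar>Im w\<bar> * (norm x)\<^sup>2 = \<bar>Im (ip (D x - sc w x) x)\<bar>"
    by (simp add: ip_diff_left ip_sc_left ip_self abs_mult)
  also have "\<dots> \<le> norm (D x - sc w x) * norm x"
    using order_trans[OF abs_Im_le_cmod Cauchy_Schwarz] .
  finally have "norm x * (\<bar>Im w\<bar> * norm x) \<le> norm x * norm (D x - sc w x)"
    by (simp add: power2_eq_square mult_ac)
  then show ?thesis using False by simp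
qed simp

text \<open>The range of the restriction minus w is closed by the lower bound. It is dense because a
  vector orthogonal to it would be an eigenvector of the restriction for \<open>cnj w\<close>, which
  the same bound excludes.\<close>

lemma S_resolvent:
  assumes w: "Im w \<noteq> 0"
  obtains x where "x \<in> S" "D x - sc w x = z"
proof -
  define R where "R = (\<lambda>x. D x - sc w x) ` S"
  have sub: "csubspace sc R"
    unfolding csubspace_def R_def
  proof (intro conjI ballI allI)
    have "0 \<in> S" using S_csubspace unfolding csubspace_def by blast
    moreover have "D 0 = 0" using D_sc[of 0 0] S_dom[OF \<open>0 \<in> S\<close>] by simp
    ultimately show "0 \<in> (\<lambda>x. D x - sc w x) ` S" by (auto intro!: image_eqI[of _ _ 0])
    fix u assume "u \<in> (\<lambda>x. D x - sc w x) ` S"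
    then obtain x where x: "x \<in> S" "u = D x - sc w x" by blast
    show "u + v \<in> (\<lambda>x. D x - sc w x) ` S" if v: "v \<in> (\<lambda>x. D x - sc w x) ` S" for v
    proof -
      obtain y where y: "y \<in> S" "v = D y - sc w y" using v by blast
      have "x + y \<in> S" using x y S_csubspace unfolding csubspace_def by blast
      moreover have "u + v = D (x + y) - sc w (x + y)"
        unfolding x(2) y(2) using x(1) y(1) by (simp add: D_add S_dom sc_add_right)
      ultimately show ?thesis by blast
    qed
    show "sc a u \<in> (\<lambda>x. D x - sc w x) ` S" for a
    proof -
      have "sc a x \<in> S" using x S_csubspace unfolding csubspace_def by blast
      moreover have "sc a u = D (sc a x) - sc w (sc a x)"
        unfolding x(2) using x(1) by (simp add: D_sc S_dom sc_diff_right mult.commute flip: sc_mult)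
      ultimately show ?thesis by blast
    qed
  qed
  have "closed R"
    unfolding closed_sequential_limits
  proof (intro allI impI)
    fix Z z assume Z: "(\<forall>n. Z n \<in> R) \<and> Z \<longlonglongrightarrow> z"
    then obtain X where X: "\<And>n. X n \<in> S" "\<And>n. Z n = D (X n) - sc w (X n)"
      unfolding R_def image_iff by metis
    have diff: "\<bar>Im w\<bar> * norm (X m - X n) \<le> norm (Z m - Z n)" for m n
    proof -
      have "X m - X n \<in> S" using csubspace_diff[OF S_csubspace X(1) X(1)] .
      moreover have "D (X m - X n) - sc w (X m - X n) = Z m - Z n"
        using X S_dom by (simp add: D_diff sc_diff_right)
      ultimately show ?thesis using S_lower_bound by metis
    qed
    have "Cauchy X"
    proof (rule metric_CauchyI)
      fix e :: real assume "e > 0"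
      then have "e * \<bar>Im w\<bar> > 0" using w by simp
      moreover have "Cauchy Z" using Z LIMSEQ_imp_Cauchy by blast
      ultimately obtain N where N: "\<And>m n. m \<ge> N \<Longrightarrow> n \<ge> N \<Longrightarrow> dist (Z m) (Z n) < e * \<bar>Im w\<bar>"
        unfolding Cauchy_def by blast
      have "dist (X m) (X n) < e" if "m \<ge> N" "n \<ge> N" for m n
      proof -
        have "\<bar>Im w\<bar> * norm (X m - X n) < \<bar>Im w\<bar> * e"
          using le_less_trans[OF diff N[OF that, unfolded dist_norm]] by (simp add: mult.commute)
        then show ?thesis using w by (simp add: dist_norm)
      qed
      then show "\<exists>N. \<forall>m\<ge>N. \<forall>n\<ge>N. dist (X m) (X n) < e" by blast
    qed
    then obtain x where x: "X \<longlonglongrightarrow> x" using Cauchy_convergent convergent_def by blast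
    \<comment> \<open>Closedness of the restriction: the limit x is placed in S by the adjoint
      characterisation of the domain.\<close>
    have ip: "ip (D u) x = ip u (z + sc w x)" if u: "u \<in> S" for u
    proof (rule LIMSEQ_unique)
      show "(\<lambda>n. ip (D u) (X n)) \<longlonglongrightarrow> ip (D u) x" by (intro tendsto_ip_right x)
      have "ip (D u) (X n) = ip u (Z n + sc w (X n))" for n
        using S_symmetric[OF u X(1)] X(2) by simp
      then show "(\<lambda>n. ip (D u) (X n)) \<longlonglongrightarrow> ip u (z + sc w x)"
        using Z x by (auto intro!: tendsto_ip_right tendsto_add bounded_linear.tendsto[OF bounded_linear_sc])
    qed
    have "x \<in> S" "D x = z + sc w x" using S_adjoint[OF ip] by auto
    then show "z \<in> R" unfolding R_def by (auto intro!: image_eqI[of _ _ x])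
  qed
  moreover have "closure R = UNIV"
  proof (rule dense_if_orthogonal_trivial[OF sub])
    fix y assume y: "\<And>v. v \<in> R \<Longrightarrow> ip y v = 0"
    have "ip (D x) y = ip x (sc (cnj w) y)" if x: "x \<in> S" for x
    proof -
      have "ip y (D x - sc w x) = 0" using y x unfolding R_def by blast
      then have "ip (D x - sc w x) y = 0" by (subst ip_commute) simp
      then show ?thesis by (simp add: ip_diff_left ip_sc_left ip_sc_right)
    qed
    from S_adjoint[OF this] have "y \<in> S" "D y = sc (cnj w) y" by auto
    then show "y = 0" using S_lower_bound[of y "cnj w"] w by (simp add: mult_le_0_iff)
  qed
  ultimately have "z \<in> R" by simp
  then show ?thesis unfolding R_def using that by blast
qed

text \<open>With z = Dx - wx, both V(I - wV)^(-1)z and x solve (D - w)v = z, so they differ by an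
  eigenvector.\<close>

lemma V_res_decomposition:
  assumes x: "x \<in> S"
  obtains c where "V (res w (D x - sc w x)) = x + sc c (\<Phi> w)"
proof -
  define v where "v = V (res w (D x - sc w x))"
  have v: "v \<in> domD" by (simp add: v_def V_dom)
  have "D v = D x - sc w x + sc w v"
    using res_eq[of w "D x - sc w x"] by (simp add: v_def D_V)
  then have "D (v - x) = sc w (v - x)" "v - x \<in> domD"
    using v S_dom[OF x] by (simp_all add: D_diff dom_diff sc_diff_right)
  then obtain c where "v - x = sc c (\<Phi> w)" using eigenvector by blast
  then have "v = x + sc c (\<Phi> w)" by (simp add: algebra_simps)
  then show ?thesis using that by (simp add: v_def)
qed

(* For y orthogonal to all eigenvectors the entire function <V (I - wV)^{-1} z, y> agrees off the
   real axis with the resolvent <(A - w)^{-1} z, y> of the self-adjoint restriction A. *)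
lemma \<Phi>_total:
  assumes y: "\<And>w. ip (\<Phi> w) y = 0"
  shows "y = 0"
proof (rule orthogonal_dense_zero[OF S_dense])
  fix x assume x: "x \<in> S"
  obtain u where u: "\<And>x. ip (V x) y = ip x u" using V_adjoint by blast
  have ent: "ip (V (res w z)) y = 0" for w z
  proof (rule entire_bounded_by_inverse_Im_zero[of "\<lambda>w. ip (V (res w z)) y" "norm z * norm y"])
    show "(\<lambda>w. ip (V (res w z)) y) holomorphic_on UNIV"
      unfolding u by (rule res_holomorphic)
    fix w :: complex assume w: "Im w \<noteq> 0"
    obtain s where s: "s \<in> S" "D s - sc w s = z" using S_resolvent[OF w] by blast
    obtain c where "V (res w z) = s + sc c (\<Phi> w)" using V_res_decomposition[OF s(1), of w] s(2) by metis
    then have "ip (V (res w z)) y = ip s y" by (simp add: ip_add_left ip_sc_left y)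
    then have "cmod (ip (V (res w z)) y) * \<bar>Im w\<bar> \<le> norm s * norm y * \<bar>Im w\<bar>"
      using Cauchy_Schwarz[of s y] by (intro mult_right_mono) auto
    also have "\<dots> = \<bar>Im w\<bar> * norm s * norm y" by simp
    also have "\<dots> \<le> norm z * norm y"
      using S_lower_bound[OF s(1), of w] s(2) by (intro mult_right_mono) auto
    finally show "cmod (ip (V (res w z)) y) * \<bar>Im w\<bar> \<le> norm z * norm y" .
  qed
  obtain c where "V (res \<i> (D x - sc \<i> x)) = x + sc c (\<Phi> \<i>)" using V_res_decomposition[OF x] by blast
  then show "ip x y = 0"
    using ent[of \<i> "D x - sc \<i> x"] by (simp add: ip_add_left ip_sc_left y)
qed

section \<open>The boundary form of D\<close>

definition bf where "bf x y = ip (D x) y - ip x (D y)"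

lemma bf_add_left: "x \<in> domD \<Longrightarrow> y \<in> domD \<Longrightarrow> bf (x + y) z = bf x z + bf y z"
  and bf_sc_left: "x \<in> domD \<Longrightarrow> bf (sc a x) z = a * bf x z"
  by (simp_all add: bf_def D_add D_sc ip_add_left ip_sc_left algebra_simps)

lemma bf_add_right: "y \<in> domD \<Longrightarrow> z \<in> domD \<Longrightarrow> bf x (y + z) = bf x y + bf x z"
  and bf_sc_right: "y \<in> domD \<Longrightarrow> bf x (sc a y) = cnj a * bf x y"
  by (simp_all add: bf_def D_add D_sc ip_add_right ip_sc_right algebra_simps)

lemma bf_\<Phi>: "bf (\<Phi> a) (\<Phi> b) = (a - cnj b) * ip (\<Phi> a) (\<Phi> b)"
  by (simp add: bf_def D_\<Phi> ip_sc_left ip_sc_right algebra_simps)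

lemma bf_S: "x \<in> S \<Longrightarrow> y \<in> S \<Longrightarrow> bf x y = 0"
  by (simp add: bf_def S_symmetric)

text \<open>The domain of D exceeds S by a single direction: solving (D - \<i>)s = (D - \<i>)x in S
  leaves an eigenvector at \<i>.\<close>

lemma dom_decomposition:
  assumes "x \<in> domD"
  obtains s c where "s \<in> S" "x = s + sc c (\<Phi> \<i>)"
proof -
  obtain s where s: "s \<in> S" "D s - sc \<i> s = D x - sc \<i> x" using S_resolvent[of \<i>] by auto
  have "D (x - s) = sc \<i> (x - s)"
    using s assms by (simp add: D_diff S_dom sc_diff_right algebra_simps)
  then obtain c where "x - s = sc c (\<Phi> \<i>)" using eigenvector[of "x - s" \<i>] dom_diff assms s(1) S_dom by blast
  then have "x = s + sc c (\<Phi> \<i>)" by (simp add: algebra_simps)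
  then show ?thesis using that s(1) by blast
qed

text \<open>The form vanishes on S, and the domain is S plus one direction, so for u in S the value
  \<open>bf u y\<close> depends on y only through one coefficient. All functionals arising from S
  are thus multiples of the one given by \<open>s0\<close>, the S-component of \<Phi>(-\<i>),
  provided that one is nonzero.\<close>

lemma bf_expansion:
  assumes x: "x \<in> domD"
  shows "\<exists>\<alpha> \<beta>. \<forall>y\<in>domD. bf x y = \<alpha> * bf (\<Phi> \<i>) y + \<beta> * bf (\<Phi> (- \<i>)) y"
proof -
  obtain s c where s: "s \<in> S" "x = s + sc c (\<Phi> \<i>)" using dom_decomposition[OF x] by blast
  obtain s0 \<kappa> where s0: "s0 \<in> S" "\<Phi> (- \<i>) = s0 + sc \<kappa> (\<Phi> \<i>)"
    using dom_decomposition[OF \<Phi>_dom[of "- \<i>"]] by blast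
  \<comment> \<open>Otherwise the restriction would have an eigenvector at the non-real point
    -\<i>.\<close>
  have "\<kappa> \<noteq> 0"
  proof
    assume "\<kappa> = 0"
    then have "\<Phi> (- \<i>) \<in> S" using s0 by simp
    from S_lower_bound[OF this, of "- \<i>"] show False using \<Phi>_nonzero by (simp add: D_\<Phi>)
  qed
  have b0: "bf s0 y = bf (\<Phi> (- \<i>)) y - \<kappa> * bf (\<Phi> \<i>) y" for y
    unfolding s0(2) using S_dom[OF s0(1)] by (simp add: bf_add_left bf_sc_left dom_sc \<Phi>_dom)
  \<comment> \<open>The eigenvectors at \<i> and -\<i> are orthogonal for the form: the factor a -
    \<open>cnj b\<close> is zero at a = -\<i>, b = \<i>.\<close>
  have "bf s0 (\<Phi> \<i>) = - \<kappa> * (2 * \<i> * ip (\<Phi> \<i>) (\<Phi> \<i>))"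
    unfolding b0 by (simp add: bf_\<Phi>)
  then have n0: "bf s0 (\<Phi> \<i>) \<noteq> 0" using \<open>\<kappa> \<noteq> 0\<close> \<Phi>_nonzero by simp
  define t where "t = bf s (\<Phi> \<i>) / bf s0 (\<Phi> \<i>)"
  have "bf x y = (c - t * \<kappa>) * bf (\<Phi> \<i>) y + t * bf (\<Phi> (- \<i>)) y" if y: "y \<in> domD" for y
  proof -
    obtain s' c' where s': "s' \<in> S" "y = s' + sc c' (\<Phi> \<i>)" using dom_decomposition[OF y] by blast
    have r: "bf u y = cnj c' * bf u (\<Phi> \<i>)" if "u \<in> S" for u
      unfolding s'(2) using S_dom[OF s'(1)] bf_S[OF that s'(1)]
      by (simp add: bf_add_right bf_sc_right dom_sc \<Phi>_dom)
    have "bf s y = t * bf s0 y" using r[OF s(1)] r[OF s0(1)] n0 by (simp add: t_def)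
    moreover have "bf x y = bf s y + c * bf (\<Phi> \<i>) y"
      unfolding s(2) using S_dom[OF s(1)] by (simp add: bf_add_left bf_sc_left dom_sc \<Phi>_dom)
    ultimately show ?thesis unfolding b0 by (simp add: algebra_simps)
  qed
  then show ?thesis by blast
qed

text \<open>Up to the sign -1 these are the boundary forms of \<Phi>(-\<i>) and \<Phi>(\<i>) with
  \<Phi>(\<open>cnj z\<close>); the conjugate makes them entire in z. Dividing by the norms accounts
  for the form taking the values -2\<i>|\<Phi>(-\<i>)|^2 and 2\<i>|\<Phi>(\<i>)|^2 on the diagonal,
  and \<open>sqrt pi\<close> produces the factor 2 pi of the de Branges kernel.\<close>

definition E0 where "E0 z = complex_of_real (sqrt pi / norm (\<Phi> (- \<i>))) * ((z + \<i>) * ip (\<Phi> (- \<i>)) (\<Phi> (cnj z)))"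
definition F0 where "F0 z = complex_of_real (sqrt pi / norm (\<Phi> \<i>)) * ((z - \<i>) * ip (\<Phi> \<i>) (\<Phi> (cnj z)))"

lemma ip_\<Phi>_holomorphic: "(\<lambda>z. ip x (\<Phi> (cnj z))) holomorphic_on UNIV"
proof -
  have "(\<lambda>z. ip x (\<Phi> (cnj z))) = sharp (\<lambda>w. ip (\<Phi> w) x)"
    unfolding sharp_def using ip_commute by metis
  then show ?thesis
    unfolding \<Phi>_def by (simp add: sharp_holomorphic res_holomorphic)
qed

lemma E0_holomorphic: "E0 holomorphic_on UNIV" and F0_holomorphic: "F0 holomorphic_on UNIV"
  unfolding E0_def[abs_def] F0_def[abs_def] by (intro holomorphic_intros ip_\<Phi>_holomorphic)+

text \<open>Expanding the form at \<Phi>(\<open>cnj w\<close>) leaves two unknown coefficients.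
  Testing against \<Phi>(\<i>) and \<Phi>(-\<i>) determines them separately by orthogonality, and
  testing against \<Phi>(\<open>cnj z\<close>) gives the identity.\<close>

lemma kernel_identity:
  "2 * pi * (z - cnj w) * ip (\<Phi> (cnj w)) (\<Phi> (cnj z)) = \<i> * (cnj (E0 w) * E0 z - cnj (F0 w) * F0 z)"
proof -
  define x y where "x = \<Phi> (cnj w)" and "y = \<Phi> (cnj z)"
  obtain \<alpha> \<beta> where e: "\<And>y. y \<in> domD \<Longrightarrow> bf x y = \<alpha> * bf (\<Phi> \<i>) y + \<beta> * bf (\<Phi> (- \<i>)) y"
    using bf_expansion[OF \<Phi>_dom[of "cnj w"]] unfolding x_def by blast
  define n1 n2 where "n1 = complex_of_real (norm (\<Phi> \<i>))" and "n2 = complex_of_real (norm (\<Phi> (- \<i>)))"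
  have n: "n1 \<noteq> 0" "n2 \<noteq> 0" using \<Phi>_nonzero by (simp_all add: n1_def n2_def)
  have ss: "ip (\<Phi> \<i>) (\<Phi> \<i>) = n1 * n1" "ip (\<Phi> (- \<i>)) (\<Phi> (- \<i>)) = n2 * n2"
    by (simp_all add: ip_self n1_def n2_def power2_eq_square)
  have a: "(cnj w + \<i>) * ip x (\<Phi> \<i>) = \<alpha> * (2 * \<i> * (n1 * n1))"
    using e[OF \<Phi>_dom[of \<i>]] by (simp add: x_def bf_\<Phi> ss)
  have b: "(cnj w - \<i>) * ip x (\<Phi> (- \<i>)) = \<beta> * (- (2 * \<i> * (n2 * n2)))"
    using e[OF \<Phi>_dom[of "- \<i>"]] by (simp add: x_def bf_\<Phi> ss)
  have c: "(cnj w - z) * ip x y = \<alpha> * ((\<i> - z) * ip (\<Phi> \<i>) y) + \<beta> * ((- \<i> - z) * ip (\<Phi> (- \<i>)) y)"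
    using e[OF \<Phi>_dom[of "cnj z"]] by (simp add: x_def y_def bf_\<Phi>)
  have sp: "complex_of_real (sqrt pi) * complex_of_real (sqrt pi) = complex_of_real pi"
    by (simp flip: of_real_mult)
  have F: "cnj (F0 w) = complex_of_real (sqrt pi) / n1 * ((cnj w + \<i>) * ip x (\<Phi> \<i>))"
    "F0 z = complex_of_real (sqrt pi) / n1 * ((z - \<i>) * ip (\<Phi> \<i>) y)"
    unfolding F0_def n1_def x_def y_def ip_commute[of "\<Phi> \<i>" "\<Phi> (cnj w)"] by simp_all
  have E: "cnj (E0 w) = complex_of_real (sqrt pi) / n2 * ((cnj w - \<i>) * ip x (\<Phi> (- \<i>)))"
    "E0 z = complex_of_real (sqrt pi) / n2 * ((z + \<i>) * ip (\<Phi> (- \<i>)) y)"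
    unfolding E0_def n2_def x_def y_def ip_commute[of "\<Phi> (- \<i>)" "\<Phi> (cnj w)"] by simp_all
  have EE: "cnj (E0 w) * E0 z = - (2 * \<i>) * complex_of_real pi * (\<beta> * ((z + \<i>) * ip (\<Phi> (- \<i>)) y))"
    unfolding E b sp[symmetric] using n by (simp add: field_simps)
  have FF: "cnj (F0 w) * F0 z = 2 * \<i> * complex_of_real pi * (\<alpha> * ((z - \<i>) * ip (\<Phi> \<i>) y))"
    unfolding F a sp[symmetric] using n by (simp add: field_simps)
  have "2 * pi * (z - cnj w) * ip x y = - (2 * complex_of_real pi) * ((cnj w - z) * ip x y)"
    by (simp add: algebra_simps)
  also have "\<dots> = \<i> * (cnj (E0 w) * E0 z - cnj (F0 w) * F0 z)"
    unfolding c EE FF by (simp add: algebra_simps)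
  finally show ?thesis unfolding x_def y_def .
qed

lemma modulus_identity: "(cmod (E0 z))\<^sup>2 - (cmod (F0 z))\<^sup>2 = 4 * pi * Im z * (norm (\<Phi> (cnj z)))\<^sup>2"
proof -
  have "\<i> * complex_of_real ((cmod (E0 z))\<^sup>2 - (cmod (F0 z))\<^sup>2) = \<i> * (cnj (E0 z) * E0 z - cnj (F0 z) * F0 z)"
    using complex_norm_square[of "E0 z"] complex_norm_square[of "F0 z"] by (simp add: mult.commute)
  also have "\<dots> = 2 * pi * (z - cnj z) * ip (\<Phi> (cnj z)) (\<Phi> (cnj z))"
    by (rule kernel_identity[symmetric])
  also have "\<dots> = \<i> * complex_of_real (4 * pi * Im z * (norm (\<Phi> (cnj z)))\<^sup>2)"
    unfolding complex_diff_cnj ip_self by (simp add: mult_ac)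
  finally show ?thesis
    by (metis mult_cancel_left complex_i_not_zero of_real_eq_iff)
qed

text \<open>The kernel identity at w = \<open>cnj z\<close>, where the factor z -
  \<open>cnj w\<close> is zero.\<close>

lemma sharp_product: "E0 z * sharp E0 z = F0 z * sharp F0 z"
  using kernel_identity[of z "cnj z"] by (simp add: sharp_def mult.commute)

text \<open>A real zero t of E0 is one of F0 too, as their moduli agree there. Then the kernel at t
  vanishes above the axis, hence everywhere, contradicting its positive value |\<Phi>(t)|^2 at
  t.\<close>

lemma E0_real_nonzero: "E0 (complex_of_real t) \<noteq> 0"
proof
  assume E: "E0 (complex_of_real t) = 0"
  then have F: "F0 (complex_of_real t) = 0" using modulus_identity[of "complex_of_real t"] by simp
  have "ip (\<Phi> (complex_of_real t)) (\<Phi> (cnj w)) = 0" if w: "Im w > 0" for w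
  proof -
    have "cnj w \<noteq> complex_of_real t" using w by (auto simp: complex_eq_iff)
    then have "w - complex_of_real t \<noteq> 0" using w by (auto simp: complex_eq_iff)
    then show ?thesis using kernel_identity[of w "complex_of_real t"] E F by simp
  qed
  then have "ip (\<Phi> (complex_of_real t)) (\<Phi> (cnj (complex_of_real t))) = 0"
    using entire_eq_on_upper_half_plane[OF ip_\<Phi>_holomorphic[of "\<Phi> (complex_of_real t)"] holomorphic_on_const[of 0 UNIV], of "complex_of_real t"] by blast
  then show False using \<Phi>_nonzero by simp
qed

lemma E0_nonzero: "Im z \<ge> 0 \<Longrightarrow> E0 z \<noteq> 0" and F0_nonzero: "Im z \<le> 0 \<Longrightarrow> F0 z \<noteq> 0"
proof -
  have p: "(norm (\<Phi> (cnj z)))\<^sup>2 > 0" using \<Phi>_nonzero by simp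
  have r: "E0 z \<noteq> 0 \<and> F0 z \<noteq> 0" if "Im z = 0"
  proof -
    have "complex_of_real (Re z) = z" using that by (simp add: complex_eq_iff)
    then have "E0 z \<noteq> 0" using E0_real_nonzero[of "Re z"] by simp
    then show ?thesis using modulus_identity[of z] that by auto
  qed
  show "E0 z \<noteq> 0" if "Im z \<ge> 0"
  proof (cases "Im z = 0")
    case False
    then have "4 * pi * Im z * (norm (\<Phi> (cnj z)))\<^sup>2 > 0" using that p by simp
    then have "(cmod (E0 z))\<^sup>2 > 0"
      unfolding modulus_identity[symmetric] using zero_le_power2[of "cmod (F0 z)"] by argo
    then show ?thesis by auto
  qed (use r in blast)
  show "F0 z \<noteq> 0" if "Im z \<le> 0"
  proof (cases "Im z = 0")
    case False
    then have "4 * pi * Im z * (norm (\<Phi> (cnj z)))\<^sup>2 < 0" using that p by (simp add: mult_less_0_iff mult_pos_neg)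
    then have "(cmod (F0 z))\<^sup>2 > 0"
      unfolding modulus_identity[symmetric] using zero_le_power2[of "cmod (E0 z)"] by argo
    then show ?thesis by auto
  qed (use r in blast)
qed

text \<open>Zeros of E0 lie strictly below the axis and those of F0 strictly above it, so the two
  quotients together cover the plane; by \<open>sharp_product\<close> they agree where both are
  defined. On the half-plane where each is used its numerator has no zeros either.\<close>

definition G where "G z = (if E0 z \<noteq> 0 then sharp F0 z / E0 z else sharp E0 z / F0 z)"

lemma E0_or_F0_nonzero: "E0 z \<noteq> 0 \<or> F0 z \<noteq> 0"
  using E0_nonzero F0_nonzero by (metis linorder_linear)

lemma G_eq: "F0 z \<noteq> 0 \<Longrightarrow> G z = sharp E0 z / F0 z"
  using sharp_product[of z] by (auto simp: G_def field_simps)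

text \<open>This relation turns F0 into the reflection of E0 once both are multiplied by a square
  root of G.\<close>

lemma sharp_E0_eq: "sharp E0 z = G z * F0 z"
proof (cases "F0 z = 0")
  case True
  then have "E0 z \<noteq> 0" using E0_or_F0_nonzero by blast
  then show ?thesis using True sharp_product[of z] by simp
qed (simp add: G_eq)

lemma G_holomorphic: "G holomorphic_on UNIV"
proof -
  have oE: "open {z. E0 z \<noteq> 0}" and oF: "open {z. F0 z \<noteq> 0}"
    by (intro open_Collect_neq continuous_on_const holomorphic_on_imp_continuous_on E0_holomorphic F0_holomorphic)+
  have "G holomorphic_on {z. E0 z \<noteq> 0}"
  proof (rule holomorphic_transform)
    show "(\<lambda>z. sharp F0 z / E0 z) holomorphic_on {z. E0 z \<noteq> 0}"
      by (intro holomorphic_intros holomorphic_on_subset[OF E0_holomorphic] holomorphic_on_subset[OF sharp_holomorphic[OF F0_holomorphic]]) auto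
  qed (simp add: G_def)
  moreover have "G holomorphic_on {z. F0 z \<noteq> 0}"
  proof (rule holomorphic_transform)
    show "(\<lambda>z. sharp E0 z / F0 z) holomorphic_on {z. F0 z \<noteq> 0}"
      by (intro holomorphic_intros holomorphic_on_subset[OF F0_holomorphic] holomorphic_on_subset[OF sharp_holomorphic[OF E0_holomorphic]]) auto
  qed (simp add: G_eq)
  ultimately have "G holomorphic_on ({z. E0 z \<noteq> 0} \<union> {z. F0 z \<noteq> 0})"
    by (intro holomorphic_on_Un oE oF)
  moreover have "{z. E0 z \<noteq> 0} \<union> {z. F0 z \<noteq> 0} = UNIV" using E0_or_F0_nonzero by auto
  ultimately show ?thesis by simp
qed

lemma G_nonzero: "G z \<noteq> 0"
proof (cases "Im z \<ge> 0")
  case True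
  then have "F0 (cnj z) \<noteq> 0" by (intro F0_nonzero) simp
  then show ?thesis using E0_nonzero[OF True] by (simp add: G_def sharp_def)
next
  case False
  then have "E0 (cnj z) \<noteq> 0" by (intro E0_nonzero) simp
  then show ?thesis using F0_nonzero[of z] False by (simp add: G_eq sharp_def)
qed

text \<open>The modulus identity at z bounds E0 from below, and at \<open>cnj z\<close> it bounds
  \<open>sharp F0\<close>. In both cases 4 pi is weakened to 1 and the lower bound on eigenvectors
  is inserted.\<close>

lemma G_exponential:
  obtains \<beta> \<gamma> :: real where "\<And>z. G z = exp (\<i> * (complex_of_real \<beta> * z + complex_of_real \<gamma>))"
proof -
  obtain g where g: "g holomorphic_on UNIV" "\<And>z. G z = exp (g z)"
    using contractible_imp_holomorphic_log[OF G_holomorphic contractible_UNIV] G_nonzero by (metis UNIV_I)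
  obtain c where c: "c > 0" "\<And>w. c \<le> norm (\<Phi> w) * (1 + cmod w)" using \<Phi>_lower_bound by blast
  have key: "c * sqrt y \<le> a * (1 + r)"
    if "y > 0" "a \<ge> 0" "r \<ge> 0" "4 * pi * y * (norm x)\<^sup>2 \<le> a\<^sup>2" "c \<le> norm x * (1 + r)" for y a r and x :: 'h
  proof -
    have "(sqrt y * norm x)\<^sup>2 = y * (norm x)\<^sup>2" using that by (simp add: power_mult_distrib)
    also have "\<dots> \<le> (4 * pi) * (y * (norm x)\<^sup>2)"
      using that pi_ge_two mult_right_mono[of 1 "4 * pi" "y * (norm x)\<^sup>2"] by simp
    also have "\<dots> \<le> a\<^sup>2" using that by (simp add: mult.assoc)
    finally have "sqrt y * norm x \<le> a" by (rule power2_le_imp_le) (rule that(2))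
    then have "sqrt y * norm x * (1 + r) \<le> a * (1 + r)" using that(3) by (intro mult_right_mono) simp_all
    moreover have "c * sqrt y \<le> norm x * (1 + r) * sqrt y" using that(1,5) by (intro mult_right_mono) simp_all
    ultimately show ?thesis by (simp add: mult_ac)
  qed
  obtain \<beta> \<gamma> :: real where "\<And>z. g z = \<i> * (complex_of_real \<beta> * z + complex_of_real \<gamma>)"
  proof (rule zero_free_quotient_linear_exponent[OF g(1) _ _ c(1), of E0 "sharp F0"])
    fix t
    have "cmod (E0 (complex_of_real t)) = cmod (F0 (complex_of_real t))"
      using modulus_identity[of "complex_of_real t"] by (simp add: power2_eq_iff_nonneg)
    then have "cmod (G (complex_of_real t)) = 1"
      using E0_real_nonzero[of t] by (auto simp: G_def sharp_def norm_divide)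
    then show "Re (g (complex_of_real t)) = 0" unfolding g(2) norm_exp_eq_Re by simp
  next
    show "E0 holomorphic_on {z. Im z > 0}" using E0_holomorphic holomorphic_on_subset by blast
  next
    fix z :: complex assume z: "Im z > 0"
    show "c * sqrt (Im z) \<le> cmod (E0 z) * (1 + cmod z)"
    proof (rule key[OF z])
      show "4 * pi * Im z * (norm (\<Phi> (cnj z)))\<^sup>2 \<le> (cmod (E0 z))\<^sup>2"
        using modulus_identity[of z] zero_le_power2[of "cmod (F0 z)"] by argo
      show "c \<le> norm (\<Phi> (cnj z)) * (1 + cmod z)" using c(2)[of "cnj z"] by simp
    qed auto
    show "c * sqrt (Im z) \<le> cmod (sharp F0 z) * (1 + cmod z)"
    proof (rule key[OF z])
      have "(cmod (E0 (cnj z)))\<^sup>2 - (cmod (F0 (cnj z)))\<^sup>2 = - (4 * pi * Im z * (norm (\<Phi> z))\<^sup>2)"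
        using modulus_identity[of "cnj z"] by simp
      then show "4 * pi * Im z * (norm (\<Phi> z))\<^sup>2 \<le> (cmod (sharp F0 z))\<^sup>2"
        using zero_le_power2[of "cmod (E0 (cnj z))"] unfolding sharp_def complex_mod_cnj by argo
      show "c \<le> norm (\<Phi> z) * (1 + cmod z)" by (rule c(2))
    qed auto
    show "exp (g z) = sharp F0 z / E0 z"
      unfolding g(2)[symmetric] G_def using E0_nonzero[of z] z by simp
  qed (rule that)
  then show ?thesis using that g(2) by metis
qed

text \<open>Normalise x to a multiple of \<phi>0 with <x, \<phi>0> = 1 and let y be the adjoint of V
  applied to x; then pair x with the equation \<Phi> = \<phi>0 + wV\<Phi>. The purpose is regularity
  of E.\<close>

lemma constant_one_representation:
  obtains x y where "\<And>z. ip x (\<Phi> (cnj z)) - z * ip y (\<Phi> (cnj z)) = 1"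
proof -
  define x where "x = sc (1 / complex_of_real ((norm \<phi>0)\<^sup>2)) \<phi>0"
  have x: "ip x \<phi>0 = 1" using \<phi>0 by (simp add: x_def ip_sc_left ip_self)
  obtain y where y: "\<And>u. ip (V u) x = ip u y" using V_adjoint by blast
  have "ip x (\<Phi> (cnj z)) - z * ip y (\<Phi> (cnj z)) = 1" for z
  proof -
    have "ip x (\<Phi> (cnj z)) = ip x (\<phi>0 + sc (cnj z) (V (\<Phi> (cnj z))))"
      using \<Phi>_eq[of "cnj z"] by simp
    also have "\<dots> = 1 + z * ip x (V (\<Phi> (cnj z)))"
      by (simp add: ip_add_right ip_sc_right x)
    also have "ip x (V (\<Phi> (cnj z))) = ip y (\<Phi> (cnj z))"
      using y ip_commute by metis
    finally show ?thesis by simp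
  qed
  then show ?thesis by (rule that)
qed

end

section \<open>The de Branges model\<close>

context hermite_biehler_no_real_zeros
begin

text \<open>Above the axis |z + \<i>| is at least 1 and at least |z|, so the lower bound on p - zq
  gives 1/|z + \<i>| \<le> |p| + |q|. Leaving p and q general allows transforms as well as their
  reflections.\<close>

lemma regular_HB_criterion:
  assumes p: "hardy_bound (\<lambda>z. p z / E z) A" and q: "hardy_bound (\<lambda>z. q z / E z) B"
    and ge: "\<And>z. Im z > 0 \<Longrightarrow> 1 \<le> cmod (p z - z * q z)"
  shows "regular_HB E"
  unfolding regular_HB_def H2_upper_def
proof (intro conjI allI impI exI)
  have zi: "cmod (z + \<i>) \<ge> 1" "cmod (z + \<i>) \<ge> cmod z" if "Im z > 0" for z
  proof -
    show "cmod (z + \<i>) \<ge> 1" using abs_Im_le_cmod[of "z + \<i>"] that by simp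
    have "(cmod z)\<^sup>2 \<le> (cmod (z + \<i>))\<^sup>2"
      using that by (simp add: cmod_power2 power_mono)
    then show "cmod (z + \<i>) \<ge> cmod z" by (rule power2_le_imp_le) simp
  qed
  have nz: "(z + \<i>) * E z \<noteq> 0" if "Im z > 0" for z
    using E_nonzero[of z] zi(1)[OF that] that by auto
  have le: "(cmod (1 / ((z + \<i>) * E z)))\<^sup>2 \<le> 2 * (cmod (p z / E z))\<^sup>2 + 2 * (cmod (q z / E z))\<^sup>2" if z: "Im z > 0" for z
  proof -
    have "1 \<le> cmod (p z) + cmod z * cmod (q z)"
      using ge[OF z] norm_triangle_ineq4[of "p z" "z * q z"] by (simp add: norm_mult)
    also have "\<dots> \<le> cmod (z + \<i>) * cmod (p z) + cmod (z + \<i>) * cmod (q z)"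
      using mult_right_mono[OF zi(1)[OF z], of "cmod (p z)"] by (intro add_mono mult_right_mono zi z) auto
    finally have "1 \<le> (cmod (p z) + cmod (q z)) * cmod (z + \<i>)" by (simp add: algebra_simps)
    moreover have "cmod (z + \<i>) > 0" using zi(1)[OF z] by linarith
    ultimately have "1 / cmod (z + \<i>) \<le> cmod (p z) + cmod (q z)"
      by (simp add: pos_divide_le_eq)
    then have "1 / cmod (z + \<i>) / cmod (E z) \<le> (cmod (p z) + cmod (q z)) / cmod (E z)"
      by (rule divide_right_mono) simp
    then have "cmod (1 / ((z + \<i>) * E z)) \<le> cmod (p z / E z) + cmod (q z / E z)"
      by (simp add: norm_divide norm_mult add_divide_distrib)
    then have "(cmod (1 / ((z + \<i>) * E z)))\<^sup>2 \<le> (cmod (p z / E z) + cmod (q z / E z))\<^sup>2"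
      by (rule power_mono) simp
    also have "\<dots> \<le> 2 * (cmod (p z / E z))\<^sup>2 + 2 * (cmod (q z / E z))\<^sup>2"
      using sum_prod_le[of "cmod (p z / E z)" "cmod (q z / E z)"] by (simp add: power2_sum)
    finally show ?thesis .
  qed
  show hol: "(\<lambda>z. 1 / ((z + \<i>) * E z)) holomorphic_on {z. 0 < Im z}"
    using nz by (intro holomorphic_intros holomorphic_on_subset[OF E_entire]) auto
  fix y :: real assume y: "0 < y"
  let ?b = "\<lambda>x. 2 * (cmod (p (Complex x y) / E (Complex x y)))\<^sup>2 + 2 * (cmod (q (Complex x y) / E (Complex x y)))\<^sup>2"
  have ib: "integrable lborel ?b"
    using hardy_bound_integrable(1)[OF p, of y] hardy_bound_integrable(1)[OF q, of y] y by simp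
  have "continuous_on UNIV (\<lambda>x. 1 / ((Complex x y + \<i>) * E (Complex x y)))"
    using continuous_on_line[OF holomorphic_on_imp_continuous_on[OF hol], of y] y by simp
  then have [measurable]: "(\<lambda>x. 1 / ((Complex x y + \<i>) * E (Complex x y))) \<in> borel_measurable borel"
    by (rule borel_measurable_continuous_onI)
  show i: "integrable lborel (\<lambda>x. (cmod (1 / ((Complex x y + \<i>) * E (Complex x y))))\<^sup>2)"
  proof (rule Bochner_Integration.integrable_bound[OF ib])
    show "AE x in lborel. norm ((cmod (1 / ((Complex x y + \<i>) * E (Complex x y))))\<^sup>2) \<le> norm (?b x)"
    proof (rule AE_I2)
      fix x show "norm ((cmod (1 / ((Complex x y + \<i>) * E (Complex x y))))\<^sup>2) \<le> norm (?b x)"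
        using le[of "Complex x y"] y by simp
    qed
  qed measurable
  have "(LINT x|lborel. (cmod (1 / ((Complex x y + \<i>) * E (Complex x y))))\<^sup>2) \<le> (LINT x|lborel. ?b x)"
    by (rule integral_mono[OF i ib]) (use le y in simp)
  also have "\<dots> = 2 * (LINT x|lborel. (cmod (p (Complex x y) / E (Complex x y)))\<^sup>2) + 2 * (LINT x|lborel. (cmod (q (Complex x y) / E (Complex x y)))\<^sup>2)"
    using hardy_bound_integrable(1)[OF p, of y] hardy_bound_integrable(1)[OF q, of y] y by simp
  also have "\<dots> \<le> 2 * A + 2 * B"
    using hardy_bound_integrable(2)[OF p, of y] hardy_bound_integrable(2)[OF q, of y] y by simp
  finally show "(LINT x|lborel. (cmod (1 / ((Complex x y + \<i>) * E (Complex x y))))\<^sup>2) \<le> 2 * A + 2 * B" .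
qed

end

context admissible_pair
begin

theorem de_branges_model:
  "\<exists>E (\<alpha>::real). hermite_biehler E \<and> regular_HB E \<and> (\<forall>t::real. E (complex_of_real t) \<noteq> 0) \<and>
    (\<lambda>x z. exp (\<i> * complex_of_real \<alpha> * z) * gen_fourier sc ip V \<phi>0 x z) ` UNIV = de_branges E \<and>
    (\<forall>x. de_branges_norm E (\<lambda>z. exp (\<i> * complex_of_real \<alpha> * z) * gen_fourier sc ip V \<phi>0 x z) = norm x)"
proof -
  obtain \<beta> \<gamma> :: real where G: "\<And>z. G z = exp (\<i> * (complex_of_real \<beta> * z + complex_of_real \<gamma>))"
    using G_exponential by blast
  \<comment> \<open>Half of the exponent of G: \<open>c * e z\<close> is an entire square root of
    G.\<close>
  define \<alpha> where "\<alpha> = \<beta> / 2"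
  define e where "e z = exp (\<i> * complex_of_real \<alpha> * z)" for z
  define c where "c = exp (\<i> * complex_of_real (\<gamma> / 2))"
  have c: "cnj c * c = 1"
    by (simp add: c_def exp_cnj flip: exp_add)
  define E where "E z = c * e z * E0 z" for z
  \<comment> \<open>The reflection of \<open>c * e z\<close> is its inverse, so
    \<open>sharp E\<close> is that inverse times G times F0, which is again \<open>c * e z\<close>
    times F0.\<close>
  have sE: "sharp E z = c * e z * F0 z" for z
  proof -
    have "sharp E z = exp (- (\<i> * complex_of_real (\<gamma> / 2))) * exp (- (\<i> * complex_of_real \<alpha> * z)) * sharp E0 z"
      by (simp add: sharp_def E_def c_def e_def exp_cnj)
    also have "\<dots> = exp (- (\<i> * complex_of_real (\<gamma> / 2)) + - (\<i> * complex_of_real \<alpha> * z) + \<i> * (complex_of_real \<beta> * z + complex_of_real \<gamma>)) * F0 z"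
      unfolding sharp_E0_eq G exp_add by (simp add: mult.assoc)
    also have "- (\<i> * complex_of_real (\<gamma> / 2)) + - (\<i> * complex_of_real \<alpha> * z) + \<i> * (complex_of_real \<beta> * z + complex_of_real \<gamma>)
        = \<i> * complex_of_real (\<gamma> / 2) + \<i> * complex_of_real \<alpha> * z"
      by (simp add: \<alpha>_def algebra_simps)
    finally show ?thesis by (simp add: c_def e_def exp_add)
  qed
  have ce: "c * e z \<noteq> 0" for z by (simp add: c_def e_def)
  have HB: "hermite_biehler E"
    unfolding hermite_biehler_def
  proof (intro conjI allI impI)
    show "E holomorphic_on UNIV"
      unfolding E_def[abs_def] e_def by (intro holomorphic_intros E0_holomorphic)
    fix z :: complex assume z: "Im z > 0"
    have "4 * pi * Im z * (norm (\<Phi> (cnj z)))\<^sup>2 > 0" using z \<Phi>_nonzero by simp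
    then have "(cmod (F0 z))\<^sup>2 < (cmod (E0 z))\<^sup>2"
      unfolding modulus_identity[symmetric] by simp
    then have "cmod (F0 z) < cmod (E0 z)" by (rule power_less_imp_less_base) simp
    then have "cmod (c * e z) * cmod (F0 z) < cmod (c * e z) * cmod (E0 z)"
      using ce[of z] by (intro mult_strict_left_mono) auto
    moreover have "cmod (E (cnj z)) = cmod (c * e z) * cmod (F0 z)"
      using sE[of z] by (metis complex_mod_cnj norm_mult sharp_def)
    moreover have "cmod (E z) = cmod (c * e z) * cmod (E0 z)"
      by (simp add: E_def norm_mult)
    ultimately show "cmod (E (cnj z)) < cmod (E z)" by simp
  qed
  have real: "E (complex_of_real t) \<noteq> 0" for t
    using ce E0_real_nonzero by (simp add: E_def)
  \<comment> \<open>The conjugate factor leaves the inner product as \<open>e z\<close>, so passing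
    to \<psi> multiplies every transform by the exponential.\<close>
  define \<psi> where "\<psi> z = sc (cnj (e z)) (\<Phi> (cnj z))" for z
  have ip_\<psi>: "ip x (\<psi> z) = e z * ip x (\<Phi> (cnj z))" for x z
    by (simp add: \<psi>_def ip_sc_right)
  interpret K: de_branges_kernel sc ip E \<psi>
  proof
    show "hermite_biehler E" by (rule HB)
    show "E (complex_of_real t) \<noteq> 0" for t by (rule real)
    show "x = 0" if x: "\<And>z. ip x (\<psi> z) = 0" for x
    proof (rule \<Phi>_total)
      fix w
      have "ip x (\<Phi> w) = 0" using x[of "cnj w"] by (simp add: ip_\<psi> e_def)
      then show "ip (\<Phi> w) x = 0" by (subst ip_commute) simp
    qed
    show "(\<lambda>z. ip x (\<psi> z)) holomorphic_on UNIV" for x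
      unfolding ip_\<psi> e_def by (intro holomorphic_intros ip_\<Phi>_holomorphic)
    fix w z
    have "ip (\<psi> w) (\<psi> z) = cnj (e w) * e z * ip (\<Phi> (cnj w)) (\<Phi> (cnj z))"
      unfolding ip_\<psi> by (simp add: \<psi>_def ip_sc_left)
    then have "2 * pi * (z - cnj w) * ip (\<psi> w) (\<psi> z)
        = cnj (e w) * e z * (2 * pi * (z - cnj w) * ip (\<Phi> (cnj w)) (\<Phi> (cnj z)))"
      by (simp add: mult_ac)
    \<comment> \<open>The unimodular constant is inserted to complete the factor
      \<open>c * e\<close> of E.\<close>
    also have "\<dots> = (cnj c * c) * (cnj (e w) * e z * (\<i> * (cnj (E0 w) * E0 z - cnj (F0 w) * F0 z)))"
      unfolding kernel_identity c by simp
    also have "\<dots> = \<i> * (cnj (E w) * E z - cnj (sharp E w) * sharp E z)"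
      unfolding sE by (simp add: E_def algebra_simps)
    finally show "2 * pi * (z - cnj w) * ip (\<psi> w) (\<psi> z) = \<i> * (cnj (E w) * E z - cnj (sharp E w) * sharp E z)" .
  qed
  have W: "K.W x z = e z * ip x (\<Phi> (cnj z))" for x z
    unfolding K.W_def ip_\<psi> ..
  obtain x y where one: "\<And>z. ip x (\<Phi> (cnj z)) - z * ip y (\<Phi> (cnj z)) = 1"
    using constant_one_representation by blast
  have W1: "K.W x z - z * K.W y z = e z" for z
  proof -
    have "K.W x z - z * K.W y z = e z * (ip x (\<Phi> (cnj z)) - z * ip y (\<Phi> (cnj z)))"
      unfolding W by (simp add: algebra_simps)
    then show ?thesis unfolding one by simp
  qed
  have ne: "cmod (e z) = exp (- \<alpha> * Im z)" for z
    by (simp add: e_def)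
  \<comment> \<open>The representation of 1 becomes one of \<open>e z\<close>, of modulus
    exp(-\<alpha> Im z), which is at least 1 above the axis only for \<alpha> \<le> 0. For \<alpha>
    > 0 the reflected transforms are used, where the exponent changes sign.\<close>
  have reg: "regular_HB E"
  proof (cases "\<alpha> \<le> 0")
    case True
    show ?thesis
      by (rule K.regular_HB_criterion[OF K.all_hardy(1)[of x] K.all_hardy(1)[of y]])
         (use True in \<open>simp add: W1 ne mult_nonpos_nonneg\<close>)
  next
    case False
    have "sharp (K.W x) z - z * sharp (K.W y) z = cnj (e (cnj z))" for z
      unfolding W1[symmetric] by (simp add: sharp_def)
    then show ?thesis
      using False by (intro K.regular_HB_criterion[OF K.all_hardy(2)[of x] K.all_hardy(2)[of y]])
         (simp add: ne)
  qed
  have gf: "(\<lambda>z. exp (\<i> * complex_of_real \<alpha> * z) * gen_fourier sc ip V \<phi>0 x z) = (\<lambda>z. ip x (\<psi> z))" for x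
    by (simp add: fun_eq_iff gen_fourier_def phi_eq ip_\<psi> e_def)
  show ?thesis
    using HB reg real K.range_eq_de_branges K.de_branges_norm_eq
    by (intro exI[of _ E] exI[of _ \<alpha>]) (simp only: gf simp_thms)
qed

end

theorem theorem4p2:
  fixes sc :: "complex \<Rightarrow> 'h::banach \<Rightarrow> 'h"
    and ip :: "'h \<Rightarrow> 'h \<Rightarrow> complex"
    and domD :: "'h set" and D V :: "'h \<Rightarrow> 'h" and \<phi>0 :: 'h
  assumes "complex_hilbert sc ip"
    and "separable_space TYPE('h)"
    and "admissible sc ip domD D V"
    and "\<phi>0 \<in> domD" and "\<phi>0 \<noteq> 0" and "D \<phi>0 = 0"
  shows "\<exists>(E::complex \<Rightarrow> complex) (\<alpha>::real).
           hermite_biehler E \<and> regular_HB E \<and> (\<forall>t::real. E (complex_of_real t) \<noteq> 0) \<and>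
           (\<lambda>x z. exp (\<i> * complex_of_real \<alpha> * z) * gen_fourier sc ip V \<phi>0 x z) ` UNIV
              = de_branges E \<and>
           (\<forall>x. de_branges_norm E (\<lambda>z. exp (\<i> * complex_of_real \<alpha> * z) * gen_fourier sc ip V \<phi>0 x z)
                 = norm x)"
proof -
  interpret admissible_pair sc ip domD D V \<phi>0
    by unfold_locales (use assms in auto)
  show ?thesis by (rule de_branges_model)
qed

end
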